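(* Let $(M,g)$ be a compact oriented surface with spin structure $S$. Suppose that $\psi_1,\dots,\psi_m$ are eigenspinors on $M$, $\psi_j=(\psi_{j+},\psi_{j-})$, with $\mathcal{D}_g\psi_j=\lambda\psi_j$ for all $j$, $\lambda\ne0$, and $|\psi_1|_g^2+\dots+|\psi_m|_g^2=1$ on $M$. Then the map $\Psi\colon M\to\mathbb{CP}^{2m-1}$ given in homogeneous coordinates by $$\Psi=[\psi_{1+}:\bar\psi_{1-}:\dots:\psi_{m+}:\bar\psi_{m-}]$$ is harmonic.
   Context: The orientation and $g$ give $M$ a complex structure; $K=(T^{(1,0)}M)^*$ is the canonical bundle. A spin structure is a holomorphic line bundle $S$ with a holomorphic isomorphism $S\otimes S\cong K$; the spinor bundle is $S\oplus\bar S$. The metric $g=\mathrm{Re}(h)$, with $h$ Hermitian, induces a Hermitian metric on $S$ by $|s|_g^2=|s\otimes s|_h$. If $z=x+iy$ is a local holomorphic coordinate and $s_0$ is a local section of $S$ with $s_0\otimes s_0=dz$, then $g=|s_0|_g^{-4}(dx^2+dy^2)$. The Dirac operator is $\mathcal{D}_g(\psi_+,\psi_-)=2(\partial_g\psi_-,\,-\bar\partial_g\psi_+)$, where locally $\bar\partial_g(fs_0)=|s_0|_g^2(\partial_{\bar z}f)\bar s_0$ and $\partial_g(f\bar s_0)=|s_0|_g^2(\partial_zf)s_0$. For $\psi=(\psi_+,\psi_-)$, $|\psi|_g^2=|\psi_+|_g^2+|\psi_-|_g^2$. For spinors $\psi_j=(\psi_{j+},\psi_{j-})$, $\psi_{j+}$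 and $\bar\psi_{j-}$ are sections of the same line bundle $S$, so the homogeneous coordinates define a point of $\mathbb{CP}^{2m-1}$ wherever the $\psi_j$ do not all vanish. $\mathbb{CP}^{2m-1}$ carries (a constant multiple of) the Fubini–Study metric. A map is harmonic if it is a critical point of the energy $E(\Psi)=\frac12\int_M|d\Psi|^2dv_g$. *)

theory Defs
  imports "HOL-Analysis.Analysis"
begin

section \<open>Smooth functions\<close>

text \<open>\<open>Ck n S f\<close>: on the open set \<open>S\<close>, all iterated directional derivatives of \<open>f\<close> up to
  order \<open>n\<close> exist (as directional derivatives of Frechet differentiable functions) and are
  continuous.\<close>

primrec Ck :: "nat \<Rightarrow> 'a::euclidean_space set \<Rightarrow> ('a \<Rightarrow> 'b::real_normed_vector) \<Rightarrow> bool" where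
  "Ck 0 S f \<longleftrightarrow> continuous_on S f"
| "Ck (Suc n) S f \<longleftrightarrow>
     (\<forall>x\<in>S. f differentiable (at x)) \<and> (\<forall>v. Ck n S (\<lambda>x. frechet_derivative f (at x) v))"

definition smooth_on :: "'a::euclidean_space set \<Rightarrow> ('a \<Rightarrow> 'b::real_normed_vector) \<Rightarrow> bool" where
  "smooth_on S f \<longleftrightarrow> (\<forall>n. Ck n S f)"


section \<open>Oriented surfaces with a Riemannian metric\<close>

text \<open>The surface is a Hausdorff type \<open>'a\<close>. A chart is a domain together with a map into the plane
  (identified with \<open>complex\<close> as an oriented real vector space); the map is irrelevant outside its
  domain.\<close>

type_synonym 'a chart = "'a set \<times> ('a \<Rightarrow> complex)"

definition chart_inv :: "'a chart \<Rightarrow> complex \<Rightarrow> 'a" where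
  "chart_inv c = inv_into (fst c) (snd c)"

definition is_chart :: "'a::t2_space chart \<Rightarrow> bool" where
  "is_chart c \<longleftrightarrow> open (fst c) \<and> open (snd c ` fst c) \<and>
     homeomorphism (fst c) (snd c ` fst c) (snd c) (chart_inv c)"

definition transition :: "'a chart \<Rightarrow> 'a chart \<Rightarrow> complex \<Rightarrow> complex" where
  "transition c c' = snd c' \<circ> chart_inv c"

text \<open>The Jacobian determinant of a map of the plane: the determinant of a real linear map \<open>L\<close> is
  the imaginary part of \<open>cnj (L 1) * L \<i>\<close>.\<close>

definition jacobian_det :: "(complex \<Rightarrow> complex) \<Rightarrow> complex \<Rightarrow> real" where
  "jacobian_det f z =
     Im (cnj (frechet_derivative f (at z) 1) * frechet_derivative f (at z) \<i>)"

definition oriented_compatible :: "'a chart \<Rightarrow> 'a chart \<Rightarrow> bool" where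
  "oriented_compatible c c' \<longleftrightarrow>
     smooth_on (snd c ` (fst c \<inter> fst c')) (transition c c') \<and>
     (\<forall>z \<in> snd c ` (fst c \<inter> fst c'). jacobian_det (transition c c') z > 0)"

text \<open>A maximal oriented smooth atlas.\<close>

definition oriented_smooth_structure :: "'a::t2_space chart set \<Rightarrow> bool" where
  "oriented_smooth_structure A \<longleftrightarrow>
     (\<forall>c\<in>A. is_chart c) \<and>
     (\<Union>c\<in>A. fst c) = UNIV \<and>
     (\<forall>c\<in>A. \<forall>c'\<in>A. oriented_compatible c c') \<and>
     (\<forall>c. is_chart c \<and> (\<forall>c'\<in>A. oriented_compatible c c' \<and> oriented_compatible c' c) \<longrightarrow> c \<in> A)"

text \<open>\<open>g c p v w\<close> is the inner product of the tangent vectors at \<open>p\<close> whose coordinate expressions in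
  the chart \<open>c\<close> are \<open>v\<close> and \<open>w\<close>.\<close>

type_synonym 'a surface_metric = "'a chart \<Rightarrow> 'a \<Rightarrow> complex \<Rightarrow> complex \<Rightarrow> real"

definition riemannian_metric :: "'a::t2_space chart set \<Rightarrow> 'a surface_metric \<Rightarrow> bool" where
  "riemannian_metric A g \<longleftrightarrow>
     (\<forall>c\<in>A. \<forall>p\<in>fst c. bilinear (g c p) \<and> (\<forall>v w. g c p v w = g c p w v) \<and>
        (\<forall>v. v \<noteq> 0 \<longrightarrow> g c p v v > 0)) \<and>
     (\<forall>c\<in>A. \<forall>v w. smooth_on (snd c ` fst c) (\<lambda>z. g c (chart_inv c z) v w)) \<and>
     (\<forall>c\<in>A. \<forall>c'\<in>A. \<forall>p \<in> fst c \<inter> fst c'. \<forall>v w.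
        g c p v w = g c' p (frechet_derivative (transition c c') (at (snd c p)) v)
                           (frechet_derivative (transition c c') (at (snd c p)) w))"

text \<open>The Riemannian measure \<open>dv\<^sub>g\<close>, given in each chart by the square root of the Gram determinant.
  This determines \<open>dv\<close> uniquely on a compact surface.\<close>

definition riemannian_measure ::
    "'a::t2_space chart set \<Rightarrow> 'a surface_metric \<Rightarrow> 'a measure \<Rightarrow> bool" where
  "riemannian_measure A g dv \<longleftrightarrow> sets dv = sets borel \<and>
     (\<forall>c\<in>A. \<forall>B\<in>sets borel. B \<subseteq> fst c \<longrightarrow>
        emeasure dv B =
          (\<integral>\<^sup>+ z \<in> snd c ` B.
             ennreal (let G = g c (chart_inv c z) in sqrt (G 1 1 * G \<i> \<i> - (G 1 \<i>)\<^sup>2)) \<partial>lborel))"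


section \<open>The complex structure, the canonical bundle\<close>

text \<open>The complex structure induced by \<open>g\<close> and the orientation: its local holomorphic coordinates
  are the oriented charts in which \<open>g\<close> is conformal to the Euclidean metric.\<close>

definition hol_charts :: "'a::t2_space chart set \<Rightarrow> 'a surface_metric \<Rightarrow> 'a chart set" where
  "hol_charts A g = {c \<in> A. \<forall>p\<in>fst c. \<exists>r. \<forall>v w. g c p v w = r * (v \<bullet> w)}"

definition hol_fun ::
    "'a::t2_space chart set \<Rightarrow> 'a surface_metric \<Rightarrow> 'a set \<Rightarrow> ('a \<Rightarrow> complex) \<Rightarrow> bool" where
  "hol_fun A g U f \<longleftrightarrow>
     (\<forall>c\<in>hol_charts A g. (f \<circ> chart_inv c) holomorphic_on (snd c ` (U \<inter> fst c)))"

definition smooth_fun :: "'a::t2_space chart set \<Rightarrow> 'a set \<Rightarrow> ('a \<Rightarrow> complex) \<Rightarrow> bool" where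
  "smooth_fun A U f \<longleftrightarrow> (\<forall>c\<in>A. smooth_on (snd c ` (U \<inter> fst c)) (f \<circ> chart_inv c))"

text \<open>An element of \<open>K\<close> at \<open>p\<close> is given by its coefficients: \<open>\<kappa> c\<close> is the coefficient with respect
  to \<open>dz\<close>, where \<open>z = snd c\<close> is a holomorphic coordinate near \<open>p\<close>.\<close>

type_synonym 'a covector = "'a chart \<Rightarrow> complex"

definition canonical_fibre ::
    "'a::t2_space chart set \<Rightarrow> 'a surface_metric \<Rightarrow> 'a \<Rightarrow> 'a covector set" where
  "canonical_fibre A g p =
     {\<kappa>. \<forall>c\<in>hol_charts A g. \<forall>c'\<in>hol_charts A g. p \<in> fst c \<inter> fst c' \<longrightarrow>
          \<kappa> c = \<kappa> c' * deriv (transition c c') (snd c p)}"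

text \<open>The norm on \<open>K\<close> dual to \<open>h\<close>, where \<open>g = Re h\<close>: since the real tangent vector \<open>\<partial>\<^sub>x\<close> has length
  \<open>sqrt (g c p 1 1)\<close> and corresponds to \<open>\<partial>\<^sub>z\<close>, the covector \<open>dz\<close> has the inverse length.\<close>

definition canonical_norm ::
    "'a::t2_space chart set \<Rightarrow> 'a surface_metric \<Rightarrow> 'a \<Rightarrow> 'a covector \<Rightarrow> real" where
  "canonical_norm A g p \<kappa> =
     (THE r. \<forall>c\<in>hol_charts A g. p \<in> fst c \<longrightarrow> r = cmod (\<kappa> c) / sqrt (g c p 1 1))"


section \<open>Line bundles and spin structures\<close>

text \<open>The type \<open>'s\<close> is the total space. The vector space structure of a complex line is determined
  by its scalar multiplication, so addition in the fibres is not part of the data. A frame is a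
  section over an open set spanning each fibre, i.e. a local trivialization.\<close>

record ('a, 's) line_bundle =
  proj :: "'s \<Rightarrow> 'a"
  scl :: "complex \<Rightarrow> 's \<Rightarrow> 's"
  frames :: "('a set \<times> ('a \<Rightarrow> 's)) set"

text \<open>\<open>coord L e s\<close> is the quotient \<open>s / e\<close> of two elements of the same fibre, \<open>e \<noteq> 0\<close>.\<close>

definition coord :: "('a, 's) line_bundle \<Rightarrow> 's \<Rightarrow> 's \<Rightarrow> complex" where
  "coord L e s = (THE a. s = scl L a e)"

definition nonzero :: "('a, 's) line_bundle \<Rightarrow> 's \<Rightarrow> bool" where
  "nonzero L s \<longleftrightarrow> s \<noteq> scl L 0 s"

definition line_bundle :: "('a::t2_space, 's) line_bundle \<Rightarrow> bool" where
  "line_bundle L \<longleftrightarrow>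
     (\<forall>a s. proj L (scl L a s) = proj L s) \<and>
     (\<forall>s. scl L 1 s = s) \<and>
     (\<forall>a b s. scl L (a * b) s = scl L a (scl L b s)) \<and>
     (\<forall>(U, e)\<in>frames L. open U \<and>
        (\<forall>p\<in>U. proj L (e p) = p \<and> (\<forall>s. proj L s = p \<longrightarrow> (\<exists>!a. s = scl L a (e p))))) \<and>
     (\<Union>(U, e)\<in>frames L. U) = UNIV"

definition holomorphic_line_bundle ::
    "'a::t2_space chart set \<Rightarrow> 'a surface_metric \<Rightarrow> ('a, 's) line_bundle \<Rightarrow> bool" where
  "holomorphic_line_bundle A g L \<longleftrightarrow> line_bundle L \<and>
     (\<forall>(U, e)\<in>frames L. \<forall>(U', e')\<in>frames L. hol_fun A g (U \<inter> U') (\<lambda>p. coord L (e p) (e' p)))"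

definition hol_section ::
    "'a::t2_space chart set \<Rightarrow> 'a surface_metric \<Rightarrow> ('a, 's) line_bundle \<Rightarrow>
     'a set \<Rightarrow> ('a \<Rightarrow> 's) \<Rightarrow> bool" where
  "hol_section A g L U s \<longleftrightarrow> (\<forall>p\<in>U. proj L (s p) = p) \<and>
     (\<forall>(V, e)\<in>frames L. hol_fun A g (U \<inter> V) (\<lambda>p. coord L (e p) (s p)))"

definition smooth_section ::
    "'a::t2_space chart set \<Rightarrow> ('a, 's) line_bundle \<Rightarrow> ('a \<Rightarrow> 's) \<Rightarrow> bool" where
  "smooth_section A L s \<longleftrightarrow> (\<forall>p. proj L (s p) = p) \<and>
     (\<forall>(V, e)\<in>frames L. smooth_fun A V (\<lambda>p. coord L (e p) (s p)))"

text \<open>A spin structure: a holomorphic line bundle \<open>S\<close> and a holomorphic isomorphism of \<open>S \<otimes> S\<close>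
  with \<open>K\<close>. The latter is given as the corresponding bilinear map \<open>\<theta>\<close>: the image of \<open>s \<otimes> t\<close> is the
  covector \<open>\<theta> s t\<close>. Bilinearity on complex lines is homogeneity in each argument, and injectivity
  on the fibres (hence bijectivity, as these are lines) is non-degeneracy.\<close>

definition spin_structure ::
    "'a::t2_space chart set \<Rightarrow> 'a surface_metric \<Rightarrow> ('a, 's) line_bundle \<Rightarrow>
     ('s \<Rightarrow> 's \<Rightarrow> 'a covector) \<Rightarrow> bool" where
  "spin_structure A g S \<theta> \<longleftrightarrow> holomorphic_line_bundle A g S \<and>
     (\<forall>s t. proj S s = proj S t \<longrightarrow> \<theta> s t \<in> canonical_fibre A g (proj S s)) \<and>
     (\<forall>s t. proj S s = proj S t \<longrightarrow>
        (\<forall>c\<in>hol_charts A g. proj S s \<in> fst c \<longrightarrow>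
           (\<forall>a b. \<theta> (scl S a s) (scl S b t) c = a * b * \<theta> s t c) \<and>
           (nonzero S s \<and> nonzero S t \<longrightarrow> \<theta> s t c \<noteq> 0))) \<and>
     (\<forall>(U, e)\<in>frames S. \<forall>c\<in>hol_charts A g. hol_fun A g (U \<inter> fst c) (\<lambda>p. \<theta> (e p) (e p) c))"

text \<open>The conjugate bundle has the same total space with conjugate scalar multiplication; \<open>Bar\<close> is
  the tautological antilinear map \<open>s \<mapsto> \<bar>s\<close> and \<open>unbar\<close> is its inverse.\<close>

datatype 's conjugate = Bar (unbar: 's)

definition conj_bundle :: "('a, 's) line_bundle \<Rightarrow> ('a, 's conjugate) line_bundle" where
  "conj_bundle L =
     \<lparr>proj = (\<lambda>s. proj L (unbar s)),
      scl = (\<lambda>a s. Bar (scl L (cnj a) (unbar s))),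
      frames = (\<lambda>(U, e). (U, \<lambda>p. Bar (e p))) ` frames L\<rparr>"

text \<open>The squared norm on \<open>S\<close>, and on the conjugate bundle by \<open>|\<bar>s| = |s|\<close>.\<close>

definition spin_norm_sq ::
    "'a::t2_space chart set \<Rightarrow> 'a surface_metric \<Rightarrow> ('a, 's) line_bundle \<Rightarrow>
     ('s \<Rightarrow> 's \<Rightarrow> 'a covector) \<Rightarrow> 's \<Rightarrow> real" where
  "spin_norm_sq A g S \<theta> s = canonical_norm A g (proj S s) (\<theta> s s)"


section \<open>Spinors and the Dirac operator\<close>

text \<open>A spinor field is a section \<open>p \<mapsto> (\<psi>\<^sub>+ p, \<psi>\<^sub>- p)\<close> of the sum of \<open>S\<close> and its conjugate.\<close>

type_synonym ('a, 's) spinor_field = "'a \<Rightarrow> 's \<times> 's conjugate"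

definition smooth_spinor ::
    "'a::t2_space chart set \<Rightarrow> ('a, 's) line_bundle \<Rightarrow> ('a, 's) spinor_field \<Rightarrow> bool" where
  "smooth_spinor A S \<psi> \<longleftrightarrow>
     smooth_section A S (fst \<circ> \<psi>) \<and> smooth_section A (conj_bundle S) (snd \<circ> \<psi>)"

definition spinor_norm_sq ::
    "'a::t2_space chart set \<Rightarrow> 'a surface_metric \<Rightarrow> ('a, 's) line_bundle \<Rightarrow>
     ('s \<Rightarrow> 's \<Rightarrow> 'a covector) \<Rightarrow> 's \<times> 's conjugate \<Rightarrow> real" where
  "spinor_norm_sq A g S \<theta> u =
     spin_norm_sq A g S \<theta> (fst u) + spin_norm_sq A g S \<theta> (unbar (snd u))"

definition spinor_scl ::
    "('a, 's) line_bundle \<Rightarrow> complex \<Rightarrow> 's \<times> 's conjugate \<Rightarrow> 's \<times> 's conjugate" where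
  "spinor_scl S a u = (scl S a (fst u), scl (conj_bundle S) a (snd u))"

text \<open>A holomorphic coordinate \<open>z\<close> together with a local section \<open>s\<^sub>0\<close> of \<open>S\<close> with
  \<open>s\<^sub>0 \<otimes> s\<^sub>0 = dz\<close>.\<close>

definition adapted ::
    "'a::t2_space chart set \<Rightarrow> 'a surface_metric \<Rightarrow> ('a, 's) line_bundle \<Rightarrow>
     ('s \<Rightarrow> 's \<Rightarrow> 'a covector) \<Rightarrow> 'a chart \<Rightarrow> ('a \<Rightarrow> 's) \<Rightarrow> bool" where
  "adapted A g S \<theta> c s0 \<longleftrightarrow> c \<in> hol_charts A g \<and> hol_section A g S (fst c) s0 \<and>
     (\<forall>p\<in>fst c. \<theta> (s0 p) (s0 p) c = 1)"

definition d_z :: "(complex \<Rightarrow> complex) \<Rightarrow> complex \<Rightarrow> complex" where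
  "d_z f z = (frechet_derivative f (at z) 1 - \<i> * frechet_derivative f (at z) \<i>) / 2"

definition d_zbar :: "(complex \<Rightarrow> complex) \<Rightarrow> complex \<Rightarrow> complex" where
  "d_zbar f z = (frechet_derivative f (at z) 1 + \<i> * frechet_derivative f (at z) \<i>) / 2"

definition dbar_op ::
    "'a::t2_space chart set \<Rightarrow> 'a surface_metric \<Rightarrow> ('a, 's) line_bundle \<Rightarrow>
     ('s \<Rightarrow> 's \<Rightarrow> 'a covector) \<Rightarrow> ('a \<Rightarrow> 's) \<Rightarrow> 'a \<Rightarrow> 's conjugate" where
  "dbar_op A g S \<theta> \<psi> p =
     (THE u. \<forall>c s0. adapted A g S \<theta> c s0 \<and> p \<in> fst c \<longrightarrow>
        (let f = (\<lambda>q. coord S (s0 q) (\<psi> q))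
         in u = scl (conj_bundle S)
                  (of_real (spin_norm_sq A g S \<theta> (s0 p)) * d_zbar (f \<circ> chart_inv c) (snd c p))
                  (Bar (s0 p))))"

definition del_op ::
    "'a::t2_space chart set \<Rightarrow> 'a surface_metric \<Rightarrow> ('a, 's) line_bundle \<Rightarrow>
     ('s \<Rightarrow> 's \<Rightarrow> 'a covector) \<Rightarrow> ('a \<Rightarrow> 's conjugate) \<Rightarrow> 'a \<Rightarrow> 's" where
  "del_op A g S \<theta> \<phi> p =
     (THE u. \<forall>c s0. adapted A g S \<theta> c s0 \<and> p \<in> fst c \<longrightarrow>
        (let f = (\<lambda>q. coord (conj_bundle S) (Bar (s0 q)) (\<phi> q))
         in u = scl S
                  (of_real (spin_norm_sq A g S \<theta> (s0 p)) * d_z (f \<circ> chart_inv c) (snd c p))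
                  (s0 p)))"

definition dirac ::
    "'a::t2_space chart set \<Rightarrow> 'a surface_metric \<Rightarrow> ('a, 's) line_bundle \<Rightarrow>
     ('s \<Rightarrow> 's \<Rightarrow> 'a covector) \<Rightarrow> ('a, 's) spinor_field \<Rightarrow> ('a, 's) spinor_field" where
  "dirac A g S \<theta> \<psi> =
     (\<lambda>p. (scl S 2 (del_op A g S \<theta> (snd \<circ> \<psi>) p),
           scl (conj_bundle S) (- 2) (dbar_op A g S \<theta> (fst \<circ> \<psi>) p)))"


section \<open>Complex projective space and harmonic maps\<close>

text \<open>A point of projective space is a complex line in \<open>complex ^ 'n\<close>; \<open>hcoord v\<close> is the point with
  homogeneous coordinates \<open>v \<noteq> 0\<close>.\<close>

definition hcoord :: "complex ^ 'n \<Rightarrow> (complex ^ 'n) set" where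
  "hcoord v = {w. \<exists>a. w = a *s v}"

text \<open>The squared Fubini--Study length of the image of the tangent vector \<open>w\<close> at \<open>v \<noteq> 0\<close> under the
  differential of \<open>hcoord\<close>: the quotient metric of the unit sphere, obtained by rescaling \<open>v\<close> to
  unit length and taking the component of \<open>w\<close> orthogonal to the complex line of \<open>v\<close>.\<close>

definition fubini_study_sq :: "complex ^ 'n \<Rightarrow> complex ^ 'n \<Rightarrow> real" where
  "fubini_study_sq v w =
     (norm (w - ((\<Sum>i\<in>UNIV. w $ i * cnj (v $ i)) / of_real ((norm v)\<^sup>2)) *s v))\<^sup>2 / (norm v)\<^sup>2"

definition local_lift ::
    "'a::t2_space chart \<Rightarrow> 'a \<Rightarrow> ('a \<Rightarrow> (complex ^ 'n) set) \<Rightarrow> (complex \<Rightarrow> complex ^ 'n) \<Rightarrow> bool"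
  where
  "local_lift c p \<Psi> F \<longleftrightarrow> p \<in> fst c \<and>
     (\<exists>W. open W \<and> snd c p \<in> W \<and> W \<subseteq> snd c ` fst c \<and> smooth_on W F \<and>
        (\<forall>z\<in>W. F z \<noteq> 0 \<and> \<Psi> (chart_inv c z) = hcoord (F z)))"

definition smooth_map ::
    "'a::t2_space chart set \<Rightarrow> ('a \<Rightarrow> (complex ^ 'n) set) \<Rightarrow> bool" where
  "smooth_map A \<Psi> \<longleftrightarrow> (\<forall>p. \<exists>c\<in>A. \<exists>F. local_lift c p \<Psi> F)"

text \<open>\<open>|d\<Psi>|\<^sup>2\<close> is the trace, over a \<open>g\<close>-orthonormal basis, of the pullback of \<open>k\<close> times the
  Fubini--Study metric.\<close>

definition energy_density ::
    "'a::t2_space chart set \<Rightarrow> 'a surface_metric \<Rightarrow> real \<Rightarrow>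
     ('a \<Rightarrow> (complex ^ 'n) set) \<Rightarrow> 'a \<Rightarrow> real" where
  "energy_density A g k \<Psi> p =
     (THE r. \<forall>c\<in>A. \<forall>F v w. local_lift c p \<Psi> F \<and>
        g c p v v = 1 \<and> g c p w w = 1 \<and> g c p v w = 0 \<longrightarrow>
        (let DF = frechet_derivative F (at (snd c p))
         in r = k * fubini_study_sq (F (snd c p)) (DF v) +
                k * fubini_study_sq (F (snd c p)) (DF w)))"

definition energy ::
    "'a::t2_space chart set \<Rightarrow> 'a surface_metric \<Rightarrow> 'a measure \<Rightarrow> real \<Rightarrow>
     ('a \<Rightarrow> (complex ^ 'n) set) \<Rightarrow> real" where
  "energy A g dv k \<Psi> = 1 / 2 * (LINT p|dv. energy_density A g k \<Psi> p)"

text \<open>A variation \<open>V\<close> of \<open>\<Psi>\<close> is a family depending smoothly on point and parameter jointly.\<close>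

definition smooth_variation ::
    "'a::t2_space chart set \<Rightarrow> ('a \<Rightarrow> (complex ^ 'n) set) \<Rightarrow>
     (real \<Rightarrow> 'a \<Rightarrow> (complex ^ 'n) set) \<Rightarrow> bool" where
  "smooth_variation A \<Psi> V \<longleftrightarrow> V 0 = \<Psi> \<and>
     (\<exists>\<epsilon>>0. \<forall>p. \<forall>t. \<bar>t\<bar> < \<epsilon> \<longrightarrow>
        (\<exists>c\<in>A. p \<in> fst c \<and>
          (\<exists>W F. open W \<and> (snd c p, t) \<in> W \<and> W \<subseteq> (snd c ` fst c) \<times> UNIV \<and> smooth_on W F \<and>
            (\<forall>(z, s)\<in>W. F (z, s) \<noteq> 0 \<and> V s (chart_inv c z) = hcoord (F (z, s))))))"

definition harmonic_map ::
    "'a::t2_space chart set \<Rightarrow> 'a surface_metric \<Rightarrow> 'a measure \<Rightarrow> real \<Rightarrow>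
     ('a \<Rightarrow> (complex ^ 'n) set) \<Rightarrow> bool" where
  "harmonic_map A g dv k \<Psi> \<longleftrightarrow> smooth_map A \<Psi> \<and>
     (\<forall>V. smooth_variation A \<Psi> V \<longrightarrow>
        ((\<lambda>t. energy A g dv k (V t)) has_real_derivative 0) (at 0))"

text \<open>The map with homogeneous coordinates \<open>\<psi>\<^sub>j\<^sub>+\<close>, \<open>\<bar>\<psi>\<^sub>j\<^sub>-\<close>: these lie in the same fibre of \<open>S\<close>, and
  dividing by any nonzero element of that fibre gives the same point. The coordinates of
  \<open>\<psi>\<^sub>j\<^sub>+\<close> and \<open>\<bar>\<psi>\<^sub>j\<^sub>-\<close> are indexed by \<open>(j, True)\<close> and \<open>(j, False)\<close>.\<close>

definition spinor_map ::
    "('a, 's) line_bundle \<Rightarrow> ('m \<Rightarrow> ('a, 's) spinor_field) \<Rightarrow>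
     'a \<Rightarrow> (complex ^ ('m::finite \<times> bool)) set" where
  "spinor_map S \<psi> p =
     (THE L. \<forall>t. proj S t = p \<and> nonzero S t \<longrightarrow>
        L = hcoord (\<chi> i. if snd i then coord S t (fst (\<psi> (fst i) p))
                        else coord S t (unbar (snd (\<psi> (fst i) p)))))"

end

theory Submission
  imports Defs "HOL-Complex_Analysis.Riemann_Mapping"
begin

text \<open>
  Sending a line to its orthogonal projection embeds projective space into Hermitian matrices, and
  twice the Fubini--Study metric becomes the Frobenius metric, so the energy of \<open>Q = F F\<^sup>* / |F|\<^sup>2\<close> is
  a Dirichlet integral. For two maps \<open>Q\<close>, \<open>Q + D\<close> the difference of the energies is the energy of
  \<open>D\<close> plus a multiple of the integral of \<open>\<langle>dD, dQ\<rangle>\<close>, which by Stokes is that of \<open>- \<langle>D, \<Delta>Q\<rangle>\<close>. If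
  \<open>\<Delta>Q\<close> is normal to the space of projections, both terms are of second order in \<open>D\<close>, and the energy
  has zero derivative along every variation; nothing has to be differentiated under the integral.

  In a holomorphic coordinate with \<open>s\<^sub>0 \<otimes> s\<^sub>0 = dz\<close> the spinor map has the lift \<open>F\<close> whose entries are
  the coefficients of \<open>\<psi>\<^sub>j\<^sub>+\<close> and of the conjugates of \<open>\<psi>\<^sub>j\<^sub>-\<close>; the normalization says that \<open>|F|\<^sup>4\<close> is the
  conformal factor. The eigenvalue is real: its imaginary part times the area form is exact. The
  Dirac equation then says that the antiholomorphic derivative of \<open>F\<close> is \<open>l |F|\<^sup>2 G\<close>, where \<open>l\<close> is half
  the eigenvalue and \<open>G\<close> is a quaternionic rotation of \<open>F\<close>, orthogonal to \<open>F\<close>. With \<open>R\<close> the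
  component of the holomorphic derivative of \<open>F\<close> orthogonal to \<open>F\<close>, this yields
  \<open>\<Delta>Q / 4 = l\<^sup>2 |F|\<^sup>2 (G G\<^sup>* - F F\<^sup>*) + R R\<^sup>* / |F|\<^sup>2 - |R|\<^sup>2 F F\<^sup>* / |F|\<^sup>4\<close>, which commutes with \<open>Q\<close>.
\<close>

section \<open>Functions of class $C^k$\<close>

text \<open>What makes the Laplacian harmless is the absence of mixed terms: it is a combination of
  matrices \<open>outer x x\<close> with \<open>x\<close> on the line of the lift or orthogonal to
  it. Against such a matrix a difference D of two rank one projections pairs to order |D|^2,
  globally and with explicit constants, whereas a tangential term
  \<open>outer x y + outer y x\<close> would pair to first order. The mixed terms cancel because the
  conjugate derivative of the horizontal part of F_z turns out to be a multiple of F alone.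

  Integration by parts is stated as an estimate with a tolerance \<open>e\<close>:
  \<open>e = 0\<close> gives the reality of the eigenvalue, \<open>e\<close> of order t^2 the first
  variation. Reality has to come first, since with a complex eigenvalue the two halves of the lift
  satisfy equations with conjugate constants and there is no single \<open>l\<close>. Cut-off
  functions are differentiated only once, so a partition of unity of class C^1, built from squared
  positive parts, is enough. Conformal charts cover the surface by hypothesis, so that integrals and
  Laplacians are computed in them throughout.\<close>

lemma Ck_Suc_imp_Ck: "Ck (Suc n) S f \<Longrightarrow> Ck n S f"
proof (induction n arbitrary: f)
  case 0
  then show ?case
    by (auto intro!: continuous_at_imp_continuous_on differentiable_imp_continuous_within)
next
  case (Suc n)
  then show ?case by (metis Ck.simps(2))
qed

lemma Ck_mono: "n \<le> m \<Longrightarrow> Ck m S f \<Longrightarrow> Ck n S f"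
  by (induction rule: inc_induct) (auto dest: Ck_Suc_imp_Ck simp del: Ck.simps)

lemma smooth_on_Ck: "smooth_on S f \<Longrightarrow> Ck n S f"
  by (simp add: smooth_on_def)

lemma Ck_subset: "Ck n S f \<Longrightarrow> T \<subseteq> S \<Longrightarrow> Ck n T f"
  by (induction n arbitrary: f) (auto intro: continuous_on_subset)

lemma smooth_on_subset: "smooth_on S f \<Longrightarrow> T \<subseteq> S \<Longrightarrow> smooth_on T f"
  by (auto simp: smooth_on_def intro: Ck_subset)

lemma has_derivative_cong_open:
  assumes "open S" "x \<in> S" "\<And>y. y \<in> S \<Longrightarrow> f y = g y"
  shows "(f has_derivative D) (at x) \<longleftrightarrow> (g has_derivative D) (at x)"
proof
  show "(f has_derivative D) (at x) \<Longrightarrow> (g has_derivative D) (at x)"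
    by (rule has_derivative_transform_within_open[of f D x UNIV S]) (use assms in auto)
  show "(g has_derivative D) (at x) \<Longrightarrow> (f has_derivative D) (at x)"
    by (rule has_derivative_transform_within_open[of g D x UNIV S]) (use assms in auto)
qed

lemma frechet_derivative_cong_open:
  assumes "open S" "x \<in> S" "\<And>y. y \<in> S \<Longrightarrow> f y = g y"
  shows "frechet_derivative f (at x) = frechet_derivative g (at x)"
  unfolding frechet_derivative_def using has_derivative_cong_open[OF assms] by simp

lemma differentiable_cong_open:
  assumes "open S" "x \<in> S" "\<And>y. y \<in> S \<Longrightarrow> f y = g y"
  shows "f differentiable (at x) \<longleftrightarrow> g differentiable (at x)"
  unfolding differentiable_def using has_derivative_cong_open[OF assms] by simp

lemma Ck_cong:
  assumes "open S" "\<And>x. x \<in> S \<Longrightarrow> f x = g x"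
  shows "Ck n S f \<longleftrightarrow> Ck n S g"
  using assms(2)
proof (induction n arbitrary: f g)
  case 0
  then show ?case by (auto cong: continuous_on_cong)
next
  case (Suc n)
  have "Ck n S (\<lambda>x. frechet_derivative f (at x) v) \<longleftrightarrow> Ck n S (\<lambda>x. frechet_derivative g (at x) v)" for v
  proof (rule Suc.IH)
    show "frechet_derivative f (at x) v = frechet_derivative g (at x) v" if "x \<in> S" for x
      by (rule arg_cong[where f="\<lambda>D. D v"], rule frechet_derivative_cong_open[OF assms(1) that])
        (rule Suc.prems)
  qed
  moreover have "f differentiable (at x) \<longleftrightarrow> g differentiable (at x)" if "x \<in> S" for x
    by (rule differentiable_cong_open[OF assms(1) that]) (rule Suc.prems)
  ultimately show ?case by simp
qed

lemma smooth_on_cong: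
  assumes "open S" "\<And>x. x \<in> S \<Longrightarrow> f x = g x"
  shows "smooth_on S f \<longleftrightarrow> smooth_on S g"
  using Ck_cong[OF assms] by (simp add: smooth_on_def)

lemma Ck_transform:
  assumes "open S" "Ck n S f" "\<And>x. x \<in> S \<Longrightarrow> f x = g x"
  shows "Ck n S g"
  using Ck_cong[OF assms(1,3), where n = n] assms(2) by simp

lemma smooth_on_transform:
  assumes "open S" "smooth_on S f" "\<And>x. x \<in> S \<Longrightarrow> f x = g x"
  shows "smooth_on S g"
  using smooth_on_cong[OF assms(1,3)] assms(2) by simp

lemma frechet_derivative_eqI: "(f has_derivative D) (at x) \<Longrightarrow> frechet_derivative f (at x) = D"
  by (metis frechet_derivative_at)

text \<open>Trades \<open>frechet_derivative\<close> for an explicit derivative \<open>D\<close>;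
  the closure properties below are proved with it by induction on \<open>n\<close>.\<close>

lemma Ck_SucI:
  assumes "open S" "\<And>x. x \<in> S \<Longrightarrow> (f has_derivative D x) (at x)"
    "\<And>v. Ck n S (\<lambda>x. D x v)"
  shows "Ck (Suc n) S f"
proof -
  have "Ck n S (\<lambda>x. frechet_derivative f (at x) v)" for v
    using assms(3)[of v] Ck_cong[OF assms(1), of "\<lambda>x. frechet_derivative f (at x) v" "\<lambda>x. D x v" n]
    by (simp add: frechet_derivative_eqI[OF assms(2)])
  then show ?thesis using assms(2) by (auto simp: differentiable_def)
qed

lemma Ck_has_derivative:
  "Ck (Suc n) S f \<Longrightarrow> x \<in> S \<Longrightarrow> (f has_derivative frechet_derivative f (at x)) (at x)"
  by (simp add: frechet_derivative_works)

lemma Ck_frechet: "Ck (Suc n) S f \<Longrightarrow> Ck n S (\<lambda>x. frechet_derivative f (at x) v)"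
  by simp

lemma Ck_differentiable: "Ck (Suc n) S f \<Longrightarrow> x \<in> S \<Longrightarrow> f differentiable (at x)"
  by simp

lemma Ck_const: "Ck n S (\<lambda>x. c)"
  by (induction n arbitrary: c) (auto simp: frechet_derivative_const)

lemma Ck_bounded_linear:
  assumes "open S" "bounded_linear L" "Ck n S f"
  shows "Ck n S (\<lambda>x. L (f x))"
  using assms(3)
proof (induction n arbitrary: f)
  case 0
  then show ?case using bounded_linear.continuous_on[OF assms(2)] by auto
next
  case (Suc n)
  show ?case
    by (rule Ck_SucI[OF assms(1), where D="\<lambda>x v. L (frechet_derivative f (at x) v)"])
      (use Suc in \<open>auto intro!: bounded_linear.has_derivative[OF assms(2)] simp: frechet_derivative_works\<close>)
qed

lemma Ck_ident: "Ck n S (\<lambda>x. x)"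
proof (cases n)
  case (Suc m)
  have "Ck (Suc m) UNIV (\<lambda>x. x)"
    by (rule Ck_SucI[where D="\<lambda>x v. v"]) (auto simp: Ck_const)
  then show ?thesis unfolding Suc by (rule Ck_subset) simp
qed simp

lemma Ck_minus: "open S \<Longrightarrow> Ck n S f \<Longrightarrow> Ck n S (\<lambda>x. - f x)"
  by (rule Ck_bounded_linear[OF _ bounded_linear_minus[OF bounded_linear_ident]])

lemma Ck_add:
  assumes "open S" "Ck n S f" "Ck n S g"
  shows "Ck n S (\<lambda>x. f x + g x)"
  using assms(2,3)
proof (induction n arbitrary: f g)
  case 0
  then show ?case by (auto intro: continuous_on_add)
next
  case (Suc n)
  show ?case
    by (rule Ck_SucI[OF assms(1),
          where D="\<lambda>x v. frechet_derivative f (at x) v + frechet_derivative g (at x) v"])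
      (use Suc in \<open>auto intro!: has_derivative_add simp: frechet_derivative_works\<close>)
qed

lemma Ck_slice: "Ck n S (\<lambda>z. (z, t))"
proof -
  have "bounded_linear (\<lambda>z. (z, 0))" by (intro bounded_linear_Pair bounded_linear_ident bounded_linear_zero)
  from Ck_add[OF open_UNIV Ck_bounded_linear[OF open_UNIV this Ck_ident] Ck_const[of _ _ "(0, t)"]]
  have "Ck n UNIV (\<lambda>z. (z, t))" by simp
  then show ?thesis by (rule Ck_subset) simp
qed

lemma Ck_Pair:
  assumes S: "open S" and f: "Ck n S f" and g: "Ck n S g"
  shows "Ck n S (\<lambda>x. (f x, g x))"
proof -
  have "bounded_linear (\<lambda>z. (z, 0))" "bounded_linear (\<lambda>z. (0, z))"
    by (intro bounded_linear_Pair bounded_linear_ident bounded_linear_zero)+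
  from Ck_add[OF S Ck_bounded_linear[OF S this(1) f] Ck_bounded_linear[OF S this(2) g]] show ?thesis by simp
qed

lemma Ck_sum:
  assumes "open S" "\<And>i. i \<in> I \<Longrightarrow> Ck n S (f i)"
  shows "Ck n S (\<lambda>x. \<Sum>i\<in>I. f i x)"
  using assms(2)
proof (induction I rule: infinite_finite_induct)
  case (insert i I)
  then show ?case using Ck_add[OF assms(1), of n "f i" "\<lambda>x. \<Sum>i\<in>I. f i x"] by auto
qed (auto simp: Ck_const)

lemma Ck_bounded_bilinear:
  assumes "open S" "bounded_bilinear B" "Ck n S f" "Ck n S g"
  shows "Ck n S (\<lambda>x. B (f x) (g x))"
  using assms(3,4)
proof (induction n arbitrary: f g)
  case 0
  then show ?case using bounded_bilinear.continuous_on[OF assms(2)] by auto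
next
  case (Suc n)
  note lower = Suc.prems[THEN Ck_Suc_imp_Ck]
  show ?case
  proof (rule Ck_SucI[OF assms(1), where
        D="\<lambda>x v. B (f x) (frechet_derivative g (at x) v) + B (frechet_derivative f (at x) v) (g x)"])
    show "((\<lambda>x. B (f x) (g x)) has_derivative
        (\<lambda>v. B (f x) (frechet_derivative g (at x) v) + B (frechet_derivative f (at x) v) (g x))) (at x)"
      if "x \<in> S" for x
      by (rule bounded_bilinear.FDERIV[OF assms(2)])
        (use Suc.prems that in \<open>auto simp: frechet_derivative_works\<close>)
    show "Ck n S (\<lambda>x. B (f x) (frechet_derivative g (at x) v) +
        B (frechet_derivative f (at x) v) (g x))" for v
      using Suc.prems lower by (intro Ck_add Suc.IH assms(1)) auto
  qed
qed

lemmas Ck_mult = Ck_bounded_bilinear[OF _ bounded_bilinear_mult]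

lemma Ck_inverse:
  fixes f :: "'a::euclidean_space \<Rightarrow> 'b::real_normed_field"
  assumes "open S" "Ck n S f" "\<And>x. x \<in> S \<Longrightarrow> f x \<noteq> 0"
  shows "Ck n S (\<lambda>x. inverse (f x))"
  using assms(2)
proof (induction n)
  case 0
  then show ?case using assms(3) by (auto intro: continuous_on_inverse)
next
  case (Suc n)
  let ?D = "\<lambda>x v. - (inverse (f x) * frechet_derivative f (at x) v * inverse (f x))"
  show ?case
  proof (rule Ck_SucI[OF assms(1), where D="?D"])
    show "((\<lambda>x. inverse (f x)) has_derivative ?D x) (at x)" if "x \<in> S" for x
      by (rule Deriv.has_derivative_inverse)
        (use Suc.prems that assms(3) in \<open>auto simp: frechet_derivative_works\<close>)
    have *: "Ck n S (\<lambda>x. inverse (f x))" using Suc Ck_Suc_imp_Ck by blast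
    have "Ck n S (\<lambda>x. (inverse (f x) * frechet_derivative f (at x) v) * inverse (f x))" for v
      by (intro Ck_mult assms(1) *) (use Suc.prems in auto)
    from Ck_bounded_linear[OF assms(1) bounded_linear_minus[OF bounded_linear_ident] this]
    show "Ck n S (\<lambda>x. ?D x v)" for v .
  qed
qed

lemma Ck_compose:
  fixes f :: "'b::euclidean_space \<Rightarrow> 'c::real_normed_vector"
    and g :: "'a::euclidean_space \<Rightarrow> 'b"
  assumes "open S" "open T" "g ` S \<subseteq> T" "Ck n S g" "Ck n T f"
  shows "Ck n S (\<lambda>x. f (g x))"
  using assms(4,5)
proof (induction n arbitrary: f)
  case 0
  then show ?case using assms(3) continuous_on_compose2 by (metis Ck.simps(1))
next
  case (Suc n)
  let ?G = "\<lambda>x v. frechet_derivative g (at x) v"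
  \<comment> \<open>The direction \<open>?G x v\<close> varies with \<open>x\<close>, while
    \<open>Ck\<close> speaks of fixed directions. Expanding it in \<open>Basis\<close> leaves sums
    of products to which the induction hypothesis applies.\<close>
  let ?D = "\<lambda>x v. \<Sum>b\<in>Basis. (?G x v \<bullet> b) *\<^sub>R frechet_derivative f (at (g x)) b"
  have lin: "bounded_linear (frechet_derivative f (at y))" if "y \<in> T" for y
    using Suc.prems(2) that Ck_has_derivative has_derivative_bounded_linear by blast
  have eq: "?D x v = frechet_derivative f (at (g x)) (?G x v)" if "x \<in> S" for x v
  proof -
    have "frechet_derivative f (at (g x)) (?G x v)
        = frechet_derivative f (at (g x)) (\<Sum>b\<in>Basis. (?G x v \<bullet> b) *\<^sub>R b)"
      by (simp add: euclidean_representation)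
    also have "\<dots> = ?D x v"
      using lin[of "g x"] that assms(3)
      by (simp add: linear_sum linear_scale bounded_linear.linear image_subset_iff)
    finally show ?thesis by simp
  qed
  show ?case
  proof (rule Ck_SucI[OF assms(1), where D="?D"])
    fix x assume x: "x \<in> S"
    have "((\<lambda>x. f (g x)) has_derivative (\<lambda>v. frechet_derivative f (at (g x)) (?G x v))) (at x)"
      using diff_chain_at[OF Ck_has_derivative[OF Suc.prems(1) x]
          Ck_has_derivative[OF Suc.prems(2)], of ] x assms(3)
      by (simp add: o_def image_subset_iff)
    then show "((\<lambda>x. f (g x)) has_derivative ?D x) (at x)" using eq x by simp
  next
    show "Ck n S (\<lambda>x. ?D x v)" for v
      using Suc.prems Ck_Suc_imp_Ck[OF Suc.prems(1)] Suc.IH[of "\<lambda>y. frechet_derivative f (at y) _"]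
      by (intro Ck_sum assms(1) Ck_bounded_bilinear[OF _ bounded_bilinear_scaleR]
          Ck_bounded_linear[OF _ bounded_linear_inner_left] Suc.IH) auto
  qed
qed

lemma Ck_local:
  assumes "\<And>x. x \<in> S \<Longrightarrow> \<exists>T. open T \<and> x \<in> T \<and> Ck n T f"
  shows "Ck n S f"
  using assms
proof (induction n arbitrary: f)
  case 0
  have "isCont f x" if "x \<in> S" for x
    using 0[OF that] by (auto simp: continuous_on_eq_continuous_at)
  then show ?case by (simp add: continuous_at_imp_continuous_on)
next
  case (Suc n)
  then show ?case by simp (meson)
qed

lemma smooth_on_local:
  assumes "\<And>x. x \<in> S \<Longrightarrow> \<exists>T. open T \<and> x \<in> T \<and> smooth_on T f"
  shows "smooth_on S f"
  unfolding smooth_on_def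
proof
  show "Ck n S f" for n
    by (rule Ck_local) (use assms in \<open>meson smooth_on_Ck\<close>)
qed

text \<open>The derivative in direction \<open>v\<close> is \<open>v\<close> times the holomorphic
  function \<open>deriv f\<close>, so holomorphy reproduces itself under differentiation.\<close>

lemma smooth_on_holomorphic:
  assumes "open S" "f holomorphic_on S"
  shows "smooth_on S f"
proof -
  have "Ck n S f" for n
    using assms(2)
  proof (induction n arbitrary: f)
    case 0
    then show ?case by (simp add: holomorphic_on_imp_continuous_on)
  next
    case (Suc n)
    show ?case
    proof (rule Ck_SucI[OF assms(1), where D="\<lambda>x v. deriv f x * v"])
      show "(f has_derivative (\<lambda>v. deriv f x * v)) (at x)" if "x \<in> S" for x
        using holomorphic_derivI[OF Suc.prems assms(1) that] by (simp add: has_field_derivative_def)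
      show "Ck n S (\<lambda>x. deriv f x * v)" for v
        by (intro Suc.IH holomorphic_intros Suc.prems assms(1))
    qed
  qed
  then show ?thesis by (simp add: smooth_on_def)
qed

lemma has_derivative_vec:
  fixes f :: "'a::real_normed_vector \<Rightarrow> 'b::euclidean_space ^ 'n"
  assumes "\<And>i. ((\<lambda>x. f x $ i) has_derivative (\<lambda>v. D v $ i)) (at x within S)"
  shows "(f has_derivative D) (at x within S)"
  unfolding has_derivative_componentwise_within[of f]
  using bounded_linear.has_derivative[OF bounded_linear_inner_left assms]
  by (auto simp: Basis_vec_def inner_axis)

lemma Ck_of_vec_nth:
  fixes f :: "'a::euclidean_space \<Rightarrow> 'b::euclidean_space ^ 'n"
  assumes "open S" "\<And>i. Ck n S (\<lambda>x. f x $ i)"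
  shows "Ck n S f"
  using assms(2)
proof (induction n arbitrary: f)
  case 0
  then show ?case using continuous_on_vec_lambda[of S "\<lambda>i x. f x $ i"] by auto
next
  case (Suc n)
  let ?D = "\<lambda>x v. \<chi> i. frechet_derivative (\<lambda>x. f x $ i) (at x) v"
  show ?case
  proof (rule Ck_SucI[OF assms(1), where D="?D"])
    fix x assume x: "x \<in> S"
    show "(f has_derivative ?D x) (at x)"
      by (rule has_derivative_vec) (use Ck_has_derivative[OF Suc.prems x] in simp)
  next
    show "Ck n S (\<lambda>x. ?D x v)" for v
      by (rule Suc.IH) (use Suc.prems in auto)
  qed
qed

lemma Ck_vec_nth: "open S \<Longrightarrow> Ck n S f \<Longrightarrow> Ck n S (\<lambda>x. f x $ i)"
  by (rule Ck_bounded_linear) (auto intro: bounded_linear_vec_nth)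

section \<open>Symmetry of second derivatives\<close>

lemma second_difference_mvt:
  fixes f :: "complex \<Rightarrow> real"
  assumes h: "h > 0" and sub: "\<And>s t. 0 \<le> s \<Longrightarrow> s \<le> h \<Longrightarrow> 0 \<le> t \<Longrightarrow> t \<le> h \<Longrightarrow> z + of_real s * u + of_real t * v \<in> S"
    and C: "Ck 2 S f"
  shows "\<exists>s t. 0 < s \<and> s < h \<and> 0 < t \<and> t < h \<and>
    f (z + of_real h * u + of_real h * v) - f (z + of_real h * u) - f (z + of_real h * v) + f z =
      h * h * frechet_derivative (\<lambda>w. frechet_derivative f (at w) u) (at (z + of_real s * u + of_real t * v)) v"
proof -
  let ?fu = "\<lambda>w. frechet_derivative f (at w) u"
  let ?fuv = "\<lambda>w. frechet_derivative ?fu (at w) v"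
  have d1: "(f has_derivative frechet_derivative f (at w)) (at w)" if "w \<in> S" for w
    using C that by (auto simp: numeral_2_eq_2 frechet_derivative_works[symmetric])
  have d2: "(?fu has_derivative frechet_derivative ?fu (at w)) (at w)" if "w \<in> S" for w
    using C that by (auto simp: numeral_2_eq_2 frechet_derivative_works[symmetric])
  let ?p = "\<lambda>s t. z + of_real s * u + of_real t * v"
  have e1: "((\<lambda>s. f (?p s t)) has_real_derivative ?fu (?p s t)) (at s)" if "?p s t \<in> S" for s t
  proof -
    have "((\<lambda>s. f (?p s t)) has_derivative (\<lambda>r. frechet_derivative f (at (?p s t)) (of_real r * u))) (at s)"
      by (rule has_derivative_compose[where g=f and f="\<lambda>s. ?p s t", OF _ d1[OF that]]) (auto intro!: derivative_eq_intros)
    then show ?thesis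
      using linear_scale[OF has_derivative_linear[OF d1[OF that]]]
      by (simp add: has_field_derivative_def mult_commute_abs flip: scaleR_conv_of_real)
  qed
  have e2: "((\<lambda>t. ?fu (?p s t)) has_real_derivative ?fuv (?p s t)) (at t)" if "?p s t \<in> S" for s t
  proof -
    have "((\<lambda>t. ?fu (?p s t)) has_derivative (\<lambda>r. frechet_derivative ?fu (at (?p s t)) (of_real r * v))) (at t)"
      by (rule has_derivative_compose[where g="?fu" and f="\<lambda>t. ?p s t", OF _ d2[OF that]]) (auto intro!: derivative_eq_intros)
    then show ?thesis
      using linear_scale[OF has_derivative_linear[OF d2[OF that]]]
      by (simp add: has_field_derivative_def mult_commute_abs flip: scaleR_conv_of_real)
  qed
  \<comment> \<open>The mean value theorem is applied first along \<open>u\<close>, to the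
    difference of \<open>f\<close> between the two sides parallel to \<open>u\<close>, and then
    along \<open>v\<close> to the derivative that results.\<close>
  have "\<exists>s>0. s < h \<and> (f (?p h h) - f (?p h 0)) - (f (?p 0 h) - f (?p 0 0)) =
      (h - 0) * (?fu (?p s h) - ?fu (?p s 0))"
    by (rule MVT2[OF h]) (use h in \<open>auto intro!: DERIV_diff e1[of _ h] e1[of _ 0, simplified] sub sub[of _ 0, simplified]\<close>)
  then obtain s where s: "0 < s" "s < h" and
    eq1: "(f (?p h h) - f (?p h 0)) - (f (?p 0 h) - f (?p 0 0)) = h * (?fu (?p s h) - ?fu (?p s 0))"
    by auto
  have "\<exists>t>0. t < h \<and> ?fu (?p s h) - ?fu (?p s 0) = (h - 0) * ?fuv (?p s t)"
    by (rule MVT2[OF h]) (use h s in \<open>auto intro!: e2 sub\<close>)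
  then obtain t where t: "0 < t" "t < h" "?fu (?p s h) - ?fu (?p s 0) = h * ?fuv (?p s t)" by auto
  show ?thesis
    by (rule exI[of _ s], rule exI[of _ t]) (use s t eq1 in \<open>simp add: algebra_simps\<close>)
qed

text \<open>The second difference is symmetric in \<open>u\<close> and \<open>v\<close>, and by
  \<open>second_difference_mvt\<close> its quotient by h^2 is a value of either mixed derivative
  near \<open>z\<close>; continuity does the rest. Real values are needed for the mean value
  theorem.\<close>

lemma mixed_partials_real:
  fixes f :: "complex \<Rightarrow> real"
  assumes S: "open S" "z \<in> S" and C: "Ck 2 S f"
  shows "frechet_derivative (\<lambda>w. frechet_derivative f (at w) u) (at z) v =
         frechet_derivative (\<lambda>w. frechet_derivative f (at w) v) (at z) u"
proof (rule ccontr)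
  let ?fuv = "\<lambda>w. frechet_derivative (\<lambda>w. frechet_derivative f (at w) u) (at w) v"
  let ?fvu = "\<lambda>w. frechet_derivative (\<lambda>w. frechet_derivative f (at w) v) (at w) u"
  assume "?fuv z \<noteq> ?fvu z"
  \<comment> \<open>Half of the gap: two equal values, each strictly within \<open>?e\<close> of its
    own limit, contradict it.\<close>
  then have e: "\<bar>?fuv z - ?fvu z\<bar> / 2 > 0" (is "?e > 0") by simp
  have "continuous_on S ?fuv" "continuous_on S ?fvu" using C by (auto simp: numeral_2_eq_2)
  then have "isCont ?fuv z" "isCont ?fvu z" using S by (auto simp: continuous_on_eq_continuous_at)
  then obtain d1 d2 where d: "d1 > 0" "\<And>w. dist w z < d1 \<Longrightarrow> dist (?fuv w) (?fuv z) < ?e"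
     "d2 > 0" "\<And>w. dist w z < d2 \<Longrightarrow> dist (?fvu w) (?fvu z) < ?e"
    using e unfolding continuous_at_eps_delta by metis
  obtain r where r: "r > 0" "ball z r \<subseteq> S" using S by (auto simp: open_contains_ball)
  define d where "d = min r (min d1 d2)"
  have d0: "d > 0" using d r by (simp add: d_def)
  \<comment> \<open>With this \<open>m\<close>, the parallelogram with sides h u and h v stays
    inside the ball of radius \<open>d\<close>; the summand 1 covers vanishing directions.\<close>
  define m where "m = norm u + norm v + 1"
  define h where "h = d / (2 * m)"
  have n0: "m > 0" by (simp add: add_nonneg_pos m_def)
  have h0: "h > 0" using d0 n0 by (simp add: h_def)
  have close: "dist (z + of_real s * u + of_real t * v) z < d" 
    if "0 \<le> s" "s \<le> h" "0 \<le> t" "t \<le> h" for s t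
  proof -
    have "dist (z + of_real s * u + of_real t * v) z \<le> s * norm u + t * norm v"
      using norm_triangle_ineq[of "of_real s * u" "of_real t * v"] that
      by (simp add: dist_norm norm_mult)
    also have "\<dots> \<le> h * norm u + h * norm v" using that by (intro add_mono mult_right_mono) auto
    also have "\<dots> \<le> h * m" using h0 by (simp add: algebra_simps m_def)
    also have "\<dots> = d / 2" using n0 by (simp add: h_def)
    finally show ?thesis using d0 by simp
  qed
  have sub: "z + of_real s * u + of_real t * v \<in> S" "z + of_real t * v + of_real s * u \<in> S"
    if "0 \<le> s" "s \<le> h" "0 \<le> t" "t \<le> h" for s t
    using close[OF that] r by (auto simp: d_def subset_iff mem_ball dist_commute add_ac)
  obtain s t where st: "0 < s" "s < h" "0 < t" "t < h" and
    1: "f (z + of_real h * u + of_real h * v) - f (z + of_real h * u) - f (z + of_real h * v) + f z =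
      h * h * ?fuv (z + of_real s * u + of_real t * v)"
    using second_difference_mvt[OF h0 sub(1) C] by blast
  obtain s' t' where st': "0 < s'" "s' < h" "0 < t'" "t' < h" and
    2: "f (z + of_real h * v + of_real h * u) - f (z + of_real h * v) - f (z + of_real h * u) + f z =
      h * h * ?fvu (z + of_real s' * v + of_real t' * u)"
    using second_difference_mvt[OF h0 sub(2) C] by blast
  have "h * h * ?fuv (z + of_real s * u + of_real t * v) = h * h * ?fvu (z + of_real s' * v + of_real t' * u)"
    using 1 2 by (simp add: algebra_simps)
  then have eq: "?fuv (z + of_real s * u + of_real t * v) = ?fvu (z + of_real s' * v + of_real t' * u)"
    using h0 by simp
  have "dist (?fuv (z + of_real s * u + of_real t * v)) (?fuv z) < ?e"
    using close[of s t] st by (intro d) (auto simp: d_def)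
  moreover have "dist (?fvu (z + of_real s' * v + of_real t' * u)) (?fvu z) < ?e"
    using close[of t' s'] st' by (intro d) (auto simp: d_def add_ac)
  ultimately show False unfolding eq dist_real_def by argo
qed

lemma mixed_partials:
  fixes f :: "complex \<Rightarrow> complex"
  assumes S: "open S" "z \<in> S" and C: "Ck 2 S f"
  shows "frechet_derivative (\<lambda>w. frechet_derivative f (at w) u) (at z) v =
         frechet_derivative (\<lambda>w. frechet_derivative f (at w) v) (at z) u"
proof -
  have *: "L (frechet_derivative (\<lambda>w. frechet_derivative f (at w) u) (at z) v) =
    frechet_derivative (\<lambda>w. frechet_derivative (\<lambda>w. L (f w)) (at w) u) (at z) v"
    if L: "bounded_linear (L :: complex \<Rightarrow> real)" for L u v
  proof -
    have "((\<lambda>w. L (f w)) has_derivative (\<lambda>u. L (frechet_derivative f (at w) u))) (at w)" if "w \<in> S" for w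
      using C that by (intro bounded_linear.has_derivative[OF L]) (auto simp: numeral_2_eq_2 frechet_derivative_works)
    then have a: "frechet_derivative (\<lambda>w. L (f w)) (at w) u = L (frechet_derivative f (at w) u)" if "w \<in> S" for w
      using that frechet_derivative_eqI by metis
    have "((\<lambda>w. L (frechet_derivative f (at w) u)) has_derivative
       (\<lambda>v. L (frechet_derivative (\<lambda>w. frechet_derivative f (at w) u) (at z) v))) (at z)"
      using C S by (intro bounded_linear.has_derivative[OF L]) (auto simp: numeral_2_eq_2 frechet_derivative_works)
    then have "((\<lambda>w. frechet_derivative (\<lambda>w. L (f w)) (at w) u) has_derivative
       (\<lambda>v. L (frechet_derivative (\<lambda>w. frechet_derivative f (at w) u) (at z) v))) (at z)"
      by (rule has_derivative_transform_within_open[OF _ S]) (simp add: a)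
    then show ?thesis by (simp add: frechet_derivative_eqI)
  qed
  have sym: "L (frechet_derivative (\<lambda>w. frechet_derivative f (at w) u) (at z) v) =
      L (frechet_derivative (\<lambda>w. frechet_derivative f (at w) v) (at z) u)"
    if L: "bounded_linear (L :: complex \<Rightarrow> real)" for L
    unfolding *[OF L] by (rule mixed_partials_real[OF S Ck_bounded_linear[OF S(1) L C]])
  show ?thesis
    by (rule complex_eqI) (rule sym[OF bounded_linear_Re], rule sym[OF bounded_linear_Im])
qed

section \<open>Wirtinger derivatives\<close>

text \<open>\<open>wirt f a b z\<close>: the derivatives of \<open>f\<close> at \<open>z\<close> with respect to \<open>z\<close> and its conjugate are
  \<open>a\<close> and \<open>b\<close>.\<close>

definition wirt :: "(complex \<Rightarrow> complex) \<Rightarrow> complex \<Rightarrow> complex \<Rightarrow> complex \<Rightarrow> bool" where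
  "wirt f a b z \<longleftrightarrow> (f has_derivative (\<lambda>h. a * h + b * cnj h)) (at z)"

lemma wirt_frechet: "wirt f a b z \<Longrightarrow> frechet_derivative f (at z) h = a * h + b * cnj h"
  by (simp add: wirt_def frechet_derivative_eqI)

lemma wirt_d_z: "wirt f a b z \<Longrightarrow> d_z f z = a"
  by (simp add: d_z_def wirt_frechet algebra_simps)

lemma wirt_d_zbar: "wirt f a b z \<Longrightarrow> d_zbar f z = b"
  by (simp add: d_zbar_def wirt_frechet algebra_simps)

lemma linear_complex_eq:
  assumes "linear (L :: complex \<Rightarrow> complex)"
  shows "L h = (L 1 - \<i> * L \<i>) / 2 * h + (L 1 + \<i> * L \<i>) / 2 * cnj h"
proof -
  have "h = Re h *\<^sub>R 1 + Im h *\<^sub>R \<i>" by (simp add: complex_eq_iff)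
  then have "L h = L (Re h *\<^sub>R 1 + Im h *\<^sub>R \<i>)" by simp
  also have "\<dots> = Re h *\<^sub>R L 1 + Im h *\<^sub>R L \<i>"
    using assms by (simp add: linear_add linear_scale)
  finally show ?thesis by (simp add: complex_eq_iff field_simps)
qed

lemma linear_complex_Re_Im:
  assumes "linear (D :: complex \<Rightarrow> 'b::real_vector)"
  shows "D x = Re x *\<^sub>R D 1 + Im x *\<^sub>R D \<i>"
proof -
  have "x = Re x *\<^sub>R 1 + Im x *\<^sub>R \<i>" by (simp add: complex_eq_iff)
  then have "D x = D (Re x *\<^sub>R 1 + Im x *\<^sub>R \<i>)" by simp
  also have "\<dots> = Re x *\<^sub>R D 1 + Im x *\<^sub>R D \<i>"
    by (simp only: linear_add[OF assms] linear_scale[OF assms])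
  finally show ?thesis .
qed

lemma differentiable_wirt:
  assumes "f differentiable (at z)"
  shows "wirt f (d_z f z) (d_zbar f z) z"
proof -
  have D: "(f has_derivative frechet_derivative f (at z)) (at z)"
    using assms by (simp add: frechet_derivative_works)
  have "frechet_derivative f (at z) h = d_z f z * h + d_zbar f z * cnj h" for h
    unfolding d_z_def d_zbar_def by (rule linear_complex_eq[OF has_derivative_linear[OF D]])
  then have "frechet_derivative f (at z) = (\<lambda>h. d_z f z * h + d_zbar f z * cnj h)"
    by (rule ext)
  with D show ?thesis by (simp add: wirt_def)
qed

lemma wirt_field_derivative: "(f has_field_derivative a) (at z) \<Longrightarrow> wirt f a 0 z"
  by (simp add: wirt_def has_field_derivative_def)

lemma wirt_const: "wirt (\<lambda>z. c) 0 0 z"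
  by (simp add: wirt_def)

lemma wirt_add: "wirt f a b z \<Longrightarrow> wirt g c d z \<Longrightarrow> wirt (\<lambda>z. f z + g z) (a + c) (b + d) z"
  unfolding wirt_def by (drule (1) has_derivative_add) (simp add: algebra_simps)

lemma wirt_diff: "wirt f a b z \<Longrightarrow> wirt g c d z \<Longrightarrow> wirt (\<lambda>z. f z - g z) (a - c) (b - d) z"
  unfolding wirt_def by (drule (1) has_derivative_diff) (simp add: algebra_simps)

lemma wirt_mult:
  "wirt f a b z \<Longrightarrow> wirt g c d z \<Longrightarrow> wirt (\<lambda>z. f z * g z) (f z * c + a * g z) (f z * d + b * g z) z"
  unfolding wirt_def by (drule (1) has_derivative_mult) (simp add: algebra_simps)

lemma wirt_cmult: "wirt f a b z \<Longrightarrow> wirt (\<lambda>z. c * f z) (c * a) (c * b) z"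
  using wirt_mult[OF wirt_const] by fastforce

lemma wirt_cnj: "wirt f a b z \<Longrightarrow> wirt (\<lambda>z. cnj (f z)) (cnj b) (cnj a) z"
  unfolding wirt_def
  by (drule bounded_linear.has_derivative[OF bounded_linear_cnj]) (simp add: algebra_simps)

lemma wirt_inverse:
  assumes "wirt f a b z" "f z \<noteq> 0"
  shows "wirt (\<lambda>z. inverse (f z)) (- a / (f z)\<^sup>2) (- b / (f z)\<^sup>2) z"
proof -
  have "((\<lambda>z. inverse (f z)) has_derivative (\<lambda>h. - (inverse (f z) * (a * h + b * cnj h) * inverse (f z)))) (at z)"
    by (rule Deriv.has_derivative_inverse) (use assms in \<open>auto simp: wirt_def\<close>)
  then show ?thesis unfolding wirt_def
    by (rule has_derivative_eq_rhs) (simp add: fun_eq_iff divide_inverse power2_eq_square algebra_simps)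
qed

lemma wirt_divide:
  assumes "wirt f a b z" "wirt g c d z" "g z \<noteq> 0"
  shows "wirt (\<lambda>z. f z / g z) (a / g z - f z * c / (g z)\<^sup>2) (b / g z - f z * d / (g z)\<^sup>2) z"
  using wirt_mult[OF assms(1) wirt_inverse[OF assms(2,3)]]
  by (simp add: divide_inverse algebra_simps)

lemma wirt_sum:
  "finite I \<Longrightarrow> (\<And>i. i \<in> I \<Longrightarrow> wirt (f i) (a i) (b i) z) \<Longrightarrow>
    wirt (\<lambda>z. \<Sum>i\<in>I. f i z) (\<Sum>i\<in>I. a i) (\<Sum>i\<in>I. b i) z"
  by (induction I rule: finite_induct) (auto intro: wirt_const wirt_add)

lemma wirt_cong_open:
  "wirt f a b z \<Longrightarrow> open S \<Longrightarrow> z \<in> S \<Longrightarrow> (\<And>w. w \<in> S \<Longrightarrow> f w = g w) \<Longrightarrow> wirt g a b z"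
  unfolding wirt_def by (erule has_derivative_transform_within_open) auto

lemma Ck_d_z:
  assumes S: "open S" and f: "Ck (Suc n) S f"
  shows "Ck n S (d_z f)"
proof -
  have a: "Ck n S (\<lambda>z. frechet_derivative f (at z) 1 / 2)"
    by (rule Ck_bounded_linear[OF S bounded_linear_divide]) (use f in auto)
  have b: "Ck n S (\<lambda>z. (- \<i> / 2) * frechet_derivative f (at z) \<i>)"
    by (rule Ck_bounded_linear[OF S bounded_linear_mult_right]) (use f in auto)
  show ?thesis
    using Ck_add[OF S a b] by (simp add: d_z_def[abs_def] diff_divide_distrib)
qed

text \<open>Both parts rest on the equality of the mixed derivatives: in either order the two
  Wirtinger derivatives give a quarter of f_xx + f_yy.\<close>

lemma wirt_laplace:
  assumes S: "open S" "z \<in> S" and C: "Ck 2 S f"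
  shows "d_zbar (d_z f) z = d_z (d_zbar f) z"
    and "frechet_derivative (\<lambda>w. frechet_derivative f (at w) 1) (at z) 1 +
      frechet_derivative (\<lambda>w. frechet_derivative f (at w) \<i>) (at z) \<i> = 4 * d_z (d_zbar f) z"
proof -
  let ?x = "\<lambda>w. frechet_derivative f (at w) 1"
  let ?y = "\<lambda>w. frechet_derivative f (at w) \<i>"
  have d: "?x differentiable (at z)" "?y differentiable (at z)"
    using C S by (auto simp: numeral_2_eq_2)
  then have x: "(?x has_derivative frechet_derivative ?x (at z)) (at z)"
    and y: "(?y has_derivative frechet_derivative ?y (at z)) (at z)"
    by (auto simp: frechet_derivative_works)
  have "(d_z f has_derivative (\<lambda>h. (frechet_derivative ?x (at z) h - \<i> * frechet_derivative ?y (at z) h) / 2)) (at z)"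
    unfolding d_z_def[abs_def] by (auto intro!: derivative_eq_intros x y)
  note z = frechet_derivative_eqI[OF this]
  have "(d_zbar f has_derivative (\<lambda>h. (frechet_derivative ?x (at z) h + \<i> * frechet_derivative ?y (at z) h) / 2)) (at z)"
    unfolding d_zbar_def[abs_def] by (auto intro!: derivative_eq_intros x y)
  note zbar = frechet_derivative_eqI[OF this]
  have mix: "frechet_derivative ?x (at z) \<i> = frechet_derivative ?y (at z) 1"
    by (rule mixed_partials[OF S C])
  show "d_zbar (d_z f) z = d_z (d_zbar f) z"
    unfolding d_zbar_def[of "d_z f"] d_z_def[of "d_zbar f"] z zbar mix by (simp add: field_simps)
  show "frechet_derivative ?x (at z) 1 + frechet_derivative ?y (at z) \<i> = 4 * d_z (d_zbar f) z"
    unfolding d_z_def[of "d_zbar f"] zbar mix by (simp add: field_simps)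
qed

section \<open>Projective space as a space of projection matrices\<close>

definition hinner :: "complex ^ 'n \<Rightarrow> complex ^ 'n \<Rightarrow> complex" where
  "hinner v w = (\<Sum>i\<in>UNIV. v $ i * cnj (w $ i))"

definition outer :: "complex ^ 'n \<Rightarrow> complex ^ 'n \<Rightarrow> complex ^ 'n ^ 'n" where
  "outer v w = (\<chi> i j. v $ i * cnj (w $ j))"

definition projmat :: "complex ^ 'n \<Rightarrow> complex ^ 'n ^ 'n" where
  "projmat v = inverse (v \<bullet> v) *\<^sub>R outer v v"

lemma outer_nth [simp]: "outer v w $ i $ j = v $ i * cnj (w $ j)"
  by (simp add: outer_def)

lemma hinner_diff: "hinner (u - v) w = hinner u w - hinner v w"
  and hinner_scale: "hinner (a *s u) w = a * hinner u w"
  by (simp_all add: hinner_def sum_subtractf sum_distrib_left algebra_simps)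

lemma hinner_commute: "hinner v w = cnj (hinner w v)"
  by (simp add: hinner_def mult.commute)

lemma inner_eq_hinner: "v \<bullet> w = Re (hinner v w)"
  by (simp add: hinner_def inner_vec_def inner_complex_def)

lemma hinner_self: "hinner v v = of_real (v \<bullet> v)"
proof -
  have "Im (hinner v v) = 0" by (simp add: hinner_def)
  then show ?thesis by (simp add: complex_eq_iff inner_eq_hinner)
qed

lemma norm_vec_scale: "norm (a *s v) = cmod a * norm (v :: complex ^ 'n)"
proof -
  have "hinner (a *s v) (a *s v) = of_real ((cmod a)\<^sup>2) * hinner v v"
    unfolding hinner_def sum_distrib_left complex_norm_square
    by (intro sum.cong) (auto simp: algebra_simps)
  then have "(a *s v) \<bullet> (a *s v) = (cmod a)\<^sup>2 * (v \<bullet> v)"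
    by (simp only: hinner_self of_real_mult[symmetric] of_real_eq_iff)
  then have "(norm (a *s v))\<^sup>2 = (cmod a * norm v)\<^sup>2"
    by (simp add: power2_norm_eq_inner power_mult_distrib)
  then show ?thesis by simp
qed

text \<open>The real Cauchy-Schwarz inequality after turning \<open>v\<close> by the phase that
  makes the Hermitian product real and nonnegative. If the product vanishes, \<open>s\<close> is 0
  and the argument still runs.\<close>

lemma cmod_hinner_le: "cmod (hinner v w) \<le> norm v * norm w"
proof -
  define s where "s = cnj (sgn (hinner v w))"
  have sgn: "cnj (sgn z) * z = of_real (cmod z)" for z
  proof -
    have "cnj (sgn z) * z = (z * cnj z) / of_real (cmod z)" by (simp add: sgn_eq)
    also have "\<dots> = of_real ((cmod z)\<^sup>2) / of_real (cmod z)" by (simp only: complex_norm_square)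
    finally show ?thesis by (simp add: power2_eq_square)
  qed
  have "hinner (s *s v) w = of_real (cmod (hinner v w))"
    by (simp only: hinner_scale s_def sgn)
  then have "cmod (hinner v w) = (s *s v) \<bullet> w" by (simp add: inner_eq_hinner)
  also have "\<dots> \<le> norm (s *s v) * norm w" by (rule norm_cauchy_schwarz)
  also have "\<dots> \<le> norm v * norm w"
    by (intro mult_right_mono) (auto simp: norm_vec_scale s_def norm_sgn)
  finally show ?thesis .
qed

lemma inner_outer: "outer a b \<bullet> outer c d = Re (hinner a c * hinner d b)"
proof -
  have "outer a b \<bullet> outer c d = Re (\<Sum>i\<in>UNIV. \<Sum>j\<in>UNIV. (a $ i * cnj (c $ i)) * (d $ j * cnj (b $ j)))"
    unfolding inner_vec_def Re_sum by (intro sum.cong refl) (simp add: inner_complex_def algebra_simps)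
  also have "\<dots> = Re (hinner a c * hinner d b)"
    by (simp add: hinner_def sum_product)
  finally show ?thesis .
qed

lemma bounded_bilinear_outer: "bounded_bilinear outer"
proof -
  have "bilinear outer"
    unfolding bilinear_def
    by (auto intro!: linearI simp: vec_eq_iff algebra_simps)
  then show ?thesis by (simp add: bilinear_conv_bounded_bilinear)
qed

lemma projmat_scale:
  assumes "a \<noteq> 0"
  shows "projmat (a *s v) = projmat v"
proof -
  have "outer (a *s v) (a *s v) = (cmod a)\<^sup>2 *\<^sub>R outer v v"
    by (simp only: vec_eq_iff outer_nth vector_scaleR_component vector_smult_component)
      (simp add: scaleR_conv_of_real complex_norm_square del: of_real_power)
  moreover have "(a *s v) \<bullet> (a *s v) = (cmod a)\<^sup>2 * (v \<bullet> v)"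
    by (simp add: dot_square_norm norm_vec_scale power_mult_distrib)
  ultimately show ?thesis using assms by (simp add: projmat_def)
qed

lemma Ck_projmat:
  fixes F :: "'a::euclidean_space \<Rightarrow> complex ^ 'n"
  assumes "open S" "Ck n S F" "\<And>x. x \<in> S \<Longrightarrow> F x \<noteq> 0"
  shows "Ck n S (\<lambda>x. projmat (F x))"
  unfolding projmat_def
  by (intro Ck_bounded_bilinear[OF _ bounded_bilinear_scaleR] Ck_inverse
      Ck_bounded_bilinear[OF _ bounded_bilinear_inner] Ck_bounded_bilinear[OF _ bounded_bilinear_outer])
    (use assms in auto)

text \<open>For \<open>v \<noteq> 0\<close> the part of \<open>w\<close> orthogonal to the complex
  line of \<open>v\<close>; \<open>fubini_study_sq\<close> is its squared length divided by that of
  \<open>v\<close>.\<close>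

definition horizontal :: "complex ^ 'n \<Rightarrow> complex ^ 'n \<Rightarrow> complex ^ 'n" where
  "horizontal v w = w - (hinner w v / of_real (v \<bullet> v)) *s v"

lemma hinner_horizontal: "v \<noteq> 0 \<Longrightarrow> hinner (horizontal v w) v = 0"
  by (simp add: horizontal_def hinner_diff hinner_scale hinner_self)

text \<open>\<open>projmat\<close> is constant along nonzero complex multiples of its argument, so
  the component of \<open>F' h\<close> along \<open>F x\<close> must drop out: its real part is
  absorbed by the derivative of the norm, its imaginary part cancels between the two arguments of
  \<open>outer\<close>.\<close>

lemma has_derivative_projmat:
  assumes F: "(F has_derivative F') (at x within S)" and nz: "F x \<noteq> 0"
  shows "((\<lambda>x. projmat (F x)) has_derivative
    (\<lambda>h. inverse (F x \<bullet> F x) *\<^sub>R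
       (outer (horizontal (F x) (F' h)) (F x) + outer (F x) (horizontal (F x) (F' h))))) (at x within S)"
proof -
  let ?n = "\<lambda>x. F x \<bullet> F x"
  have n0: "?n x \<noteq> 0" using nz by simp
  have n: "((\<lambda>x. inverse (?n x)) has_derivative (\<lambda>h. - (inverse (?n x) * (2 * (F' h \<bullet> F x)) * inverse (?n x)))) (at x within S)"
    by (rule Deriv.has_derivative_inverse[where f="?n", OF n0])
      (use has_derivative_inner[OF F F] in \<open>simp add: inner_commute\<close>)
  have o: "((\<lambda>x. outer (F x) (F x)) has_derivative (\<lambda>h. outer (F x) (F' h) + outer (F' h) (F x))) (at x within S)"
    by (rule bounded_bilinear.FDERIV[OF bounded_bilinear_outer F F])
  have eq: "inverse (?n x) *\<^sub>R (outer (F x) w + outer w (F x)) -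
      (inverse (?n x) * (2 * (w \<bullet> F x)) * inverse (?n x)) *\<^sub>R outer (F x) (F x) =
      inverse (?n x) *\<^sub>R (outer (horizontal (F x) w) (F x) + outer (F x) (horizontal (F x) w))" for w
  proof -
    have "of_real (2 * (w \<bullet> F x)) = hinner w (F x) + cnj (hinner w (F x))"
      by (simp add: inner_eq_hinner complex_add_cnj)
    then have c: "of_real (w \<bullet> F x) = (hinner w (F x) + cnj (hinner w (F x))) / 2"
      by (simp add: field_simps)
    show ?thesis
      using n0
      by (simp only: vec_eq_iff outer_nth vector_scaleR_component vector_add_component
          vector_minus_component horizontal_def vector_smult_component)
        (simp add: scaleR_conv_of_real c field_simps del: inner_eq_zero_iff)
  qed
  show ?thesis
    unfolding projmat_def
    by (rule has_derivative_eq_rhs[OF has_derivative_scaleR[OF n o]])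
      (simp only: scaleR_minus_left add_uminus_conv_diff eq)
qed

text \<open>The two summands are orthogonal to each other and equally long. This is the origin of
  the factor 2 between the Frobenius and the Fubini-Study metric.\<close>

lemma norm_sq_hermitian_outer:
  assumes "hinner u v = 0"
  shows "(norm (outer u v + outer v u))\<^sup>2 = 2 * (u \<bullet> u) * (v \<bullet> v)"
proof -
  have "hinner v u = 0" using assms by (metis complex_cnj_zero hinner_commute)
  then show ?thesis
    by (simp add: power2_norm_eq_inner inner_add_left inner_add_right inner_outer assms hinner_self)
qed

lemma fubini_study_sq_projmat:
  assumes F: "(F has_derivative F') (at x)" and nz: "F x \<noteq> 0"
  shows "2 * fubini_study_sq (F x) (F' h) = (norm (frechet_derivative (\<lambda>x. projmat (F x)) (at x) h))\<^sup>2"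
proof -
  let ?u = "horizontal (F x) (F' h)"
  have "fubini_study_sq (F x) (F' h) = (?u \<bullet> ?u) / (F x \<bullet> F x)"
    by (simp add: fubini_study_sq_def horizontal_def hinner_def power2_norm_eq_inner)
  moreover have "(norm (frechet_derivative (\<lambda>x. projmat (F x)) (at x) h))\<^sup>2 =
      (inverse (F x \<bullet> F x))\<^sup>2 * (2 * (?u \<bullet> ?u) * (F x \<bullet> F x))"
    unfolding frechet_derivative_eqI[OF has_derivative_projmat[OF F nz]]
    by (simp add: power_mult_distrib norm_sq_hermitian_outer[OF hinner_horizontal[OF nz]])
  moreover have "(inverse (F x \<bullet> F x))\<^sup>2 * (2 * (?u \<bullet> ?u) * (F x \<bullet> F x)) = 2 * ((?u \<bullet> ?u) / (F x \<bullet> F x))"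
    using nz by (simp add: field_simps power2_eq_square)
  ultimately show ?thesis by simp
qed

text \<open>Makes a map to projective space a map to a vector space, so that two maps can be
  subtracted. By \<open>projmat_scale\<close> the choice of the representative does not
  matter.\<close>

definition projline :: "(complex ^ 'n) set \<Rightarrow> complex ^ 'n ^ 'n" where
  "projline L = projmat (SOME v. v \<noteq> 0 \<and> L = hcoord v)"

lemma projline_hcoord:
  assumes "v \<noteq> 0"
  shows "projline (hcoord v) = projmat v"
proof -
  define w where "w = (SOME w. w \<noteq> 0 \<and> hcoord v = hcoord w)"
  have w: "w \<noteq> 0 \<and> hcoord v = hcoord w"
    unfolding w_def by (rule someI[of _ v]) (use assms in simp)
  have "w = 1 *s w" by simp
  then have "w \<in> hcoord w" unfolding hcoord_def by blast
  then have "w \<in> hcoord v" using w by simp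
  then obtain a where a: "w = a *s v" by (auto simp: hcoord_def)
  with w have "a \<noteq> 0" by auto
  then show ?thesis unfolding projline_def w_def[symmetric] a by (rule projmat_scale)
qed

section \<open>Differences of projections against normal directions\<close>

lemma Re_hinner_mult_commute: "Re (hinner v w * hinner w v) = (cmod (hinner v w))\<^sup>2"
  by (subst hinner_commute[of w v]) (simp add: cmod_power2 flip: power2_eq_square)

lemma inner_projmat:
  assumes "v \<noteq> 0" "w \<noteq> 0"
  shows "projmat v \<bullet> projmat w = (cmod (hinner v w))\<^sup>2 / ((v \<bullet> v) * (w \<bullet> w))"
  by (simp add: projmat_def inner_outer Re_hinner_mult_commute field_simps del: times_complex.sel)

lemma norm_projmat_diff_sq:
  assumes "v \<noteq> 0" "w \<noteq> 0"
  shows "(norm (projmat v - projmat w))\<^sup>2 = 2 - 2 * (projmat v \<bullet> projmat w)"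
proof -
  have "projmat u \<bullet> projmat u = 1" if "u \<noteq> 0" for u :: "complex ^ 'n"
    using that by (simp add: inner_projmat hinner_self power2_eq_square)
  from this[OF assms(1)] this[OF assms(2)] show ?thesis
    by (simp add: power2_norm_eq_inner inner_diff_left inner_diff_right inner_commute)
qed

text \<open>First kind of normal direction. \<open>outer w w\<close> is a multiple of the projection
  P_w, and projections onto lines have norm one, so the product of P_v - P_w with P_w is - |P_v -
  P_w|^2 / 2.\<close>

lemma inner_projmat_diff_outer_self:
  assumes "v \<noteq> 0" "w \<noteq> 0"
  shows "(projmat v - projmat w) \<bullet> outer w w = - (w \<bullet> w) * (norm (projmat v - projmat w))\<^sup>2 / 2"
proof -
  have "outer w w = (w \<bullet> w) *\<^sub>R projmat w" using assms by (simp add: projmat_def)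
  moreover have "projmat w \<bullet> projmat w = 1"
    using assms by (simp add: inner_projmat hinner_self power2_eq_square)
  ultimately show ?thesis
    using assms by (simp add: norm_projmat_diff_sq inner_diff_left algebra_simps)
qed

text \<open>Second kind of normal direction. The projection onto \<open>w\<close> annihilates
  \<open>r\<close>, and \<open>r\<close> sees only the part \<open>?u\<close> of \<open>v\<close>
  orthogonal to \<open>w\<close>, so Cauchy-Schwarz bounds the pairing by |r|^2 times |?u|^2 /
  |v|^2. The last quotient is the squared sine of the angle between the lines, which is half the
  squared distance of the projections.\<close>

lemma inner_projmat_diff_outer_orthogonal:
  assumes "v \<noteq> 0" "w \<noteq> 0" and orth: "hinner r w = 0"
  shows "\<bar>(projmat v - projmat w) \<bullet> outer r r\<bar> \<le> (r \<bullet> r) * (norm (projmat v - projmat w))\<^sup>2 / 2"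
proof -
  have wr: "hinner w r = 0" using orth by (metis complex_cnj_zero hinner_commute)
  let ?u = "horizontal w v"
  have v: "hinner v r = hinner ?u r"
    by (simp add: horizontal_def hinner_diff hinner_scale wr)
  have uu: "?u \<bullet> ?u = (v \<bullet> v) - (cmod (hinner v w))\<^sup>2 / (w \<bullet> w)"
  proof -
    have "hinner ?u ?u = hinner v ?u"
      using hinner_horizontal[OF assms(2), of v] hinner_commute[of w ?u]
      by (subst (1) horizontal_def) (simp add: hinner_diff hinner_scale)
    also have "\<dots> = cnj (hinner ?u v)" by (rule hinner_commute)
    also have "\<dots> = cnj (hinner v v - hinner v w / of_real (w \<bullet> w) * hinner w v)"
      by (simp add: horizontal_def hinner_diff hinner_scale)
    also have "\<dots> = of_real ((v \<bullet> v) - (cmod (hinner v w))\<^sup>2 / (w \<bullet> w))"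
      by (subst (2) hinner_commute) (simp add: hinner_self complex_norm_square mult.commute del: of_real_power)
    finally show ?thesis by (simp only: hinner_self of_real_eq_iff)
  qed
  have "(projmat v - projmat w) \<bullet> outer r r = (cmod (hinner v r))\<^sup>2 / (v \<bullet> v)"
    by (simp add: projmat_def inner_diff_left inner_outer wr orth Re_hinner_mult_commute
        inverse_eq_divide del: times_complex.sel)
  then have "\<bar>(projmat v - projmat w) \<bullet> outer r r\<bar> = (cmod (hinner v r))\<^sup>2 / (v \<bullet> v)" by simp
  also have "\<dots> \<le> ((?u \<bullet> ?u) * (r \<bullet> r)) / (v \<bullet> v)"
    unfolding v using power_mono[OF cmod_hinner_le[of ?u r], of 2]
    by (intro divide_right_mono) (auto simp: power_mult_distrib power2_norm_eq_inner)
  also have "(?u \<bullet> ?u) = (v \<bullet> v) * (norm (projmat v - projmat w))\<^sup>2 / 2"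
    using assms(1,2) by (simp add: uu norm_projmat_diff_sq inner_projmat field_simps)
  finally show ?thesis using assms(1) by (simp add: mult.commute)
qed

text \<open>Computed entry by entry as 4 times \<open>d_z\<close> of \<open>d_zbar\<close>. The
  hypotheses are the Dirac equation for \<open>F\<close> and its image under the quaternionic
  rotation; the derivative \<open>e\<close> of \<open>G\<close> may be anything, because only the
  other derivative of \<open>G\<close> enters.\<close>

lemma laplace_projmat:
  fixes F G :: "complex \<Rightarrow> complex ^ 'n" and l :: real
  defines "N \<equiv> \<lambda>w. complex_of_real (F w \<bullet> F w)"
  assumes S: "open S" "z \<in> S" and C: "Ck 2 S F" and nz: "\<And>w. w \<in> S \<Longrightarrow> F w \<noteq> 0"
    and Fzbar: "\<And>w i. w \<in> S \<Longrightarrow> d_zbar (\<lambda>w. F w $ i) w = of_real l * N w * G w $ i"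
    and G: "\<And>w i. w \<in> S \<Longrightarrow> wirt (\<lambda>w. G w $ i) (- of_real l * N w * F w $ i) (e w i) w"
    and orth: "\<And>w. w \<in> S \<Longrightarrow> hinner (G w) (F w) = 0"
  defines "A \<equiv> \<chi> i. d_z (\<lambda>w. F w $ i) z"
  defines "R \<equiv> horizontal (F z) A"
  defines "M \<equiv> \<lambda>w. projmat (F w)"
  shows "frechet_derivative (\<lambda>w. frechet_derivative M (at w) 1) (at z) 1 +
      frechet_derivative (\<lambda>w. frechet_derivative M (at w) \<i>) (at z) \<i> =
      4 *\<^sub>R ((l\<^sup>2 * (F z \<bullet> F z)) *\<^sub>R (outer (G z) (G z) - outer (F z) (F z)) +
        inverse (F z \<bullet> F z) *\<^sub>R outer R R -
        ((R \<bullet> R) / (F z \<bullet> F z)\<^sup>2) *\<^sub>R outer (F z) (F z))"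
proof -
  let ?A = "\<lambda>w i. d_z (\<lambda>w. F w $ i) w"
  let ?s = "\<lambda>w. \<Sum>k\<in>UNIV. ?A w k * cnj (F w $ k)"
  let ?r = "\<lambda>w j. ?A w j - ?s w * F w $ j / N w"
  let ?B = "\<lambda>i j. frechet_derivative (\<lambda>w. frechet_derivative (\<lambda>w. M w $ i $ j) (at w) 1) (at z) 1 +
      frechet_derivative (\<lambda>w. frechet_derivative (\<lambda>w. M w $ i $ j) (at w) \<i>) (at z) \<i>"
  have CF: "Ck 2 S (\<lambda>w. F w $ i)" for i by (rule Ck_vec_nth[OF S(1) C])
  have N0: "N w \<noteq> 0" if "w \<in> S" for w using nz[OF that] by (simp add: N_def)
  have N_eq: "N w = (\<Sum>k\<in>UNIV. F w $ k * cnj (F w $ k))" for w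
    unfolding N_def hinner_self[symmetric] hinner_def ..
  have wF: "wirt (\<lambda>w. F w $ i) (?A w i) (of_real l * N w * G w $ i) w" if "w \<in> S" for w i
    using differentiable_wirt[of "\<lambda>w. F w $ i" w] CF[of i] that Fzbar[OF that, of i]
    by (auto simp: numeral_2_eq_2)
  have wFc: "wirt (\<lambda>w. cnj (F w $ i)) (cnj (of_real l * N w * G w $ i)) (cnj (?A w i)) w" if "w \<in> S" for w i
    by (rule wirt_cnj[OF wF[OF that]])
  have GF: "(\<Sum>k\<in>UNIV. G w $ k * cnj (F w $ k)) = 0" if "w \<in> S" for w
    using orth[OF that] by (simp add: hinner_def)
  have FG: "(\<Sum>k\<in>UNIV. F w $ k * cnj (G w $ k)) = 0" if "w \<in> S" for w
    using arg_cong[OF GF[OF that], of cnj] by (simp add: mult.commute)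
  have Nc: "cnj (N w) = N w" for w by (simp add: N_def)
  \<comment> \<open>\<open>G\<close> is orthogonal to \<open>F\<close>, so the Dirac terms
    contribute nothing to the derivatives of |F|^2.\<close>
  have wN: "wirt N (?s w) (cnj (?s w)) w" if w: "w \<in> S" for w
  proof -
    have "wirt (\<lambda>w. \<Sum>k\<in>UNIV. F w $ k * cnj (F w $ k))
       (\<Sum>k\<in>UNIV. F w $ k * cnj (of_real l * N w * G w $ k) + ?A w k * cnj (F w $ k))
       (\<Sum>k\<in>UNIV. F w $ k * cnj (?A w k) + (of_real l * N w * G w $ k) * cnj (F w $ k)) w"
      by (intro wirt_sum wirt_mult wF wFc w) simp
    moreover have "(\<Sum>k\<in>UNIV. F w $ k * cnj (of_real l * N w * G w $ k)) = of_real l * N w * (\<Sum>k\<in>UNIV. F w $ k * cnj (G w $ k))"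
      by (simp add: sum_distrib_left Nc algebra_simps)
    moreover have "(\<Sum>k\<in>UNIV. (of_real l * N w * G w $ k) * cnj (F w $ k)) = of_real l * N w * (\<Sum>k\<in>UNIV. G w $ k * cnj (F w $ k))"
      by (simp add: sum_distrib_left algebra_simps)
    moreover have "(\<lambda>w. \<Sum>k\<in>UNIV. F w $ k * cnj (F w $ k)) = N" by (rule ext) (simp add: N_eq)
    moreover have "(\<Sum>k\<in>UNIV. F w $ k * cnj (?A w k)) = cnj (?s w)"
      by (simp add: mult.commute)
    ultimately show ?thesis
      by (simp only: sum.distrib GF[OF w] FG[OF w] mult_zero_right add_0_left add_0_right)
  qed
  have Mij: "M w $ i $ j = F w $ i * cnj (F w $ j) / N w" for w i j
    by (simp only: M_def projmat_def N_def vector_scaleR_component outer_nth)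
      (simp add: scaleR_conv_of_real field_simps)
  \<comment> \<open>The first summand is the Dirac term. In the second, the quotient rule subtracts
    exactly what turns the holomorphic derivative of \<open>F\<close> into its horizontal part
    \<open>?r\<close>.\<close>
  have Mzbar: "d_zbar (\<lambda>w. M w $ i $ j) w = of_real l * G w $ i * cnj (F w $ j) + F w $ i * cnj (?r w j) / N w"
    if w: "w \<in> S" for w i j
    unfolding Mij
    by (subst wirt_d_zbar[OF wirt_divide[OF wirt_mult[OF wF[OF w] wFc[OF w]] wN[OF w] N0[OF w]]])
      (use N0[OF w] in \<open>simp add: Nc field_simps power2_eq_square del: cnj_sum\<close>)
  have CA: "Ck 1 S (\<lambda>w. ?A w i)" for i
    using Ck_d_z[OF S(1), of 1] CF[of i] by (simp add: numeral_2_eq_2)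
  let ?l = "complex_of_real l" and ?N = "N z" and ?f = "\<lambda>i. F z $ i" and ?g = "\<lambda>i. G z $ i"
    and ?a = "\<lambda>i. ?A z i" and ?t = "?s z"
  \<comment> \<open>Commuting the derivatives means that the Dirac equation is differentiated, not
    the unknown holomorphic derivative.\<close>
  have Azbar: "d_zbar (\<lambda>w. ?A w j) z = ?l * ?t * ?g j - ?l\<^sup>2 * ?N\<^sup>2 * ?f j" for j
  proof -
    have "d_zbar (\<lambda>w. ?A w j) z = d_z (d_zbar (\<lambda>w. F w $ j)) z"
      by (rule wirt_laplace(1)[OF S CF])
    also have "\<dots> = ?l * ?t * ?g j - ?l\<^sup>2 * ?N\<^sup>2 * ?f j"
    proof (rule wirt_d_z, rule wirt_cong_open[OF _ S])
      have "wirt (\<lambda>w. of_real l * (N w * G w $ j)) (?l * (?N * (- of_real l * ?N * ?f j) + ?t * ?g j))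
        (?l * (?N * e z j + cnj ?t * ?g j)) z"
        by (intro wirt_cmult wirt_mult wN G S)
      then show "wirt (\<lambda>w. of_real l * (N w * G w $ j)) (?l * ?t * ?g j - ?l\<^sup>2 * ?N\<^sup>2 * ?f j)
        (?l * (?N * e z j + cnj ?t * ?g j)) z"
        by (simp add: algebra_simps power2_eq_square)
    qed (simp add: Fzbar)
    finally show ?thesis .
  qed
  have wA: "wirt (\<lambda>w. ?A w j) (d_z (\<lambda>w. ?A w j) z) (?l * ?t * ?g j - ?l\<^sup>2 * ?N\<^sup>2 * ?f j) z" for j
    using differentiable_wirt[of "\<lambda>w. ?A w j" z] CA[of j] S(2) by (auto simp: Azbar)
  let ?K = "\<Sum>k\<in>UNIV. ?a k * cnj (?a k)"
  \<comment> \<open>The terms with \<open>G\<close> again sum to zero; what survives is the squared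
    length \<open>?K\<close> of the holomorphic derivative and the \<open>F\<close> part of
    \<open>Azbar\<close>.\<close>
  have ws: "\<exists>b. wirt ?s b (?K - ?l\<^sup>2 * ?N^3) z"
  proof -
    have "wirt ?s (\<Sum>k\<in>UNIV. ?a k * cnj (of_real l * ?N * ?g k) + d_z (\<lambda>w. ?A w k) z * cnj (?f k))
       (\<Sum>k\<in>UNIV. ?a k * cnj (?a k) + (?l * ?t * ?g k - ?l\<^sup>2 * ?N\<^sup>2 * ?f k) * cnj (?f k)) z"
      by (intro wirt_sum wirt_mult wA wFc S) simp
    moreover have "(\<Sum>k\<in>UNIV. (c * ?g k - d * ?f k) * cnj (?f k)) =
       c * (\<Sum>k\<in>UNIV. ?g k * cnj (?f k)) - d * (\<Sum>k\<in>UNIV. ?f k * cnj (?f k))" for c d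
      by (simp add: sum_distrib_left algebra_simps sum_subtractf)
    note this[of "?l * ?t" "?l\<^sup>2 * ?N\<^sup>2"]
    then have "(\<Sum>k\<in>UNIV. ?a k * cnj (?a k) + (?l * ?t * ?g k - ?l\<^sup>2 * ?N\<^sup>2 * ?f k) * cnj (?f k)) = ?K - ?l\<^sup>2 * ?N^3"
      unfolding sum.distrib GF[OF S(2)] N_eq[symmetric] by (simp add: power3_eq_cube power2_eq_square)
    ultimately show ?thesis by auto
  qed
  let ?k = "?K / ?N - ?t * cnj ?t / ?N\<^sup>2"
  \<comment> \<open>The decisive cancellation: the terms with \<open>G\<close> coming from
    \<open>Azbar\<close> and from the quotient rule are opposite, and so are those with l^2. Only a
    multiple of \<open>F\<close> is left, with factor \<open>?k\<close> equal to |R|^2 /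
    |F|^2.\<close>
  have wr: "\<exists>b. wirt (\<lambda>w. ?r w j) b (- ?k * ?f j) z" for j
  proof -
    obtain b where b: "wirt ?s b (?K - ?l\<^sup>2 * ?N^3) z" using ws by blast
    have "(?l * ?t * ?g j - ?l\<^sup>2 * ?N\<^sup>2 * ?f j) -
        ((?t * (?l * ?N * ?g j) + (?K - ?l\<^sup>2 * ?N^3) * ?f j) / ?N - (?t * ?f j) * cnj ?t / ?N\<^sup>2) = - ?k * ?f j"
      using N0[OF S(2)] by (simp add: divide_simps) (simp add: algebra_simps power2_eq_square power3_eq_cube)
    with wirt_diff[OF wA wirt_divide[OF wirt_mult[OF b wF[OF S(2)]] wN[OF S(2)] N0[OF S(2)]], of j j]
    show ?thesis by metis
  qed
  have kc: "cnj ?k = ?k" by (simp add: Nc mult.commute)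
  have B: "?B i j = 4 * (?l\<^sup>2 * ?N * (?g i * cnj (?g j) - ?f i * cnj (?f j)) + ?r z i * cnj (?r z j) / ?N
      - ?k * ?f i * cnj (?f j) / ?N)" for i j
  proof -
    have CM: "Ck 2 S (\<lambda>w. M w $ i $ j)"
      unfolding M_def by (intro Ck_vec_nth Ck_projmat S C nz)
    obtain b where b: "wirt (\<lambda>w. ?r w j) b (- ?k * ?f j) z" using wr by blast
    let ?c = "of_real l * (?g i * cnj (?l * ?N * ?g j) + (- ?l * ?N * ?f i) * cnj (?f j)) +
        ((?f i * cnj (- ?k * ?f j) + ?a i * cnj (?r z j)) / ?N - ?f i * cnj (?r z j) * ?t / ?N\<^sup>2)"
    have "\<exists>d. wirt (\<lambda>w. of_real l * (G w $ i * cnj (F w $ j)) + F w $ i * cnj (?r w j) / N w) ?c d z"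
      by (rule exI, rule wirt_add[OF wirt_cmult[OF wirt_mult[OF G[OF S(2)] wFc[OF S(2)]]]
         wirt_divide[OF wirt_mult[OF wF[OF S(2)] wirt_cnj[OF b]] wN[OF S(2)] N0[OF S(2)]]])
    then obtain d where "wirt (\<lambda>w. of_real l * (G w $ i * cnj (F w $ j)) + F w $ i * cnj (?r w j) / N w) ?c d z"
      by blast
    from wirt_cong_open[OF this S, of "d_zbar (\<lambda>w. M w $ i $ j)"]
    have "wirt (d_zbar (\<lambda>w. M w $ i $ j)) ?c d z" by (simp add: Mzbar mult.assoc)
    then have "d_z (d_zbar (\<lambda>w. M w $ i $ j)) z = ?c" by (rule wirt_d_z)
    moreover have "?c = ?l\<^sup>2 * ?N * (?g i * cnj (?g j) - ?f i * cnj (?f j)) + ?r z i * cnj (?r z j) / ?N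
      - ?k * ?f i * cnj (?f j) / ?N"
    proof -
      have "?c = ?l\<^sup>2 * ?N * (?g i * cnj (?g j) - ?f i * cnj (?f j)) + (?a i - ?t * ?f i / ?N) * cnj (?r z j) / ?N
        - ?k * ?f i * cnj (?f j) / ?N" if "cnj (?r z j) = q" "?k = kk" "cnj kk = kk" for q kk
        unfolding complex_cnj_mult complex_cnj_minus that Nc
        using N0[OF S(2)] by (simp add: divide_simps) (simp add: algebra_simps power2_eq_square)
      then show ?thesis using kc by blast
    qed
    ultimately show ?thesis using wirt_laplace(2)[OF S CM] by simp
  qed
  have R: "R $ i = ?r z i" for i
    by (simp add: R_def horizontal_def A_def hinner_def N_def)
  have hA: "hinner A (F z) = ?t" by (simp add: hinner_def A_def)
  have hAA: "hinner A A = ?K" by (simp add: hinner_def A_def)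
  have RR: "of_real (R \<bullet> R) = ?K - ?t * cnj ?t / ?N"
  proof -
    have "hinner R R = hinner A R"
      using hinner_horizontal[OF nz[OF S(2)], of A] hinner_commute[of "F z" R]
      unfolding R_def[symmetric] by (subst (1) R_def) (simp add: horizontal_def hinner_diff hinner_scale)
    also have "\<dots> = cnj (hinner R A)" by (rule hinner_commute)
    also have "hinner R A = ?K - ?t / ?N * hinner (F z) A"
      unfolding R_def horizontal_def hinner_diff hinner_scale hA hAA N_def ..
    also have "hinner (F z) A = cnj ?t" unfolding hA[symmetric] by (rule hinner_commute)
    finally show ?thesis by (simp add: hinner_self Nc mult.commute)
  qed
  have kN: "of_real ((R \<bullet> R) / (F z \<bullet> F z)\<^sup>2) = ?k / ?N"
  proof -
    have "complex_of_real (F z \<bullet> F z) = ?N" by (simp add: N_def)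
    moreover have "(K - X / ?N) / ?N\<^sup>2 = (K / ?N - X / ?N\<^sup>2) / ?N" for K X
      using N0[OF S(2)] by (simp add: field_simps power2_eq_square)
    ultimately show ?thesis unfolding of_real_divide RR of_real_power by simp
  qed
  have CM: "Ck 2 S M" unfolding M_def by (intro Ck_projmat S C nz)
  have nth: "frechet_derivative f (at w) v $ i $ j = frechet_derivative (\<lambda>w. f w $ i $ j) (at w) v"
    if "f differentiable (at w)" for f :: "complex \<Rightarrow> complex ^ 'n ^ 'n" and w v i j
    using frechet_derivative_eqI[OF bounded_linear.has_derivative[OF bounded_linear_vec_nth
       bounded_linear.has_derivative[OF bounded_linear_vec_nth, of f]]] that
    by (metis frechet_derivative_works)
  have B': "(frechet_derivative (\<lambda>w. frechet_derivative M (at w) v) (at z) v) $ i $ j =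
     frechet_derivative (\<lambda>w. frechet_derivative (\<lambda>w. M w $ i $ j) (at w) v) (at z) v" for v i j
  proof -
    have "(\<lambda>w. frechet_derivative M (at w) v) differentiable (at z)"
      using CM S by (simp add: numeral_2_eq_2)
    from nth[OF this] have "(frechet_derivative (\<lambda>w. frechet_derivative M (at w) v) (at z) v) $ i $ j =
      frechet_derivative (\<lambda>w. frechet_derivative M (at w) v $ i $ j) (at z) v" .
    also have "\<dots> = frechet_derivative (\<lambda>w. frechet_derivative (\<lambda>w. M w $ i $ j) (at w) v) (at z) v"
      by (rule arg_cong[where f="\<lambda>D. D v"], rule frechet_derivative_cong_open[OF S])
        (rule nth, use CM in \<open>simp add: numeral_2_eq_2\<close>)
    finally show ?thesis .
  qed
  have comp: "(4 *\<^sub>R ((x *\<^sub>R (outer (G z) (G z) - outer (F z) (F z)) + y *\<^sub>R outer R R - t *\<^sub>R outer (F z) (F z)))) $ i $ j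
     = 4 * (of_real x * (?g i * cnj (?g j) - ?f i * cnj (?f j)) + of_real y * (R $ i * cnj (R $ j))
         - of_real t * (?f i * cnj (?f j)))" for x y t :: real and i j
    by (simp only: vector_scaleR_component vector_add_component vector_minus_component outer_nth)
      (simp add: scaleR_conv_of_real)
  show ?thesis
    unfolding vec_eq_iff comp vector_add_component B' B kN R
    by (simp add: N_def divide_inverse algebra_simps)
qed

section \<open>Conformal charts and adapted frames\<close>

text \<open>The conformal factor whenever the chart lies in \<open>hol_charts\<close>, see
  \<open>metric_conf\<close>.\<close>

definition conf :: "'a surface_metric \<Rightarrow> 'a chart \<Rightarrow> 'a \<Rightarrow> real" where
  "conf g c p = g c p 1 1"

text \<open>\<open>hol_cover\<close> expresses that isothermal coordinates exist near every point;
  \<open>hol_charts\<close> is then a complex atlas by \<open>hol_transition\<close>.\<close>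

locale conformal_surface =
  fixes A :: "'a::t2_space chart set" and g :: "'a surface_metric"
  assumes atlas: "oriented_smooth_structure A"
    and metric: "riemannian_metric A g"
    and hol_cover: "(\<Union>c\<in>hol_charts A g. fst c) = UNIV"
begin

lemma hol_in_atlas: "c \<in> hol_charts A g \<Longrightarrow> c \<in> A"
  by (simp add: hol_charts_def)

lemma is_chart: "c \<in> A \<Longrightarrow> is_chart c"
  using atlas by (simp add: oriented_smooth_structure_def)

lemma
  assumes "c \<in> A"
  shows open_domain: "open (fst c)" and open_range: "open (snd c ` fst c)"
    and continuous_chart: "continuous_on (fst c) (snd c)"
    and continuous_chart_inv: "continuous_on (snd c ` fst c) (chart_inv c)"
    and chart_inv_chart [simp]: "p \<in> fst c \<Longrightarrow> chart_inv c (snd c p) = p"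
  using is_chart[OF assms] by (auto simp: is_chart_def homeomorphism_def)

lemma chart_inv_in: "c \<in> A \<Longrightarrow> z \<in> snd c ` fst c \<Longrightarrow> chart_inv c z \<in> fst c"
  and chart_chart_inv: "c \<in> A \<Longrightarrow> z \<in> snd c ` fst c \<Longrightarrow> snd c (chart_inv c z) = z"
  by auto

lemma open_chart_image:
  assumes "c \<in> A" "open U"
  shows "open (snd c ` (fst c \<inter> U))"
proof -
  have "snd c ` (fst c \<inter> U) = snd c ` fst c \<inter> chart_inv c -` U" using assms by force
  then show ?thesis
    using continuous_open_preimage[OF continuous_chart_inv open_range] assms by metis
qed

lemma transition_chart: "c \<in> A \<Longrightarrow> p \<in> fst c \<Longrightarrow> transition c c' (snd c p) = snd c' p"
  by (simp add: transition_def)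

lemma transition_differentiable:
  assumes "c \<in> A" "c' \<in> A" "p \<in> fst c" "p \<in> fst c'"
  shows "transition c c' differentiable (at (snd c p))"
proof -
  have "smooth_on (snd c ` (fst c \<inter> fst c')) (transition c c')"
    using atlas assms by (simp add: oriented_smooth_structure_def oriented_compatible_def)
  then have "Ck 1 (snd c ` (fst c \<inter> fst c')) (transition c c')" by (rule smooth_on_Ck)
  then show ?thesis using assms by auto
qed

lemma chart_change:
  assumes "c \<in> A" "c' \<in> A" "w \<in> snd c ` (fst c \<inter> fst c')"
  shows "(u \<circ> chart_inv c') (transition c c' w) = (u \<circ> chart_inv c) w"
  using assms by (auto simp: transition_def)

lemma has_derivative_chart_change:
  assumes c: "c \<in> A" "c' \<in> A" "p \<in> fst c" "p \<in> fst c'"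
    and u: "((u \<circ> chart_inv c') has_derivative D) (at (snd c' p))"
  shows "((u \<circ> chart_inv c) has_derivative
    (\<lambda>v. D (frechet_derivative (transition c c') (at (snd c p)) v))) (at (snd c p))"
proof -
  have "((\<lambda>w. (u \<circ> chart_inv c') (transition c c' w)) has_derivative
    (\<lambda>v. D (frechet_derivative (transition c c') (at (snd c p)) v))) (at (snd c p))"
    by (rule has_derivative_compose[where f="transition c c'" and g="u \<circ> chart_inv c'" and g'=D])
      (use transition_differentiable[OF c] u in
        \<open>simp_all add: frechet_derivative_works transition_chart[OF c(1,3)]\<close>)
  then show ?thesis
  proof (rule has_derivative_transform_within_open)
    show "open (snd c ` (fst c \<inter> fst c'))" by (rule open_chart_image[OF c(1) open_domain[OF c(2)]])
    show "snd c p \<in> snd c ` (fst c \<inter> fst c')" using c by blast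
  qed (rule chart_change[OF c(1,2)])
qed

lemma metric_change:
  "c \<in> A \<Longrightarrow> c' \<in> A \<Longrightarrow> p \<in> fst c \<Longrightarrow> p \<in> fst c' \<Longrightarrow>
   g c p v w = g c' p (frechet_derivative (transition c c') (at (snd c p)) v)
                      (frechet_derivative (transition c c') (at (snd c p)) w)"
  using metric unfolding riemannian_metric_def by blast

lemma metric_pos: "c \<in> A \<Longrightarrow> p \<in> fst c \<Longrightarrow> v \<noteq> 0 \<Longrightarrow> g c p v v > 0"
  using metric unfolding riemannian_metric_def by blast

lemma conf_pos: "c \<in> A \<Longrightarrow> p \<in> fst c \<Longrightarrow> conf g c p > 0"
  by (simp add: conf_def metric_pos)

lemma metric_conf:
  assumes "c \<in> hol_charts A g" "p \<in> fst c"
  shows "g c p v w = conf g c p * (v \<bullet> w)"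
proof -
  obtain r where r: "\<And>v w. g c p v w = r * (v \<bullet> w)" using assms unfolding hol_charts_def by blast
  show ?thesis unfolding conf_def r by simp
qed

lemma smooth_conf:
  assumes "c \<in> A"
  shows "smooth_on (snd c ` fst c) (\<lambda>z. conf g c (chart_inv c z))"
  using metric assms unfolding riemannian_metric_def conf_def by blast

text \<open>Between conformal charts the derivative at a point multiplies inner products by a
  constant, so it maps 1 and \<i> to orthogonal vectors \<open>a\<close> and \<open>b\<close> of
  equal length. Orientation selects b = i a against b = - i a, and this is the Cauchy-Riemann
  equation.\<close>

lemma hol_transition:
  assumes c: "c \<in> hol_charts A g" "c' \<in> hol_charts A g" "p \<in> fst c" "p \<in> fst c'"
  shows "(transition c c' has_field_derivative deriv (transition c c') (snd c p)) (at (snd c p))"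
    and "conf g c p = conf g c' p * (cmod (deriv (transition c c') (snd c p)))\<^sup>2"
    and "deriv (transition c c') (snd c p) \<noteq> 0"
proof -
  let ?L = "frechet_derivative (transition c c') (at (snd c p))"
  have cA: "c \<in> A" "c' \<in> A" using c by (auto simp: hol_in_atlas)
  have diff: "transition c c' differentiable (at (snd c p))"
    by (rule transition_differentiable[OF cA c(3,4)])
  define a b r where "a = ?L 1" and "b = ?L \<i>" and "r = conf g c p / conf g c' p"
  have pos: "conf g c p > 0" "conf g c' p > 0" using conf_pos cA c by auto
  have L: "?L v \<bullet> ?L w = r * (v \<bullet> w)" for v w
    using metric_change[OF cA c(3,4), of v w] pos
    by (simp add: metric_conf[OF c(1,3)] metric_conf[OF c(2,4)] r_def field_simps)
  have aa: "a \<bullet> a = r" and bb: "b \<bullet> b = r" and ab: "a \<bullet> b = 0"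
    unfolding a_def b_def L by (simp_all add: inner_complex_def)
  have r0: "r > 0" using pos by (simp add: r_def)
  have "jacobian_det (transition c c') (snd c p) > 0"
    using atlas cA c by (auto simp: oriented_smooth_structure_def oriented_compatible_def)
  then have det: "Im (cnj a * b) > 0" by (simp add: jacobian_det_def a_def b_def)
  \<comment> \<open>Lagrange's identity for the Gram determinant; it gives the Jacobian up to sign,
    and \<open>det\<close> fixes the sign.\<close>
  have "(Im (cnj a * b))\<^sup>2 = (a \<bullet> a) * (b \<bullet> b) - (a \<bullet> b)\<^sup>2"
    by (simp add: inner_complex_def power2_eq_square algebra_simps)
  then have "(Im (cnj a * b))\<^sup>2 = r\<^sup>2" by (simp add: aa bb ab power2_eq_square)
  then have "Im (cnj a * b) = r" using det r0 by (simp add: power2_eq_iff)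
  then have "cnj a * b = \<i> * of_real r" using ab by (simp add: complex_eq_iff inner_complex_def)
  also have "of_real r = cnj a * a"
    using aa by (simp add: complex_eq_iff inner_complex_def algebra_simps)
  finally have "cnj a * b = cnj a * (\<i> * a)" by (simp add: algebra_simps)
  moreover have "a \<noteq> 0" using aa r0 by auto
  ultimately have b: "b = \<i> * a" by simp
  have "wirt (transition c c') a 0 (snd c p)"
    using differentiable_wirt[OF diff] unfolding d_z_def d_zbar_def a_def[symmetric] b_def[symmetric] b
    by (simp add: field_simps)
  then have D: "(transition c c' has_field_derivative a) (at (snd c p))"
    by (simp add: wirt_def has_field_derivative_def)
  from DERIV_imp_deriv[OF D] have d: "deriv (transition c c') (snd c p) = a" .
  show "(transition c c' has_field_derivative deriv (transition c c') (snd c p)) (at (snd c p))"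
    unfolding d by (rule D)
  show "conf g c p = conf g c' p * (cmod (deriv (transition c c') (snd c p)))\<^sup>2"
    unfolding d using aa pos by (simp add: r_def dot_square_norm field_simps)
  show "deriv (transition c c') (snd c p) \<noteq> 0" unfolding d by fact
qed

lemma hol_transition_frechet:
  assumes c: "c \<in> hol_charts A g" "c' \<in> hol_charts A g" "p \<in> fst c" "p \<in> fst c'"
  shows "frechet_derivative (transition c c') (at (snd c p)) v = deriv (transition c c') (snd c p) * v"
  using wirt_frechet[OF wirt_field_derivative[OF hol_transition(1)[OF c]]] by simp

lemma wirt_chart_change:
  assumes c: "c \<in> hol_charts A g" "c' \<in> hol_charts A g" "p \<in> fst c" "p \<in> fst c'"
    and u: "wirt (u \<circ> chart_inv c') a b (snd c' p)"
  shows "wirt (u \<circ> chart_inv c) (a * deriv (transition c c') (snd c p))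
    (b * cnj (deriv (transition c c') (snd c p))) (snd c p)"
  using has_derivative_chart_change[OF hol_in_atlas[OF c(1)] hol_in_atlas[OF c(2)] c(3,4) u[unfolded wirt_def]]
  by (simp add: hol_transition_frechet[OF c] wirt_def mult.assoc)

definition restrict_chart :: "'a chart \<Rightarrow> 'a set \<Rightarrow> 'a chart" where
  "restrict_chart c U = (fst c \<inter> U, snd c)"

lemma restrict_chart_simps [simp]:
  "fst (restrict_chart c U) = fst c \<inter> U" "snd (restrict_chart c U) = snd c"
  by (simp_all add: restrict_chart_def)

lemma chart_inv_restrict:
  assumes "c \<in> A" "z \<in> snd c ` (fst c \<inter> U)"
  shows "chart_inv (restrict_chart c U) z = chart_inv c z"
proof -
  obtain p where p: "p \<in> fst c" "p \<in> U" "z = snd c p" using assms by auto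
  have "inj_on (snd c) (fst c)" by (metis assms(1) chart_inv_chart inj_on_inverseI)
  then have "inj_on (snd c) (fst c \<inter> U)" by (rule inj_on_subset) auto
  then have "chart_inv (restrict_chart c U) z = p"
    using p by (simp add: chart_inv_def)
  then show ?thesis using p assms by simp
qed

text \<open>Maximality of the atlas: compatibility with all its charts suffices, and a restriction
  inherits it. Needed because sections with square dz are constructed only over small
  domains.\<close>

lemma restrict_chart_in_atlas:
  assumes c: "c \<in> A" and U: "open U"
  shows "restrict_chart c U \<in> A"
proof -
  let ?c = "restrict_chart c U"
  have im: "open (snd c ` (fst c \<inter> U))" by (rule open_chart_image[OF c U])
  have "homeomorphism (fst c \<inter> U) (snd c ` (fst c \<inter> U)) (snd c) (chart_inv ?c)"
    unfolding homeomorphism_def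
  proof (intro conjI ballI)
    show "continuous_on (fst c \<inter> U) (snd c)"
      using continuous_chart[OF c] by (rule continuous_on_subset) auto
    have "continuous_on (snd c ` (fst c \<inter> U)) (chart_inv c)"
      using continuous_chart_inv[OF c] by (rule continuous_on_subset) auto
    then show "continuous_on (snd c ` (fst c \<inter> U)) (chart_inv ?c)"
      by (rule continuous_on_eq) (simp add: chart_inv_restrict[OF c])
    show *: "chart_inv ?c (snd c x) = x" if "x \<in> fst c \<inter> U" for x
      using that c by (simp add: chart_inv_restrict)
    show "snd c (chart_inv ?c y) = y" if "y \<in> snd c ` (fst c \<inter> U)" for y
      using that * by auto
    show "chart_inv ?c ` snd c ` (fst c \<inter> U) = fst c \<inter> U"
      using * by force
  qed auto
  then have chart: "is_chart ?c"
    using open_domain[OF c] U im by (simp add: is_chart_def open_Int)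
  have comp: "oriented_compatible ?c c' \<and> oriented_compatible c' ?c" if c': "c' \<in> A" for c'
  proof -
    have compat: "oriented_compatible c c'" "oriented_compatible c' c"
      using atlas c c' by (auto simp: oriented_smooth_structure_def)
    let ?V = "snd c ` (fst c \<inter> U \<inter> fst c')"
    have V: "open ?V" using open_chart_image[OF c open_Int[OF U open_domain[OF c']]] by (simp add: Int_assoc)
    have eq: "transition c c' z = transition ?c c' z" if "z \<in> ?V" for z
      using chart_inv_restrict[OF c, of z U] that by (auto simp: transition_def)
    have "smooth_on ?V (transition c c')"
      using compat(1) by (auto simp: oriented_compatible_def intro: smooth_on_subset)
    then have "smooth_on ?V (transition ?c c')" using smooth_on_cong[OF V eq] by simp
    moreover have "jacobian_det (transition ?c c') z = jacobian_det (transition c c') z" if "z \<in> ?V" for z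
      unfolding jacobian_det_def using frechet_derivative_cong_open[OF V that, of "transition c c'" "transition ?c c'"] eq
      by simp
    ultimately have 1: "oriented_compatible ?c c'"
      using compat(1) by (auto simp: oriented_compatible_def)
    have "transition c' ?c = transition c' c" by (simp add: transition_def)
    then have 2: "oriented_compatible c' ?c"
      using compat(2) by (auto simp: oriented_compatible_def intro: smooth_on_subset)
    show ?thesis using 1 2 by simp
  qed
  show ?thesis using atlas chart comp unfolding oriented_smooth_structure_def by blast
qed

lemma restrict_chart_transition:
  assumes c: "c \<in> A" and U: "open U" and p: "p \<in> fst c" "p \<in> U"
  shows "(transition (restrict_chart c U) c has_derivative (\<lambda>v. v)) (at (snd c p))"
    and "(transition c (restrict_chart c U) has_derivative (\<lambda>v. v)) (at (snd c p))"
proof -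
  have id: "((\<lambda>v. v) has_derivative (\<lambda>v. v)) (at (snd c p))" by simp
  show "(transition (restrict_chart c U) c has_derivative (\<lambda>v. v)) (at (snd c p))"
    by (rule has_derivative_transform_within_open[OF id open_chart_image[OF c U]])
      (use p c in \<open>auto simp: transition_def chart_inv_restrict\<close>)
  show "(transition c (restrict_chart c U) has_derivative (\<lambda>v. v)) (at (snd c p))"
    by (rule has_derivative_transform_within_open[OF id open_chart_image[OF c U]])
      (use p c in \<open>auto simp: transition_def\<close>)
qed

lemma restrict_chart_hol:
  assumes c: "c \<in> hol_charts A g" and U: "open U"
  shows "restrict_chart c U \<in> hol_charts A g"
proof -
  have cA: "c \<in> A" "restrict_chart c U \<in> A"
    using hol_in_atlas[OF c] restrict_chart_in_atlas U by auto
  have "g (restrict_chart c U) p v w = conf g c p * (v \<bullet> w)" if "p \<in> fst c" "p \<in> U" for p v w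
    using metric_change[OF cA(2,1), of p v w] that metric_conf[OF c that(1)]
      frechet_derivative_eqI[OF restrict_chart_transition(1)[OF cA(1) U that]]
    by simp
  then show ?thesis using cA(2) by (auto simp: hol_charts_def)
qed

lemma deriv_transition_restrict:
  assumes "c \<in> A" "open U" "p \<in> fst c" "p \<in> U"
  shows "deriv (transition (restrict_chart c U) c) (snd c p) = 1"
proof -
  have "(\<lambda>v. v) = (*) (1 :: complex)" by auto
  then show ?thesis
    using restrict_chart_transition(1)[OF assms]
    by (intro DERIV_imp_deriv) (simp add: has_field_derivative_def)
qed

lemma hol_chart_at: "\<exists>c\<in>hol_charts A g. p \<in> fst c"
  using hol_cover by blast

end

section \<open>Spin structures and adapted frames\<close>

lemma line_bundle_conj:
  "scl (conj_bundle L) a s = Bar (scl L (cnj a) (unbar s))"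
  "proj (conj_bundle L) s = proj L (unbar s)"
  by (simp_all add: conj_bundle_def)

locale spin_surface = conformal_surface A g
  for A :: "'a::t2_space chart set" and g :: "'a surface_metric" +
  fixes S :: "('a, 's) line_bundle" and \<theta> :: "'s \<Rightarrow> 's \<Rightarrow> 'a covector"
  assumes spin: "spin_structure A g S \<theta>"
begin

lemma line_bundle_S: "line_bundle S"
  using spin by (simp add: spin_structure_def holomorphic_line_bundle_def)

lemma proj_scl [simp]: "proj S (scl S a s) = proj S s"
  and scl_1 [simp]: "scl S 1 s = s"
  and scl_scl: "scl S a (scl S b s) = scl S (a * b) s"
  using line_bundle_S by (simp_all add: line_bundle_def)

lemma frame:
  assumes "(U, e) \<in> frames S"
  shows "open U" and "p \<in> U \<Longrightarrow> proj S (e p) = p"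
    and "p \<in> U \<Longrightarrow> proj S s = p \<Longrightarrow> \<exists>!a. s = scl S a (e p)"
proof -
  have "\<forall>(U, e)\<in>frames S. open U \<and>
        (\<forall>p\<in>U. proj S (e p) = p \<and> (\<forall>s. proj S s = p \<longrightarrow> (\<exists>!a. s = scl S a (e p))))"
    using line_bundle_S unfolding line_bundle_def by (elim conjE)
  from bspec[OF this assms]
  have *: "open U \<and> (\<forall>p\<in>U. proj S (e p) = p \<and> (\<forall>s. proj S s = p \<longrightarrow> (\<exists>!a. s = scl S a (e p))))"
    by simp
  show "open U" using * by (rule conjunct1)
  show "proj S (e p) = p" if "p \<in> U" using bspec[OF conjunct2[OF *] that] by (rule conjunct1)
  show "\<exists>!a. s = scl S a (e p)" if "p \<in> U" "proj S s = p"
    using bspec[OF conjunct2[OF *] that(1)] that(2) by (elim conjE allE impE)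
qed

lemma frame_at: "\<exists>U e. (U, e) \<in> frames S \<and> p \<in> U"
proof -
  have "p \<in> (\<Union>(U, e)\<in>frames S. U)" using line_bundle_S by (simp add: line_bundle_def)
  then show ?thesis by auto
qed

lemma nonzero_frame:
  assumes "(U, e) \<in> frames S" "p \<in> U"
  shows "nonzero S (e p)"
  unfolding nonzero_def
proof
  assume "e p = scl S 0 (e p)"
  moreover have "e p = scl S 1 (e p)" by simp
  ultimately show False using frame(3)[OF assms frame(2)[OF assms]] by (metis zero_neq_one)
qed

text \<open>A frame \<open>e\<close> identifies the fibre with the complex numbers; \<open>t\<close>
  then has a nonzero coordinate \<open>b\<close>, and the quotient is \<open>a / b\<close>.\<close>

lemma scl_unique:
  assumes "nonzero S t" "proj S s = proj S t"
  shows "\<exists>!a. s = scl S a t"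
proof -
  obtain U e where U: "(U, e) \<in> frames S" "proj S t \<in> U" using frame_at by blast
  let ?e = "e (proj S t)"
  obtain b where b: "t = scl S b ?e" using frame(3)[OF U, of t] by auto
  have b0: "b \<noteq> 0"
  proof
    assume "b = 0"
    then have "t = scl S 0 t" using b by (metis mult_zero_left scl_scl)
    then show False using assms by (simp add: nonzero_def)
  qed
  obtain a where a: "s = scl S a ?e" using frame(3)[OF U assms(2)] by auto
  show ?thesis
  proof
    show "s = scl S (a / b) t" using a b b0 by (metis nonzero_divide_eq_eq scl_scl)
    fix a' assume "s = scl S a' t"
    then have "s = scl S (a' * b) ?e" using b by (metis scl_scl)
    then have "a' * b = a" using frame(3)[OF U assms(2)] a by blast
    then show "a' = a / b" using b0 by (simp add: field_simps)
  qed
qed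

lemma scl_coord: "nonzero S t \<Longrightarrow> proj S s = proj S t \<Longrightarrow> scl S (coord S t s) t = s"
  unfolding coord_def using theI'[OF scl_unique] by metis

lemma coord_eqI: "nonzero S t \<Longrightarrow> s = scl S a t \<Longrightarrow> coord S t s = a"
  unfolding coord_def by (rule the1_equality[OF scl_unique]) auto

lemma coord_scl: "nonzero S t \<Longrightarrow> coord S t (scl S a t) = a"
  by (simp add: coord_eqI)

lemma coord_self: "nonzero S t \<Longrightarrow> coord S t t = 1"
  by (simp add: coord_eqI)

lemma coord_mult:
  assumes "nonzero S t" "nonzero S t'" "proj S s = proj S t" "proj S t' = proj S t"
  shows "coord S t s = coord S t' s * coord S t t'"
  using assms by (intro coord_eqI) (simp_all add: scl_coord flip: scl_scl)

lemma coord_nonzero: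
  assumes "nonzero S t" "nonzero S t'" "proj S t' = proj S t"
  shows "coord S t t' \<noteq> 0"
  using coord_mult[of t t' t] assms coord_self[of t] by auto

lemma theta_scl:
  "c \<in> hol_charts A g \<Longrightarrow> proj S t \<in> fst c \<Longrightarrow> \<theta> (scl S a t) (scl S b t) c = a * b * \<theta> t t c"
  and theta_nonzero:
  "c \<in> hol_charts A g \<Longrightarrow> proj S t \<in> fst c \<Longrightarrow> nonzero S t \<Longrightarrow> \<theta> t t c \<noteq> 0"
  using spin by (simp_all add: spin_structure_def)

lemma theta_change:
  "c \<in> hol_charts A g \<Longrightarrow> c' \<in> hol_charts A g \<Longrightarrow> proj S t \<in> fst c \<Longrightarrow> proj S t \<in> fst c' \<Longrightarrow>
    \<theta> t t c = \<theta> t t c' * deriv (transition c c') (snd c (proj S t))"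
proof -
  assume c: "c \<in> hol_charts A g" "c' \<in> hol_charts A g" "proj S t \<in> fst c" "proj S t \<in> fst c'"
  have "\<theta> t t \<in> canonical_fibre A g (proj S t)" using spin by (simp add: spin_structure_def)
  then show ?thesis using c unfolding canonical_fibre_def by blast
qed

lemma hol_theta:
  "(U, e) \<in> frames S \<Longrightarrow> c \<in> hol_charts A g \<Longrightarrow> hol_fun A g (U \<inter> fst c) (\<lambda>p. \<theta> (e p) (e p) c)"
  using spin unfolding spin_structure_def by (elim conjE) fast

lemma hol_frames:
  "(U, e) \<in> frames S \<Longrightarrow> (U', e') \<in> frames S \<Longrightarrow> hol_fun A g (U \<inter> U') (\<lambda>p. coord S (e p) (e' p))"
  using spin unfolding spin_structure_def holomorphic_line_bundle_def by (elim conjE) fast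

text \<open>Under a change of holomorphic chart the modulus of the covector coefficient and the
  square root of the conformal factor are multiplied by the same number, so the description in
  \<open>canonical_norm\<close> has a value.\<close>

lemma spin_norm_sq_eq:
  assumes c: "c \<in> hol_charts A g" "proj S t \<in> fst c"
  shows "spin_norm_sq A g S \<theta> t = cmod (\<theta> t t c) / sqrt (conf g c (proj S t))"
  unfolding spin_norm_sq_def canonical_norm_def
proof (rule the_equality)
  show "\<forall>c'\<in>hol_charts A g. proj S t \<in> fst c' \<longrightarrow>
    cmod (\<theta> t t c) / sqrt (conf g c (proj S t)) = cmod (\<theta> t t c') / sqrt (g c' (proj S t) 1 1)"
  proof (intro ballI impI)
    fix c' assume c': "c' \<in> hol_charts A g" "proj S t \<in> fst c'"
    show "cmod (\<theta> t t c) / sqrt (conf g c (proj S t)) = cmod (\<theta> t t c') / sqrt (g c' (proj S t) 1 1)"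
      unfolding theta_change[OF c(1) c'(1) c(2) c'(2)] hol_transition(2)[OF c(1) c'(1) c(2) c'(2)]
      using hol_transition(3)[OF c(1) c'(1) c(2) c'(2)]
      by (simp add: norm_mult real_sqrt_mult conf_def[symmetric])
  qed
qed (use c in \<open>auto simp: conf_def\<close>)

lemma adapted_hol: "adapted A g S \<theta> c s0 \<Longrightarrow> c \<in> hol_charts A g"
  and adapted_proj: "adapted A g S \<theta> c s0 \<Longrightarrow> p \<in> fst c \<Longrightarrow> proj S (s0 p) = p"
  and adapted_theta: "adapted A g S \<theta> c s0 \<Longrightarrow> p \<in> fst c \<Longrightarrow> \<theta> (s0 p) (s0 p) c = 1"
  and adapted_section: "adapted A g S \<theta> c s0 \<Longrightarrow> hol_section A g S (fst c) s0"
  by (auto simp: adapted_def hol_section_def)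

lemma adapted_atlas: "adapted A g S \<theta> c s0 \<Longrightarrow> c \<in> A"
  by (simp add: adapted_hol hol_in_atlas)

lemma adapted_nonzero:
  assumes "adapted A g S \<theta> c s0" "p \<in> fst c"
  shows "nonzero S (s0 p)"
  unfolding nonzero_def
proof
  assume "s0 p = scl S 0 (s0 p)"
  then have "\<theta> (s0 p) (s0 p) c = \<theta> (scl S 0 (s0 p)) (scl S 0 (s0 p)) c" by simp
  also have "\<dots> = 0"
    using theta_scl[OF adapted_hol[OF assms(1)], of "s0 p" 0 0] assms adapted_proj by simp
  finally show False using adapted_theta[OF assms] by simp
qed

lemma adapted_norm:
  assumes "adapted A g S \<theta> c s0" "p \<in> fst c"
  shows "spin_norm_sq A g S \<theta> (scl S a (s0 p)) = (cmod a)\<^sup>2 / sqrt (conf g c p)"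
  using spin_norm_sq_eq[OF adapted_hol[OF assms(1)], of "scl S a (s0 p)"] assms
    theta_scl[OF adapted_hol[OF assms(1)], of "s0 p" a a]
  by (simp add: adapted_proj adapted_theta norm_mult power2_eq_square)

lemma adapted_norm_self:
  assumes "adapted A g S \<theta> c s0" "p \<in> fst c"
  shows "spin_norm_sq A g S \<theta> (s0 p) = 1 / sqrt (conf g c p)"
  using adapted_norm[OF assms, of 1] by simp

text \<open>For a frame \<open>e\<close> the coefficient \<open>?h\<close> of the square of
  \<open>e\<close> is holomorphic without zeros, so on a disc it has a holomorphic square root
  \<open>k\<close>, and e / k has square dz. The chart is cut down to the preimage of that
  disc.\<close>

lemma adapted_exists: "\<exists>c s0. adapted A g S \<theta> c s0 \<and> p \<in> fst c"
proof -
  obtain c where c: "c \<in> hol_charts A g" "p \<in> fst c" using hol_chart_at by blast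
  obtain U e where U: "(U, e) \<in> frames S" "p \<in> U" using frame_at by blast
  have cA: "c \<in> A" using c by (simp add: hol_in_atlas)
  let ?h = "\<lambda>p. \<theta> (e p) (e p) c"
  have im: "open (snd c ` (fst c \<inter> U))" by (rule open_chart_image[OF cA frame(1)[OF U(1)]])
  have "snd c p \<in> snd c ` (fst c \<inter> U)" using c U by blast
  with im obtain r where r: "r > 0" "ball (snd c p) r \<subseteq> snd c ` (fst c \<inter> U)"
    by (rule openE)
  let ?B = "ball (snd c p) r"
  have "(?h \<circ> chart_inv c) holomorphic_on snd c ` (fst c \<inter> U)"
  proof -
    have "U \<inter> fst c \<inter> fst c = fst c \<inter> U" by blast
    then show ?thesis using bspec[OF hol_theta[OF U(1) c(1), unfolded hol_fun_def] c(1)] by metis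
  qed
  then have hh: "(?h \<circ> chart_inv c) holomorphic_on ?B" using r(2) by (rule holomorphic_on_subset)
  have hnz: "(?h \<circ> chart_inv c) z \<noteq> 0" if "z \<in> ?B" for z
  proof -
    have "z \<in> snd c ` (fst c \<inter> U)" using that r by auto
    then have q: "chart_inv c z \<in> fst c \<inter> U" using cA by auto
    then show ?thesis
      using theta_nonzero[OF c(1), of "e (chart_inv c z)"] nonzero_frame[OF U(1)] frame(2)[OF U(1)] by auto
  qed
  obtain k where k: "k holomorphic_on ?B" "\<And>z. z \<in> ?B \<Longrightarrow> (?h \<circ> chart_inv c) z = (k z)\<^sup>2"
    by (rule contractible_imp_holomorphic_sqrt[OF hh convex_imp_contractible[OF convex_ball]],
        erule hnz, rule that)
  have k0: "k z \<noteq> 0" if "z \<in> ?B" for z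
    using k(2)[OF that] hnz[OF that] by auto
  define V where "V = fst c \<inter> U \<inter> (fst c \<inter> snd c -` ?B)"
  have V: "open V"
    unfolding V_def using open_domain[OF cA] frame(1)[OF U(1)]
    by (intro open_Int continuous_open_preimage continuous_chart[OF cA]) auto
  define d where "d = restrict_chart c V"
  have d: "d \<in> hol_charts A g" unfolding d_def by (rule restrict_chart_hol[OF c(1) V])
  have fd: "fst d = V" by (auto simp: d_def V_def)
  have sd: "snd d = snd c" by (simp add: d_def)
  define s0 where "s0 q = scl S (inverse (k (snd c q))) (e q)" for q
  have "adapted A g S \<theta> d s0"
    unfolding adapted_def
  proof (intro conjI ballI)
    show "d \<in> hol_charts A g" by fact
    fix q assume "q \<in> fst d"
    then have q: "q \<in> fst c" "q \<in> U" "snd c q \<in> ?B" "q \<in> V" by (auto simp: fd V_def)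
    have kq: "?h q = (k (snd c q))\<^sup>2" using k(2)[OF q(3)] cA q by simp
    have pr: "proj S (s0 q) = q" by (simp add: s0_def frame(2)[OF U(1) q(2)])
    have "\<theta> (s0 q) (s0 q) c = 1"
      using theta_scl[OF c(1), of "e q"] frame(2)[OF U(1) q(2)] q k0[OF q(3)]
      by (simp add: s0_def kq power2_eq_square field_simps)
    \<comment> \<open>Restricting the chart does not change dz, since the transition has derivative
      1.\<close>
    then show "\<theta> (s0 q) (s0 q) d = 1"
      using theta_change[OF d c(1), of "s0 q"] pr q
      by (simp add: fd sd) (simp add: d_def deriv_transition_restrict[OF cA V])
  next
    show "hol_section A g S (fst d) s0"
      unfolding hol_section_def
    proof (intro conjI ballI)
      show "proj S (s0 q) = q" if "q \<in> fst d" for q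
        using that frame(2)[OF U(1)] by (auto simp: fd V_def s0_def)
    next
      fix x assume "x \<in> frames S"
      moreover obtain W e' where x: "x = (W, e')" by (cases x)
      ultimately have W: "(W, e') \<in> frames S" by simp
      have "hol_fun A g (fst d \<inter> W) (\<lambda>p. coord S (e' p) (s0 p))"
        unfolding hol_fun_def
      proof
        \<comment> \<open>Holomorphy has to be tested in every holomorphic chart, while
          \<open>k\<close> lives in the coordinate of \<open>c\<close>; it is pulled back along the
          transition.\<close>
        fix c' assume c': "c' \<in> hol_charts A g"
        note c'A = hol_in_atlas[OF c']
        let ?D = "snd c' ` (fst d \<inter> W \<inter> fst c')"
        have 1: "((\<lambda>p. coord S (e' p) (e p)) \<circ> chart_inv c') holomorphic_on ?D"
          using hol_frames[OF W U(1)] c' unfolding hol_fun_def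
          by (rule_tac holomorphic_on_subset[where s="snd c' ` (W \<inter> U \<inter> fst c')"]) (auto simp: fd V_def)
        have t: "transition c' c holomorphic_on ?D"
          unfolding holomorphic_on_def
        proof
          fix z assume "z \<in> ?D"
          then obtain q where q: "z = snd c' q" "q \<in> fst c'" "q \<in> fst c" by (auto simp: fd V_def)
          have "transition c' c field_differentiable (at z)"
            unfolding field_differentiable_def q(1) by (rule exI, rule hol_transition(1)[OF c' c(1) q(2,3)])
          then show "transition c' c field_differentiable (at z within ?D)"
            by (rule field_differentiable_at_within)
        qed
        have img: "transition c' c ` ?D \<subseteq> ?B"
          using c'A by (auto simp: transition_def fd V_def)
        have 2: "(k \<circ> transition c' c) holomorphic_on ?D"
          by (rule holomorphic_on_compose_gen[OF t k(1) img])
        have 3: "(\<lambda>z. inverse ((k \<circ> transition c' c) z) * ((\<lambda>p. coord S (e' p) (e p)) \<circ> chart_inv c') z) holomorphic_on ?D"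
        proof (intro holomorphic_intros 1 2)
          show "(k \<circ> transition c' c) z \<noteq> 0" if "z \<in> ?D" for z
          proof -
            have "transition c' c z \<in> ?B" using img that by blast
            then show ?thesis using k0 by simp
          qed
        qed
        have eq: "((\<lambda>p. coord S (e' p) (s0 p)) \<circ> chart_inv c') z =
          inverse ((k \<circ> transition c' c) z) * ((\<lambda>p. coord S (e' p) (e p)) \<circ> chart_inv c') z" if "z \<in> ?D" for z
        proof -
          obtain q where q: "z = snd c' q" "q \<in> fst c'" "q \<in> fst c" "q \<in> U" "q \<in> W"
            using \<open>z \<in> ?D\<close> by (auto simp: fd V_def)
          have "coord S (e' q) (s0 q) = inverse (k (snd c q)) * coord S (e' q) (e q)"
            unfolding s0_def using nonzero_frame[OF W q(5)] frame(2)[OF W q(5)] frame(2)[OF U(1) q(4)]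
            by (intro coord_eqI) (simp_all add: scl_coord flip: scl_scl)
          then show ?thesis using q c'A by (simp add: transition_def)
        qed
        show "((\<lambda>p. coord S (e' p) (s0 p)) \<circ> chart_inv c') holomorphic_on ?D"
          by (rule holomorphic_transform[OF 3, OF eq[symmetric]])
      qed
      then show "case x of (V, e) \<Rightarrow> hol_fun A g (fst d \<inter> V) (\<lambda>p. coord S (e p) (s0 p))"
        by (simp add: x)
    qed
  qed
  moreover have "p \<in> fst d" using c U r by (simp add: fd V_def)
  ultimately show ?thesis by blast
qed

end

section \<open>Sections and the Dirac operator in adapted frames\<close>

context spin_surface
begin

lemma coord_conj:
  assumes "nonzero S t" "proj S (unbar u) = proj S t"
  shows "coord (conj_bundle S) (Bar t) u = cnj (coord S t (unbar u))"
  unfolding coord_def[of "conj_bundle S"] line_bundle_conj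
proof (rule the_equality)
  show "u = Bar (scl S (cnj (cnj (coord S t (unbar u)))) (unbar (Bar t)))"
    using assms by (simp add: scl_coord)
  show "a = cnj (coord S t (unbar u))" if "u = Bar (scl S (cnj a) (unbar (Bar t)))" for a
    using assms(1) by (simp add: that coord_scl)
qed

lemma smooth_section_proj: "smooth_section A S s \<Longrightarrow> proj S (s p) = p"
  by (simp add: smooth_section_def)

text \<open>Allows both components of a spinor to be handled as sections of \<open>S\<close>;
  conjugating a coordinate is real linear and keeps its smoothness.\<close>

lemma smooth_section_unbar:
  assumes "smooth_section A (conj_bundle S) \<phi>"
  shows "smooth_section A S (unbar \<circ> \<phi>)"
proof -
  have pr: "proj S (unbar (\<phi> p)) = p" for p
    using assms by (simp add: smooth_section_def line_bundle_conj)
  have "smooth_fun A V (\<lambda>p. coord S (e p) (unbar (\<phi> p)))" if V: "(V, e) \<in> frames S" for V e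
  proof -
    have "(V, \<lambda>p. Bar (e p)) \<in> frames (conj_bundle S)"
      using V by (force simp: conj_bundle_def)
    then have sm: "smooth_fun A V (\<lambda>p. coord (conj_bundle S) (Bar (e p)) (\<phi> p))"
      using assms unfolding smooth_section_def by fast
    show ?thesis
      unfolding smooth_fun_def smooth_on_def
    proof (intro ballI allI)
      fix c n assume c: "c \<in> A"
      let ?T = "snd c ` (V \<inter> fst c)"
      have T: "open ?T"
        using open_chart_image[OF c frame(1)[OF V]] by (simp add: Int_commute)
      have "Ck n ?T ((\<lambda>p. coord (conj_bundle S) (Bar (e p)) (\<phi> p)) \<circ> chart_inv c)"
        using sm c unfolding smooth_fun_def by (auto intro: smooth_on_Ck)
      then have "Ck n ?T (\<lambda>z. cnj (((\<lambda>p. coord (conj_bundle S) (Bar (e p)) (\<phi> p)) \<circ> chart_inv c) z))"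
        by (rule Ck_bounded_linear[OF T bounded_linear_cnj])
      moreover have "cnj (((\<lambda>p. coord (conj_bundle S) (Bar (e p)) (\<phi> p)) \<circ> chart_inv c) z) =
        ((\<lambda>p. coord S (e p) (unbar (\<phi> p))) \<circ> chart_inv c) z" if "z \<in> ?T" for z
      proof -
        have "chart_inv c z \<in> V" using that c by auto
        then show ?thesis
          using coord_conj[OF nonzero_frame[OF V], of "chart_inv c z" "\<phi> (chart_inv c z)"]
            pr frame(2)[OF V] by simp
      qed
      ultimately show "Ck n ?T ((\<lambda>p. coord S (e p) (unbar (\<phi> p))) \<circ> chart_inv c)"
        by (rule Ck_transform[OF T])
    qed
  qed
  then show ?thesis using pr by (auto simp: smooth_section_def)
qed

lemma hol_section_coord:
  assumes "adapted A g S \<theta> c s0" "(V, e) \<in> frames S" "c' \<in> hol_charts A g"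
  shows "((\<lambda>q. coord S (e q) (s0 q)) \<circ> chart_inv c') holomorphic_on snd c' ` (fst c \<inter> V \<inter> fst c')"
proof -
  have "hol_fun A g (fst c \<inter> V) (\<lambda>q. coord S (e q) (s0 q))"
    using adapted_section[OF assms(1)] assms(2) unfolding hol_section_def by fast
  then show ?thesis using assms(3) unfolding hol_fun_def by blast
qed

lemma frame_coord_adapted_nonzero:
  assumes "adapted A g S \<theta> c s0" "(V, e) \<in> frames S" "q \<in> fst c" "q \<in> V"
  shows "coord S (e q) (s0 q) \<noteq> 0"
  by (rule coord_nonzero[OF nonzero_frame[OF assms(2,4)] adapted_nonzero[OF assms(1,3)]])
    (simp add: frame(2)[OF assms(2,4)] adapted_proj[OF assms(1,3)])

text \<open>Smoothness is defined through \<open>frames S\<close>, to which \<open>s0\<close> need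
  not belong. Locally the coordinate with respect to \<open>s0\<close> is a quotient of two frame
  coordinates with nonvanishing denominator.\<close>

lemma smooth_coord:
  assumes ad: "adapted A g S \<theta> c s0" and s: "smooth_section A S s"
  shows "smooth_on (snd c ` fst c) ((\<lambda>q. coord S (s0 q) (s q)) \<circ> chart_inv c)"
proof (rule smooth_on_local)
  fix z assume "z \<in> snd c ` fst c"
  then obtain p where p: "p \<in> fst c" "z = snd c p" by blast
  note cA = adapted_atlas[OF ad]
  obtain V e where V: "(V, e) \<in> frames S" "p \<in> V" using frame_at by blast
  let ?T = "snd c ` (fst c \<inter> V)"
  have T: "open ?T" by (rule open_chart_image[OF cA frame(1)[OF V(1)]])
  have T': "?T = snd c ` (fst c \<inter> V \<inter> fst c)" "?T = snd c ` (V \<inter> fst c)" by auto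
  let ?a = "(\<lambda>q. coord S (e q) (s0 q)) \<circ> chart_inv c" and ?b = "(\<lambda>q. coord S (e q) (s q)) \<circ> chart_inv c"
  have sa: "smooth_on ?T ?a"
    using smooth_on_holomorphic[OF _ hol_section_coord[OF ad V(1) adapted_hol[OF ad]]] T
    unfolding T'(1)[symmetric] by blast
  have "smooth_fun A V (\<lambda>q. coord S (e q) (s q))"
    using s V(1) unfolding smooth_section_def by fast
  then have sb: "smooth_on ?T ?b" using cA unfolding smooth_fun_def T'(2) by blast
  have nz: "?a w \<noteq> 0" if "w \<in> ?T" for w
    using that cA frame_coord_adapted_nonzero[OF ad V(1)] by auto
  have "Ck n ?T (\<lambda>w. ?b w * inverse (?a w))" for n
    by (intro Ck_mult Ck_inverse T smooth_on_Ck sa sb nz)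
  then have "smooth_on ?T (\<lambda>w. ?b w * inverse (?a w))" by (simp add: smooth_on_def)
  moreover have "?b w * inverse (?a w) = ((\<lambda>q. coord S (s0 q) (s q)) \<circ> chart_inv c) w" if w: "w \<in> ?T" for w
  proof -
    obtain q where q: "q \<in> fst c" "q \<in> V" "w = snd c q" using w by blast
    have "coord S (e q) (s q) = coord S (s0 q) (s q) * coord S (e q) (s0 q)"
      using q adapted_proj[OF ad] frame(2)[OF V(1)] smooth_section_proj[OF s]
      by (intro coord_mult nonzero_frame[OF V(1)] adapted_nonzero[OF ad]) auto
    then show ?thesis using q nz[OF w] cA by simp
  qed
  ultimately have "smooth_on ?T ((\<lambda>q. coord S (s0 q) (s q)) \<circ> chart_inv c)"
    by (rule smooth_on_transform[OF T])
  moreover have "z \<in> ?T" using p V by blast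
  ultimately show "\<exists>T. open T \<and> z \<in> T \<and> smooth_on T ((\<lambda>q. coord S (s0 q) (s q)) \<circ> chart_inv c)"
    using T by blast
qed

lemma coord_differentiable:
  assumes "adapted A g S \<theta> c s0" "smooth_section A S s" "p \<in> fst c"
  shows "((\<lambda>q. coord S (s0 q) (s q)) \<circ> chart_inv c) differentiable (at (snd c p))"
  using smooth_on_Ck[OF smooth_coord[OF assms(1,2)], of 1] assms(3) by simp

lemma coord_adapted_change:
  assumes ad: "adapted A g S \<theta> c s0" "adapted A g S \<theta> c' s0'"
    and p: "p \<in> fst c" "p \<in> fst c'" and s: "proj S s = p"
  shows "coord S (s0 p) s = coord S (s0' p) s * coord S (s0 p) (s0' p)"
  using assms by (intro coord_mult adapted_nonzero[OF ad(1)] adapted_nonzero[OF ad(2)])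
    (auto simp: adapted_proj[OF ad(1)] adapted_proj[OF ad(2)])

text \<open>If s0' = w s0, then the squares dz' and dz satisfy dz' = w^2 dz: spinor transition
  functions are square roots of the derivatives of coordinate changes.\<close>

lemma adapted_change_square:
  assumes ad: "adapted A g S \<theta> c s0" "adapted A g S \<theta> c' s0'"
    and p: "p \<in> fst c" "p \<in> fst c'"
  shows "(coord S (s0 p) (s0' p))\<^sup>2 = deriv (transition c c') (snd c p)"
proof -
  let ?w = "coord S (s0 p) (s0' p)"
  have s0': "s0' p = scl S ?w (s0 p)"
    using ad p by (simp add: scl_coord adapted_nonzero adapted_proj[OF ad(1)] adapted_proj[OF ad(2)])
  have "\<theta> (s0' p) (s0' p) c = \<theta> (s0' p) (s0' p) c' * deriv (transition c c') (snd c p)"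
    using theta_change[OF adapted_hol[OF ad(1)] adapted_hol[OF ad(2)], of "s0' p"] p
    by (simp add: adapted_proj[OF ad(2)])
  also have "\<theta> (s0' p) (s0' p) c' = 1" by (rule adapted_theta[OF ad(2) p(2)])
  also have "\<theta> (s0' p) (s0' p) c = ?w * ?w"
    using theta_scl[OF adapted_hol[OF ad(1)], of "s0 p" ?w ?w] adapted_theta[OF ad(1) p(1)]
      adapted_proj[OF ad(1) p(1)] p by (simp flip: s0')
  finally show ?thesis by (simp add: power2_eq_square)
qed

lemma adapted_change_holomorphic:
  assumes ad: "adapted A g S \<theta> c s0" "adapted A g S \<theta> c' s0'"
    and p: "p \<in> fst c" "p \<in> fst c'"
  shows "\<exists>d. (((\<lambda>q. coord S (s0 q) (s0' q)) \<circ> chart_inv c) has_field_derivative d) (at (snd c p))"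
proof -
  note c = adapted_hol[OF ad(1)] and cA = adapted_atlas[OF ad(1)] and cA' = adapted_atlas[OF ad(2)]
  obtain V e where V: "(V, e) \<in> frames S" "p \<in> V" using frame_at by blast
  let ?T = "snd c ` (fst c \<inter> (fst c' \<inter> V))"
  have T: "open ?T"
    by (rule open_chart_image[OF cA open_Int[OF open_domain[OF cA'] frame(1)[OF V(1)]]])
  let ?a = "(\<lambda>q. coord S (e q) (s0 q)) \<circ> chart_inv c" and ?b = "(\<lambda>q. coord S (e q) (s0' q)) \<circ> chart_inv c"
  have a: "?a holomorphic_on ?T"
    by (rule holomorphic_on_subset[OF hol_section_coord[OF ad(1) V(1) c]]) auto
  have b: "?b holomorphic_on ?T"
    by (rule holomorphic_on_subset[OF hol_section_coord[OF ad(2) V(1) c]]) auto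
  have nz: "?a w \<noteq> 0" if "w \<in> ?T" for w
    using that cA frame_coord_adapted_nonzero[OF ad(1) V(1)] by auto
  have q: "(\<lambda>w. ?b w / ?a w) holomorphic_on ?T"
    by (intro holomorphic_intros a b nz)
  have eq: "?b w / ?a w = ((\<lambda>q. coord S (s0 q) (s0' q)) \<circ> chart_inv c) w" if w: "w \<in> ?T" for w
  proof -
    obtain q where q: "q \<in> fst c" "q \<in> fst c'" "q \<in> V" "w = snd c q" using w by blast
    have "coord S (e q) (s0' q) = coord S (s0 q) (s0' q) * coord S (e q) (s0 q)"
      using q adapted_proj[OF ad(1)] adapted_proj[OF ad(2)] frame(2)[OF V(1)]
      by (intro coord_mult nonzero_frame[OF V(1)] adapted_nonzero[OF ad(1)]) auto
    then show ?thesis using q nz[OF w] cA by simp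
  qed
  have "((\<lambda>q. coord S (s0 q) (s0' q)) \<circ> chart_inv c) holomorphic_on ?T"
    by (rule holomorphic_transform[OF q eq])
  moreover have "snd c p \<in> ?T" using p V by blast
  ultimately show ?thesis using holomorphic_derivI[OF _ T] by blast
qed

text \<open>The two coordinates differ by a holomorphic factor, which \<open>d_zbar\<close> does not
  differentiate. The chart change contributes the conjugate of its derivative, a square by
  \<open>adapted_change_square\<close>.\<close>

lemma d_zbar_adapted_change:
  assumes ad: "adapted A g S \<theta> c s0" "adapted A g S \<theta> c' s0'"
    and p: "p \<in> fst c" "p \<in> fst c'" and s: "smooth_section A S s"
  shows "d_zbar ((\<lambda>q. coord S (s0 q) (s q)) \<circ> chart_inv c) (snd c p) =
    d_zbar ((\<lambda>q. coord S (s0' q) (s q)) \<circ> chart_inv c') (snd c' p) *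
      (cnj (coord S (s0 p) (s0' p)))\<^sup>2 * coord S (s0 p) (s0' p)"
proof -
  let ?f' = "(\<lambda>q. coord S (s0' q) (s q)) \<circ> chart_inv c'"
  let ?w = "\<lambda>q. coord S (s0 q) (s0' q)"
  let ?t = "deriv (transition c c') (snd c p)"
  note cA = adapted_atlas[OF ad(1)] and cA' = adapted_atlas[OF ad(2)]
  obtain d where d: "((?w \<circ> chart_inv c) has_field_derivative d) (at (snd c p))"
    using adapted_change_holomorphic[OF ad p] by blast
  have "wirt ?f' (d_z ?f' (snd c' p)) (d_zbar ?f' (snd c' p)) (snd c' p)"
    by (rule differentiable_wirt[OF coord_differentiable[OF ad(2) s p(2)]])
  note W = wirt_mult[OF wirt_chart_change[OF adapted_hol[OF ad(1)] adapted_hol[OF ad(2)] p this]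
      wirt_field_derivative[OF d]]
  have "d_zbar ((\<lambda>q. coord S (s0 q) (s q)) \<circ> chart_inv c) (snd c p) =
     ((\<lambda>q. coord S (s0' q) (s q)) \<circ> chart_inv c) (snd c p) * 0 +
      d_zbar ?f' (snd c' p) * cnj ?t * (?w \<circ> chart_inv c) (snd c p)"
  proof (rule wirt_d_zbar, rule wirt_cong_open[OF W])
    show "open (snd c ` (fst c \<inter> fst c'))" by (rule open_chart_image[OF cA open_domain[OF cA']])
    show "snd c p \<in> snd c ` (fst c \<inter> fst c')" using p by blast
    show "((\<lambda>q. coord S (s0' q) (s q)) \<circ> chart_inv c) w * (?w \<circ> chart_inv c) w =
        ((\<lambda>q. coord S (s0 q) (s q)) \<circ> chart_inv c) w" if w: "w \<in> snd c ` (fst c \<inter> fst c')" for w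
    proof -
      obtain q where q: "q \<in> fst c" "q \<in> fst c'" "w = snd c q" using w by blast
      then show ?thesis
        using coord_adapted_change[OF ad q(1,2) smooth_section_proj[OF s]] cA by simp
    qed
  qed
  then show ?thesis
    using cA p(1) by (simp add: adapted_change_square[OF ad p, symmetric])
qed

lemma adapted_norm_change:
  assumes ad: "adapted A g S \<theta> c s0" "adapted A g S \<theta> c' s0'"
    and p: "p \<in> fst c" "p \<in> fst c'"
  shows "spin_norm_sq A g S \<theta> (s0' p) = (cmod (coord S (s0 p) (s0' p)))\<^sup>2 * spin_norm_sq A g S \<theta> (s0 p)"
    and "s0' p = scl S (coord S (s0 p) (s0' p)) (s0 p)"
proof -
  show s0': "s0' p = scl S (coord S (s0 p) (s0' p)) (s0 p)"
    using ad p by (simp add: scl_coord adapted_nonzero adapted_proj[OF ad(1)] adapted_proj[OF ad(2)])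
  show "spin_norm_sq A g S \<theta> (s0' p) = (cmod (coord S (s0 p) (s0' p)))\<^sup>2 * spin_norm_sq A g S \<theta> (s0 p)"
    by (subst s0') (simp add: adapted_norm[OF ad(1) p(1)] adapted_norm_self[OF ad(1) p(1)])
qed

text \<open>With w the change of frame, norm and section contribute the factor |w|^2 w, which is the
  conjugate of the factor in \<open>d_zbar_adapted_change\<close>. So the local formula does not
  depend on the frame and the description in \<open>dbar_op\<close> has a value.\<close>

lemma dbar_op_adapted:
  assumes ad: "adapted A g S \<theta> c s0" and p: "p \<in> fst c" and s: "smooth_section A S s"
  shows "dbar_op A g S \<theta> s p = Bar (scl S (of_real (spin_norm_sq A g S \<theta> (s0 p)) *
     cnj (d_zbar ((\<lambda>q. coord S (s0 q) (s q)) \<circ> chart_inv c) (snd c p))) (s0 p))"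
  unfolding dbar_op_def Let_def line_bundle_conj
proof (rule the_equality)
  show "\<forall>c' s0'. adapted A g S \<theta> c' s0' \<and> p \<in> fst c' \<longrightarrow>
    Bar (scl S (of_real (spin_norm_sq A g S \<theta> (s0 p)) *
       cnj (d_zbar ((\<lambda>q. coord S (s0 q) (s q)) \<circ> chart_inv c) (snd c p))) (s0 p)) =
    Bar (scl S (cnj (of_real (spin_norm_sq A g S \<theta> (s0' p)) *
       d_zbar ((\<lambda>q. coord S (s0' q) (s q)) \<circ> chart_inv c') (snd c' p))) (unbar (Bar (s0' p))))"
  proof (intro allI impI, elim conjE)
    fix c' s0' assume ad': "adapted A g S \<theta> c' s0'" "p \<in> fst c'"
    define w where "w = coord S (s0 p) (s0' p)"
    have s0': "s0' p = scl S w (s0 p)"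
      unfolding w_def by (rule adapted_norm_change(2)[OF ad ad'(1) p ad'(2)])
    show "Bar (scl S (of_real (spin_norm_sq A g S \<theta> (s0 p)) *
         cnj (d_zbar ((\<lambda>q. coord S (s0 q) (s q)) \<circ> chart_inv c) (snd c p))) (s0 p)) =
      Bar (scl S (cnj (of_real (spin_norm_sq A g S \<theta> (s0' p)) *
         d_zbar ((\<lambda>q. coord S (s0' q) (s q)) \<circ> chart_inv c') (snd c' p))) (unbar (Bar (s0' p))))"
      unfolding  d_zbar_adapted_change[OF ad ad'(1) p ad'(2) s, folded w_def]
          s0' adapted_norm[OF ad p] adapted_norm_self[OF ad p]
        by (simp add: scl_scl complex_norm_square del: of_real_power)
          (simp add: power2_eq_square mult_ac)
  qed
next
  fix u
  assume "\<forall>c s0. adapted A g S \<theta> c s0 \<and> p \<in> fst c \<longrightarrow>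
    u = Bar (scl S (cnj (of_real (spin_norm_sq A g S \<theta> (s0 p)) *
       d_zbar ((\<lambda>q. coord S (s0 q) (s q)) \<circ> chart_inv c) (snd c p))) (unbar (Bar (s0 p))))"
  from this[rule_format, OF conjI[OF ad p]]
  show "u = Bar (scl S (of_real (spin_norm_sq A g S \<theta> (s0 p)) *
     cnj (d_zbar ((\<lambda>q. coord S (s0 q) (s q)) \<circ> chart_inv c) (snd c p))) (s0 p))"
    by simp
qed

text \<open>Conjugating the coordinate turns \<open>d_z\<close> on the conjugate bundle into
  \<open>d_zbar\<close> on \<open>S\<close>; the frame change is then the same as for
  \<open>dbar_op\<close>.\<close>

lemma del_op_adapted:
  assumes ad: "adapted A g S \<theta> c s0" and p: "p \<in> fst c" and s: "smooth_section A (conj_bundle S) \<phi>"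
  shows "del_op A g S \<theta> \<phi> p = scl S (of_real (spin_norm_sq A g S \<theta> (s0 p)) *
     cnj (d_zbar ((\<lambda>q. coord S (s0 q) (unbar (\<phi> q))) \<circ> chart_inv c) (snd c p))) (s0 p)"
proof -
  have s': "smooth_section A S (\<lambda>q. unbar (\<phi> q))"
    using smooth_section_unbar[OF s] by (simp add: o_def)
  have eq: "d_z ((\<lambda>q. coord (conj_bundle S) (Bar (s0' q)) (\<phi> q)) \<circ> chart_inv c') (snd c' p) =
    cnj (d_zbar ((\<lambda>q. coord S (s0' q) (unbar (\<phi> q))) \<circ> chart_inv c') (snd c' p))"
    if ad': "adapted A g S \<theta> c' s0'" "p \<in> fst c'" for c' s0'
  proof (rule wirt_d_z, rule wirt_cong_open[OF wirt_cnj[OF differentiable_wirt[OF coord_differentiable[OF ad'(1) s' ad'(2)]]]])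
    note cA = adapted_atlas[OF ad'(1)]
    show "open (snd c' ` fst c')" by (rule open_range[OF cA])
    show "snd c' p \<in> snd c' ` fst c'" using ad'(2) by blast
    show "cnj (((\<lambda>q. coord S (s0' q) (unbar (\<phi> q))) \<circ> chart_inv c') w) =
       ((\<lambda>q. coord (conj_bundle S) (Bar (s0' q)) (\<phi> q)) \<circ> chart_inv c') w" if "w \<in> snd c' ` fst c'" for w
      using coord_conj[OF adapted_nonzero[OF ad'(1)], of "chart_inv c' w" "\<phi> (chart_inv c' w)"]
        chart_inv_in[OF cA that] adapted_proj[OF ad'(1)] smooth_section_proj[OF s'] by simp
  qed
  show ?thesis
    unfolding del_op_def Let_def
  proof (rule the_equality)
    show "\<forall>c' s0'. adapted A g S \<theta> c' s0' \<and> p \<in> fst c' \<longrightarrow>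
      scl S (of_real (spin_norm_sq A g S \<theta> (s0 p)) *
         cnj (d_zbar ((\<lambda>q. coord S (s0 q) (unbar (\<phi> q))) \<circ> chart_inv c) (snd c p))) (s0 p) =
      scl S (of_real (spin_norm_sq A g S \<theta> (s0' p)) *
         d_z ((\<lambda>q. coord (conj_bundle S) (Bar (s0' q)) (\<phi> q)) \<circ> chart_inv c') (snd c' p)) (s0' p)"
    proof (intro allI impI, elim conjE)
      fix c' s0' assume ad': "adapted A g S \<theta> c' s0'" "p \<in> fst c'"
      define w where "w = coord S (s0 p) (s0' p)"
      have s0': "s0' p = scl S w (s0 p)"
        unfolding w_def by (rule adapted_norm_change(2)[OF ad ad'(1) p ad'(2)])
      show "scl S (of_real (spin_norm_sq A g S \<theta> (s0 p)) *
         cnj (d_zbar ((\<lambda>q. coord S (s0 q) (unbar (\<phi> q))) \<circ> chart_inv c) (snd c p))) (s0 p) =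
        scl S (of_real (spin_norm_sq A g S \<theta> (s0' p)) *
         d_z ((\<lambda>q. coord (conj_bundle S) (Bar (s0' q)) (\<phi> q)) \<circ> chart_inv c') (snd c' p)) (s0' p)"
        unfolding eq[OF ad'] d_zbar_adapted_change[OF ad ad'(1) p ad'(2) s', folded w_def]
          s0' adapted_norm[OF ad p] adapted_norm_self[OF ad p]
        by (simp add: scl_scl complex_norm_square del: of_real_power)
          (simp add: power2_eq_square mult_ac)
    qed
  next
    fix u assume "\<forall>c' s0'. adapted A g S \<theta> c' s0' \<and> p \<in> fst c' \<longrightarrow>
      u = scl S (of_real (spin_norm_sq A g S \<theta> (s0' p)) *
         d_z ((\<lambda>q. coord (conj_bundle S) (Bar (s0' q)) (\<phi> q)) \<circ> chart_inv c') (snd c' p)) (s0' p)"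
    from this[rule_format, OF conjI[OF ad p]]
    show "u = scl S (of_real (spin_norm_sq A g S \<theta> (s0 p)) *
         cnj (d_zbar ((\<lambda>q. coord S (s0 q) (unbar (\<phi> q))) \<circ> chart_inv c) (snd c p))) (s0 p)"
      by (simp add: eq[OF ad p])
  qed
qed

text \<open>The squared norm of the frame is the inverse square root of the conformal factor and
  moves to the right hand side. Taking conjugates puts both equations into the form
  \<open>d_zbar\<close> of a coordinate in \<open>S\<close>, and these coordinates are the
  homogeneous coordinates of the map.\<close>

lemma eigenspinor_coordinates:
  assumes ad: "adapted A g S \<theta> c s0" and p: "p \<in> fst c" and sm: "smooth_spinor A S \<psi>"
    and D: "dirac A g S \<theta> \<psi> p = spinor_scl S \<mu> (\<psi> p)"
  shows "d_zbar ((\<lambda>q. coord S (s0 q) (fst (\<psi> q))) \<circ> chart_inv c) (snd c p) =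
      - \<mu> / 2 * of_real (sqrt (conf g c p)) * cnj (coord S (s0 p) (unbar (snd (\<psi> p))))"
    and "d_zbar ((\<lambda>q. coord S (s0 q) (unbar (snd (\<psi> q)))) \<circ> chart_inv c) (snd c p) =
      cnj \<mu> / 2 * of_real (sqrt (conf g c p)) * cnj (coord S (s0 p) (fst (\<psi> p)))"
proof -
  let ?x = "d_zbar ((\<lambda>q. coord S (s0 q) (fst (\<psi> q))) \<circ> chart_inv c) (snd c p)"
  let ?y = "d_zbar ((\<lambda>q. coord S (s0 q) (unbar (snd (\<psi> q)))) \<circ> chart_inv c) (snd c p)"
  let ?r = "spin_norm_sq A g S \<theta> (s0 p)"
  have s1: "smooth_section A S (\<lambda>q. fst (\<psi> q))" and s2: "smooth_section A (conj_bundle S) (\<lambda>q. snd (\<psi> q))"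
    using sm by (auto simp: smooth_spinor_def o_def)
  have s3: "smooth_section A S (\<lambda>q. unbar (snd (\<psi> q)))"
    using smooth_section_unbar[OF s2] by (simp add: o_def)
  have nz: "nonzero S (s0 p)" by (rule adapted_nonzero[OF ad p])
  have r: "?r = 1 / sqrt (conf g c p)" by (rule adapted_norm_self[OF ad p])
  have pos: "conf g c p > 0" by (rule conf_pos[OF adapted_atlas[OF ad] p])
  have sc: "scl S (coord S (s0 p) t) (s0 p) = t" if "proj S t = p" for t
    using scl_coord[OF nz] that adapted_proj[OF ad p] by simp
  have "scl S 2 (scl S (of_real ?r * cnj ?y) (s0 p)) = scl S \<mu> (fst (\<psi> p))"
    using D del_op_adapted[OF ad p s2] by (simp add: dirac_def spinor_scl_def o_def)
  also have "\<dots> = scl S \<mu> (scl S (coord S (s0 p) (fst (\<psi> p))) (s0 p))"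
    by (simp add: sc smooth_section_proj[OF s1])
  finally have "2 * (of_real ?r * cnj ?y) = \<mu> * coord S (s0 p) (fst (\<psi> p))"
    unfolding scl_scl using coord_scl[OF nz] by metis
  then have "cnj (2 * (of_real ?r * cnj ?y)) = cnj (\<mu> * coord S (s0 p) (fst (\<psi> p)))" by simp
  then show "?y = cnj \<mu> / 2 * of_real (sqrt (conf g c p)) * cnj (coord S (s0 p) (fst (\<psi> p)))"
    using pos by (simp add: r field_simps)
  have "Bar (scl S (cnj (- 2)) (scl S (of_real ?r * cnj ?x) (s0 p))) = Bar (scl S (cnj \<mu>) (unbar (snd (\<psi> p))))"
    using D dbar_op_adapted[OF ad p s1] by (simp add: dirac_def spinor_scl_def o_def line_bundle_conj)
  then have "scl S (- 2) (scl S (of_real ?r * cnj ?x) (s0 p)) =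
      scl S (cnj \<mu>) (scl S (coord S (s0 p) (unbar (snd (\<psi> p)))) (s0 p))"
    by (simp add: sc smooth_section_proj[OF s3])
  then have "- 2 * (of_real ?r * cnj ?x) = cnj \<mu> * coord S (s0 p) (unbar (snd (\<psi> p)))"
    unfolding scl_scl using coord_scl[OF nz] by metis
  then have "cnj (- 2 * (of_real ?r * cnj ?x)) = cnj (cnj \<mu> * coord S (s0 p) (unbar (snd (\<psi> p))))" by simp
  then show "?x = - \<mu> / 2 * of_real (sqrt (conf g c p)) * cnj (coord S (s0 p) (unbar (snd (\<psi> p))))"
    using pos by (simp add: r field_simps) (simp add: eq_neg_iff_add_eq_0 minus_equation_iff)
qed

definition spinor_lift :: "('a \<Rightarrow> 's) \<Rightarrow> ('m::finite \<Rightarrow> ('a, 's) spinor_field) \<Rightarrow> 'a \<Rightarrow> complex ^ ('m \<times> bool)" where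
  "spinor_lift s0 \<psi> q = (\<chi> i. if snd i then coord S (s0 q) (fst (\<psi> (fst i) q))
                        else coord S (s0 q) (unbar (snd (\<psi> (fst i) q))))"

lemma hcoord_scale: "a \<noteq> 0 \<Longrightarrow> hcoord (a *s v) = hcoord v"
proof -
  assume a: "a \<noteq> 0"
  have "\<exists>b. w = b *s (a *s v)" if "w = k *s v" for w k
    by (rule exI[of _ "k / a"]) (use a that in simp)
  then show ?thesis unfolding hcoord_def by (auto simp: vector_smult_assoc)
qed

lemma spinor_map_adapted:
  assumes ad: "adapted A g S \<theta> c s0" and p: "p \<in> fst c" and sm: "\<And>j. smooth_spinor A S (\<psi> j)"
  shows "spinor_map S \<psi> p = hcoord (spinor_lift s0 \<psi> p)"
  unfolding spinor_map_def
proof (rule the_equality)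
  have nz: "nonzero S (s0 p)" by (rule adapted_nonzero[OF ad p])
  have s1: "smooth_section A S (\<lambda>q. fst (\<psi> j q))" and "smooth_section A (conj_bundle S) (\<lambda>q. snd (\<psi> j q))" for j
    using sm[of j] by (auto simp: smooth_spinor_def o_def)
  then have s2: "smooth_section A S (\<lambda>q. unbar (snd (\<psi> j q)))" for j
    using smooth_section_unbar[of "\<lambda>q. snd (\<psi> j q)"] by (simp add: o_def)
  show "\<forall>t. proj S t = p \<and> nonzero S t \<longrightarrow> hcoord (spinor_lift s0 \<psi> p) =
     hcoord (\<chi> i. if snd i then coord S t (fst (\<psi> (fst i) p)) else coord S t (unbar (snd (\<psi> (fst i) p))))"
  proof (intro allI impI, elim conjE)
    fix t assume t: "proj S t = p" "nonzero S t"
    have "coord S (s0 p) s = coord S (s0 p) t * coord S t s" if "proj S s = p" for s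
      using coord_mult[OF nz t(2), of s] that t adapted_proj[OF ad p] by simp
    then have "spinor_lift s0 \<psi> p = coord S (s0 p) t *s
       (\<chi> i. if snd i then coord S t (fst (\<psi> (fst i) p)) else coord S t (unbar (snd (\<psi> (fst i) p))))"
      using smooth_section_proj[OF s1] smooth_section_proj[OF s2]
      by (simp add: spinor_lift_def vec_eq_iff)
    moreover have "coord S (s0 p) t \<noteq> 0"
      using coord_nonzero[OF nz t(2)] t adapted_proj[OF ad p] by simp
    ultimately show "hcoord (spinor_lift s0 \<psi> p) =
     hcoord (\<chi> i. if snd i then coord S t (fst (\<psi> (fst i) p)) else coord S t (unbar (snd (\<psi> (fst i) p))))"
      by (simp add: hcoord_scale)
  qed
qed (use adapted_nonzero[OF ad p] adapted_proj[OF ad p] in \<open>simp add: spinor_lift_def\<close>)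

end

section \<open>Eigenspinors and their lift\<close>

lemma sum_pair_bool: "(\<Sum>i\<in>UNIV. f i) = (\<Sum>j\<in>UNIV. f (j, True) + f (j, False))"
proof -
  have "(\<Sum>i\<in>UNIV \<times> UNIV. f i) = (\<Sum>j\<in>UNIV. \<Sum>b\<in>UNIV. f (j, b))"
    by (simp add: sum.cartesian_product)
  also have "\<dots> = (\<Sum>j\<in>UNIV. f (j, True) + f (j, False))"
    by (simp add: UNIV_bool add.commute)
  finally show ?thesis unfolding UNIV_Times_UNIV .
qed

text \<open>The quaternionic structure through which the Dirac equation enters, see \<open>lift_d_zbar\<close>.\<close>

definition twist :: "complex ^ ('m::finite \<times> bool) \<Rightarrow> complex ^ ('m \<times> bool)" where
  "twist v = (\<chi> i. if snd i then - cnj (v $ (fst i, False)) else cnj (v $ (fst i, True)))"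

text \<open>For each \<open>j\<close> the contributions of \<open>True\<close> and
  \<open>False\<close> are opposite.\<close>

lemma hinner_twist: "hinner (twist v) v = 0"
  by (simp add: hinner_def sum_pair_bool twist_def)

lemma inner_twist: "twist v \<bullet> twist v = v \<bullet> v"
  by (simp add: inner_vec_def sum_pair_bool twist_def inner_complex_def add.commute)

text \<open>The eigenvalue is allowed to be complex; \<open>eigenvalue_real\<close> derives its
  reality once integration is available.\<close>

locale eigenspinors = spin_surface A g S \<theta>
  for A :: "'a::t2_space chart set" and g :: "'a surface_metric"
    and S :: "('a, 's) line_bundle" and \<theta> :: "'s \<Rightarrow> 's \<Rightarrow> 'a covector" +
  fixes \<psi> :: "'m::finite \<Rightarrow> ('a, 's) spinor_field" and \<mu> :: complex
  assumes smooth: "\<And>j. smooth_spinor A S (\<psi> j)"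
    and eigen: "\<And>j p. dirac A g S \<theta> (\<psi> j) p = spinor_scl S \<mu> (\<psi> j p)"
    and normalized: "\<And>p. (\<Sum>j\<in>UNIV. spinor_norm_sq A g S \<theta> (\<psi> j p)) = 1"
begin

abbreviation lift :: "('a \<Rightarrow> 's) \<Rightarrow> 'a \<Rightarrow> complex ^ ('m \<times> bool)" where
  "lift s0 \<equiv> spinor_lift s0 \<psi>"

lemma smooth_plus: "smooth_section A S (\<lambda>q. fst (\<psi> j q))"
  and smooth_minus: "smooth_section A S (\<lambda>q. unbar (snd (\<psi> j q)))"
proof -
  have "smooth_section A (conj_bundle S) (\<lambda>q. snd (\<psi> j q))"
    using smooth[of j] by (simp add: smooth_spinor_def o_def)
  then show "smooth_section A S (\<lambda>q. unbar (snd (\<psi> j q)))"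
    using smooth_section_unbar[of "\<lambda>q. snd (\<psi> j q)"] by (simp add: o_def)
  show "smooth_section A S (\<lambda>q. fst (\<psi> j q))"
    using smooth[of j] by (simp add: smooth_spinor_def o_def)
qed

lemma lift_smooth:
  assumes ad: "adapted A g S \<theta> c s0"
  shows "smooth_on (snd c ` fst c) (lift s0 \<circ> chart_inv c)"
  unfolding smooth_on_def
proof
  fix n
  show "Ck n (snd c ` fst c) (lift s0 \<circ> chart_inv c)"
  proof (rule Ck_of_vec_nth[OF open_range[OF adapted_atlas[OF ad]]])
    show "Ck n (snd c ` fst c) (\<lambda>z. (lift s0 \<circ> chart_inv c) z $ i)" for i
      using smooth_on_Ck[OF smooth_coord[OF ad smooth_plus[of "fst i"]], of n]
        smooth_on_Ck[OF smooth_coord[OF ad smooth_minus[of "fst i"]], of n]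
      by (cases "snd i") (simp_all add: spinor_lift_def o_def)
  qed
qed

lemma lift_norm:
  assumes ad: "adapted A g S \<theta> c s0" and p: "p \<in> fst c"
  shows "lift s0 p \<bullet> lift s0 p = sqrt (conf g c p)"
proof -
  have nz: "nonzero S (s0 p)" by (rule adapted_nonzero[OF ad p])
  have pos: "conf g c p > 0" by (rule conf_pos[OF adapted_atlas[OF ad] p])
  have n: "spin_norm_sq A g S \<theta> t = (cmod (coord S (s0 p) t))\<^sup>2 / sqrt (conf g c p)" if "proj S t = p" for t
    using adapted_norm[OF ad p, of "coord S (s0 p) t"] scl_coord[OF nz, of t] that adapted_proj[OF ad p] by simp
  have "1 = (\<Sum>j\<in>UNIV. spinor_norm_sq A g S \<theta> (\<psi> j p))" by (simp add: normalized)
  also have "\<dots> = (\<Sum>j\<in>UNIV. (cmod (lift s0 p $ (j, True)))\<^sup>2 + (cmod (lift s0 p $ (j, False)))\<^sup>2) / sqrt (conf g c p)"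
    by (simp add: spinor_norm_sq_def n smooth_section_proj[OF smooth_plus] smooth_section_proj[OF smooth_minus]
        spinor_lift_def sum_divide_distrib add_divide_distrib)
  also have "\<dots> = (lift s0 p \<bullet> lift s0 p) / sqrt (conf g c p)"
    by (simp add: inner_vec_def sum_pair_bool dot_square_norm)
  finally show ?thesis using pos by (simp add: field_simps)
qed

lemma lift_nonzero: "adapted A g S \<theta> c s0 \<Longrightarrow> p \<in> fst c \<Longrightarrow> lift s0 p \<noteq> 0"
  using lift_norm[of c s0 p] conf_pos[OF adapted_atlas, of c s0 p] by auto

text \<open>By \<open>lift_norm\<close> the square root of the conformal factor is |F|^2, so the
  Dirac equation closes up in terms of the lift alone. As long as \<open>\<mu>\<close> is complex,
  the two halves carry conjugate constants.\<close>

lemma lift_d_zbar: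
  assumes ad: "adapted A g S \<theta> c s0" and p: "p \<in> fst c"
  shows "d_zbar (\<lambda>z. (lift s0 \<circ> chart_inv c) z $ i) (snd c p) =
    (if snd i then \<mu> else cnj \<mu>) / 2 * of_real (lift s0 p \<bullet> lift s0 p) * twist (lift s0 p) $ i"
  unfolding lift_norm[OF ad p]
  using eigenspinor_coordinates[OF ad p smooth eigen, of "fst i"]
  by (cases i) (auto simp: spinor_lift_def twist_def o_def)

text \<open>The coefficient of the sum of the products of the conjugate of
  \<open>\<psi>\<^sub>j\<^sub>-\<close> with \<open>\<psi>\<^sub>j\<^sub>+\<close>, a section of the
  square of \<open>S\<close> and hence, by \<open>quadratic_change\<close>, a form of type (1,0).
  Its differential is what detects the imaginary part of the eigenvalue.\<close>

definition quadratic :: "('a \<Rightarrow> 's) \<Rightarrow> 'a \<Rightarrow> complex" where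
  "quadratic s0 p = (\<Sum>j\<in>UNIV. lift s0 p $ (j, False) * lift s0 p $ (j, True))"

lemma quadratic_smooth:
  assumes ad: "adapted A g S \<theta> c s0"
  shows "Ck n (snd c ` fst c) (quadratic s0 \<circ> chart_inv c)"
proof -
  note o = open_range[OF adapted_atlas[OF ad]]
  have "Ck n (snd c ` fst c) (\<lambda>z. (lift s0 \<circ> chart_inv c) z $ i)" for i
    by (rule Ck_vec_nth[OF o smooth_on_Ck[OF lift_smooth[OF ad]]])
  then show ?thesis
    unfolding quadratic_def[abs_def] o_def by (intro Ck_sum Ck_mult o) auto
qed

lemma quadratic_change:
  assumes ad: "adapted A g S \<theta> c s0" "adapted A g S \<theta> c' s0'"
    and p: "p \<in> fst c" "p \<in> fst c'"
  shows "quadratic s0 p = quadratic s0' p * deriv (transition c c') (snd c p)"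
proof -
  have "lift s0 p $ i = lift s0' p $ i * coord S (s0 p) (s0' p)" for i
    using coord_adapted_change[OF ad p] smooth_section_proj[OF smooth_plus] smooth_section_proj[OF smooth_minus]
    by (simp add: spinor_lift_def)
  then have "quadratic s0 p = (\<Sum>j\<in>UNIV. lift s0' p $ (j, False) * lift s0' p $ (j, True) * (coord S (s0 p) (s0' p))\<^sup>2)"
    by (simp add: quadratic_def power2_eq_square mult_ac)
  then show ?thesis
    by (simp add: quadratic_def adapted_change_square[OF ad p] sum_distrib_right)
qed

text \<open>In the derivative the \<open>True\<close> coordinates carry the conjugate of
  \<open>\<mu>\<close> and the \<open>False\<close> coordinates carry - \<open>\<mu>\<close>. Both
  have imaginary part - Im \<open>\<mu>\<close>, so the squares add up to |F|^2; together with the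
  factor |F|^2 / 2 of the Dirac equation this gives half the conformal factor.\<close>

lemma quadratic_d_zbar:
  assumes ad: "adapted A g S \<theta> c s0" and p: "p \<in> fst c"
  shows "- 2 * Im (d_zbar (quadratic s0 \<circ> chart_inv c) (snd c p)) = conf g c p * Im \<mu>"
proof -
  let ?F = "\<lambda>z i. (lift s0 \<circ> chart_inv c) z $ i" and ?z = "snd c p"
  let ?N = "complex_of_real (lift s0 p \<bullet> lift s0 p)"
  note cA = adapted_atlas[OF ad]
  have z: "(lift s0 \<circ> chart_inv c) ?z = lift s0 p" using cA p by simp
  have "(\<lambda>z. ?F z i) differentiable (at ?z)" for i
    using Ck_vec_nth[OF open_range[OF cA] smooth_on_Ck[OF lift_smooth[OF ad], of 1], of i] p by simp
  then have w: "wirt (\<lambda>z. ?F z i) (d_z (\<lambda>z. ?F z i) ?z) (d_zbar (\<lambda>z. ?F z i) ?z) ?z" for i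
    by (rule differentiable_wirt)
  have "wirt (\<lambda>z. \<Sum>j\<in>UNIV. ?F z (j, False) * ?F z (j, True))
     (\<Sum>j\<in>UNIV. ?F ?z (j, False) * d_z (\<lambda>z. ?F z (j, True)) ?z + d_z (\<lambda>z. ?F z (j, False)) ?z * ?F ?z (j, True))
     (\<Sum>j\<in>UNIV. ?F ?z (j, False) * d_zbar (\<lambda>z. ?F z (j, True)) ?z + d_zbar (\<lambda>z. ?F z (j, False)) ?z * ?F ?z (j, True)) ?z"
    by (intro wirt_sum wirt_mult w) simp
  from wirt_d_zbar[OF this]
  have "d_zbar (quadratic s0 \<circ> chart_inv c) ?z =
     (\<Sum>j\<in>UNIV. ?F ?z (j, False) * d_zbar (\<lambda>z. ?F z (j, True)) ?z + d_zbar (\<lambda>z. ?F z (j, False)) ?z * ?F ?z (j, True))"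
    by (simp add: quadratic_def[abs_def] o_def)
  also have "\<dots> = (\<Sum>j\<in>UNIV. ?N / 2 * (cnj \<mu> * of_real ((cmod (lift s0 p $ (j, True)))\<^sup>2) -
      \<mu> * of_real ((cmod (lift s0 p $ (j, False)))\<^sup>2)))"
    unfolding lift_d_zbar[OF ad p] z complex_norm_square
    by (intro sum.cong refl) (simp add: twist_def algebra_simps)
  moreover have "Im (of_real n / 2 * (cnj \<mu> * of_real x - \<mu> * of_real y)) = - n / 2 * Im \<mu> * (x + y)" for n x y
    by (simp add: algebra_simps)
  ultimately have "Im (d_zbar (quadratic s0 \<circ> chart_inv c) ?z) =
    (\<Sum>j\<in>UNIV. - (lift s0 p \<bullet> lift s0 p) / 2 * Im \<mu> * ((cmod (lift s0 p $ (j, True)))\<^sup>2 + (cmod (lift s0 p $ (j, False)))\<^sup>2))"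
    by (simp only: Im_sum)
  also have "\<dots> = - (lift s0 p \<bullet> lift s0 p) / 2 * Im \<mu> * (lift s0 p \<bullet> lift s0 p)"
    unfolding sum_distrib_left[symmetric] by (simp add: inner_vec_def sum_pair_bool dot_square_norm)
  finally show ?thesis
    using conf_pos[OF cA p] by (simp add: lift_norm[OF ad p])
qed

lemma spinor_map_lift: "adapted A g S \<theta> c s0 \<Longrightarrow> p \<in> fst c \<Longrightarrow> spinor_map S \<psi> p = hcoord (lift s0 p)"
  by (rule spinor_map_adapted[OF _ _ smooth])

lemma smooth_spinor_map: "smooth_map A (spinor_map S \<psi>)"
  unfolding smooth_map_def
proof
  fix p
  obtain c s0 where ad: "adapted A g S \<theta> c s0" and p: "p \<in> fst c" using adapted_exists by blast
  note cA = adapted_atlas[OF ad]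
  have "local_lift c p (spinor_map S \<psi>) (lift s0 \<circ> chart_inv c)"
    unfolding local_lift_def
  proof (intro conjI exI[of _ "snd c ` fst c"] ballI)
    show "smooth_on (snd c ` fst c) (lift s0 \<circ> chart_inv c)" by (rule lift_smooth[OF ad])
    fix z assume "z \<in> snd c ` fst c"
    then have "chart_inv c z \<in> fst c" by (rule chart_inv_in[OF cA])
    then show "(lift s0 \<circ> chart_inv c) z \<noteq> 0"
      "spinor_map S \<psi> (chart_inv c z) = hcoord ((lift s0 \<circ> chart_inv c) z)"
      using lift_nonzero[OF ad] spinor_map_lift[OF ad] by auto
  qed (use p open_range[OF cA] in auto)
  then show "\<exists>c\<in>A. \<exists>F. local_lift c p (spinor_map S \<psi>) F" using cA by blast
qed

text \<open>The tension field is normal: the Laplacian of the projection matrix pairs to second order with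
  differences of projections.\<close>

lemma laplace_spinor_map_bound:
  fixes l :: real
  assumes real: "\<mu> = of_real (2 * l)"
    and ad: "adapted A g S \<theta> c s0" and K: "compact K" "K \<subseteq> snd c ` fst c"
  defines "M \<equiv> \<lambda>w. projmat ((lift s0 \<circ> chart_inv c) w)"
  shows "\<exists>C. \<forall>z\<in>K. \<forall>v. v \<noteq> 0 \<longrightarrow>
    \<bar>(projmat v - M z) \<bullet> (frechet_derivative (\<lambda>w. frechet_derivative M (at w) 1) (at z) 1 +
      frechet_derivative (\<lambda>w. frechet_derivative M (at w) \<i>) (at z) \<i>)\<bar> \<le> C * (norm (projmat v - M z))\<^sup>2"
proof -
  let ?F = "lift s0 \<circ> chart_inv c" and ?S = "snd c ` fst c"
  note cA = adapted_atlas[OF ad]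
  define AA where "AA z = (\<chi> i. d_z (\<lambda>w. ?F w $ i) z)" for z
  define R where "R z = horizontal (?F z) (AA z)" for z
  have S: "open ?S" by (rule open_range[OF cA])
  have C2: "Ck 2 ?S ?F" by (rule smooth_on_Ck[OF lift_smooth[OF ad]])
  have nz: "?F w \<noteq> 0" if "w \<in> ?S" for w
    using lift_nonzero[OF ad chart_inv_in[OF cA that]] by simp
  have zb: "d_zbar (\<lambda>w. ?F w $ i) w = of_real l * complex_of_real (?F w \<bullet> ?F w) * twist (?F w) $ i"
    if w: "w \<in> ?S" for w i
  proof -
    obtain q where q: "q \<in> fst c" "w = snd c q" using w by blast
    show ?thesis using lift_d_zbar[OF ad q(1), of i] cA q by (cases "snd i") (simp_all add: real)
  qed
  have FF: "(\<lambda>w. ?F w $ i) differentiable (at w)" if "w \<in> ?S" for w i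
    by (rule Ck_differentiable[OF Ck_vec_nth[OF S C2, unfolded numeral_2_eq_2] that])
  \<comment> \<open>The conjugate of \<open>zb\<close>, rotated once more; the rotation squares to
    -1, hence the minus sign.\<close>
  have G: "wirt (\<lambda>w. twist (?F w) $ i) (- of_real l * complex_of_real (?F w \<bullet> ?F w) * ?F w $ i)
      ((if snd i then - 1 else 1) * cnj (d_z (\<lambda>w. ?F w $ (fst i, \<not> snd i)) w)) w" if w: "w \<in> ?S" for w i
  proof -
    have 1: "wirt (\<lambda>w. (if snd i then - 1 else 1) * cnj (?F w $ (fst i, \<not> snd i)))
      ((if snd i then - 1 else 1) * cnj (d_zbar (\<lambda>w. ?F w $ (fst i, \<not> snd i)) w))
      ((if snd i then - 1 else 1) * cnj (d_z (\<lambda>w. ?F w $ (fst i, \<not> snd i)) w)) w"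
      by (intro wirt_cmult wirt_cnj differentiable_wirt FF w)
    have 2: "(\<lambda>w. (if snd i then - 1 else 1) * cnj (?F w $ (fst i, \<not> snd i))) = (\<lambda>w. twist (?F w) $ i)"
      by (auto simp: twist_def)
    have 3: "(if snd i then - 1 else 1) * cnj (d_zbar (\<lambda>w. ?F w $ (fst i, \<not> snd i)) w) =
        - of_real l * complex_of_real (?F w \<bullet> ?F w) * ?F w $ i"
      unfolding zb[OF w] by (cases i) (auto simp: twist_def)
    show ?thesis using 1 unfolding 2 3 .
  qed
  let ?L = "\<lambda>z. frechet_derivative (\<lambda>w. frechet_derivative M (at w) 1) (at z) 1 +
      frechet_derivative (\<lambda>w. frechet_derivative M (at w) \<i>) (at z) \<i>"
  have L: "?L z = 4 *\<^sub>R ((l\<^sup>2 * (?F z \<bullet> ?F z)) *\<^sub>R (outer (twist (?F z)) (twist (?F z)) - outer (?F z) (?F z)) +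
        inverse (?F z \<bullet> ?F z) *\<^sub>R outer (R z) (R z) -
        ((R z \<bullet> R z) / (?F z \<bullet> ?F z)\<^sup>2) *\<^sub>R outer (?F z) (?F z))" if z: "z \<in> ?S" for z
    unfolding M_def R_def AA_def by (rule laplace_projmat[OF S z C2 nz zb G hinner_twist])
  \<comment> \<open>Each of the four terms of the Laplacian is estimated with a factor 1/2; the two
    Dirac terms add up, and so do the two terms with \<open>R\<close>.\<close>
  define b where "b z = 4 * (l\<^sup>2 * (?F z \<bullet> ?F z) * (?F z \<bullet> ?F z) + inverse (?F z \<bullet> ?F z) * (R z \<bullet> R z))" for z
  have bound: "\<bar>(projmat v - M z) \<bullet> ?L z\<bar> \<le> b z * (norm (projmat v - M z))\<^sup>2" if z: "z \<in> ?S" and v: "v \<noteq> 0" for z v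
  proof -
    let ?D = "projmat v - M z" and ?N = "?F z \<bullet> ?F z" and ?d = "(norm (projmat v - M z))\<^sup>2"
    have N: "?N > 0" using nz[OF z] by simp
    have "?D \<bullet> outer (?F z) (?F z) = - ?N * ?d / 2"
      unfolding M_def by (rule inner_projmat_diff_outer_self[OF v nz[OF z]])
    then have f: "\<bar>?D \<bullet> outer (?F z) (?F z)\<bar> \<le> ?N * ?d / 2"
      using N by (simp only: abs_mult abs_divide abs_minus) simp
    have t: "\<bar>?D \<bullet> outer (twist (?F z)) (twist (?F z))\<bar> \<le> ?N * ?d / 2"
      using inner_projmat_diff_outer_orthogonal[OF v nz[OF z] hinner_twist] by (simp add: M_def inner_twist)
    have r: "\<bar>?D \<bullet> outer (R z) (R z)\<bar> \<le> (R z \<bullet> R z) * ?d / 2"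
      unfolding M_def R_def by (rule inner_projmat_diff_outer_orthogonal[OF v nz[OF z] hinner_horizontal[OF nz[OF z]]])
    have abs4: "\<bar>4 * (a * (x - y) + e * w - k * y)\<bar> \<le> 4 * (a * \<bar>x\<bar> + a * \<bar>y\<bar> + e * \<bar>w\<bar> + k * \<bar>y\<bar>)"
      if "a \<ge> 0" "e \<ge> 0" "k \<ge> 0" for a x y e w k :: real
    proof -
      have lin: "\<bar>4 * (p - q + r - s)\<bar> \<le> 4 * (P + Q + U + T)"
        if "\<bar>p\<bar> \<le> P" "\<bar>q\<bar> \<le> Q" "\<bar>r\<bar> \<le> U" "\<bar>s\<bar> \<le> T" for p q r s P Q U T :: real
        using that unfolding abs_le_iff by auto
      show ?thesis
        unfolding right_diff_distrib[of a] by (rule lin) (use that in \<open>auto simp: abs_mult\<close>)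
    qed
    have "\<bar>?D \<bullet> ?L z\<bar> \<le> 4 * ((l\<^sup>2 * ?N) * \<bar>?D \<bullet> outer (twist (?F z)) (twist (?F z))\<bar> +
        (l\<^sup>2 * ?N) * \<bar>?D \<bullet> outer (?F z) (?F z)\<bar> + inverse ?N * \<bar>?D \<bullet> outer (R z) (R z)\<bar> +
        ((R z \<bullet> R z) / ?N\<^sup>2) * \<bar>?D \<bullet> outer (?F z) (?F z)\<bar>)"
      unfolding L[OF z] inner_scaleR_right inner_add_right inner_diff_right
      by (rule abs4) auto
    also have "\<dots> \<le> 4 * ((l\<^sup>2 * ?N) * (?N * ?d / 2) + (l\<^sup>2 * ?N) * (?N * ?d / 2) +
        inverse ?N * ((R z \<bullet> R z) * ?d / 2) + ((R z \<bullet> R z) / ?N\<^sup>2) * (?N * ?d / 2))"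
      using N by (intro mult_left_mono add_mono t r f) auto
    also have "\<dots> = b z * ?d"
      using N by (simp add: b_def field_simps power2_eq_square)
    finally show ?thesis .
  qed
  \<comment> \<open>What remains is the continuity of \<open>b\<close>, which makes it bounded on
    \<open>K\<close>.\<close>
  have cF: "continuous_on ?S ?F" using Ck_mono[OF _ C2, of 0] by simp
  have cA: "continuous_on ?S (\<lambda>z. d_z (\<lambda>w. ?F w $ i) z)" for i
    using Ck_mono[OF _ Ck_d_z[OF S, of 1 "\<lambda>w. ?F w $ i"], of 0] Ck_vec_nth[OF S C2, of i]
    by (simp add: numeral_2_eq_2)
  have cAA: "continuous_on ?S AA" unfolding AA_def[abs_def] by (intro continuous_on_vec_lambda cA)
  have cS: "continuous_on ?S (\<lambda>z. \<Sum>i\<in>UNIV. AA z $ i * cnj (?F z $ i))"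
    by (intro continuous_on_sum continuous_on_mult continuous_on_cnj continuous_on_component cF cAA)
  have cN: "continuous_on ?S (\<lambda>z. complex_of_real (?F z \<bullet> ?F z))"
    by (intro continuous_on_of_real continuous_on_inner cF)
  have "continuous_on ?S (\<lambda>z. AA z - (\<chi> i. ((\<Sum>i\<in>UNIV. AA z $ i * cnj (?F z $ i)) / complex_of_real (?F z \<bullet> ?F z)) * ?F z $ i))"
    by (rule continuous_on_diff[OF cAA], rule continuous_on_vec_lambda,
        rule continuous_on_mult[OF continuous_on_divide[OF cS cN] continuous_on_component[OF cF]])
      (use nz in simp)
  then have cR: "continuous_on ?S R"
    by (rule continuous_on_eq) (simp add: R_def horizontal_def hinner_def vector_scalar_mult_def)
  have "continuous_on ?S b"
    unfolding b_def[abs_def]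
    by (intro continuous_on_mult continuous_on_add continuous_on_inverse continuous_on_inner
        continuous_on_const cF cR) (use nz in simp)
  then have "continuous_on K b" using K(2) by (rule continuous_on_subset)
  then have "bounded (b ` K)" using K(1) compact_continuous_image compact_imp_bounded by blast
  then obtain C where C: "\<And>z. z \<in> K \<Longrightarrow> norm (b z) \<le> C" unfolding bounded_iff by blast
  show ?thesis
  proof (intro exI[of _ C] ballI allI impI)
    fix z v assume z: "z \<in> K" and v: "(v :: complex ^ ('m \<times> bool)) \<noteq> 0"
    have "\<bar>(projmat v - M z) \<bullet> ?L z\<bar> \<le> b z * (norm (projmat v - M z))\<^sup>2"
      using z v K by (intro bound) auto
    also have "\<dots> \<le> C * (norm (projmat v - M z))\<^sup>2"
      using C[OF z] by (intro mult_right_mono) auto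
    finally show "\<bar>(projmat v - M z) \<bullet> ?L z\<bar> \<le> C * (norm (projmat v - M z))\<^sup>2" .
  qed
qed

end

section \<open>Integration on a compact surface\<close>

lemma compactly_supported_bound:
  fixes f :: "'a::euclidean_space \<Rightarrow> 'b::real_normed_vector"
  assumes "continuous_on UNIV f" "\<And>z. norm z > R \<Longrightarrow> f z = 0"
  shows "\<exists>C\<ge>0. \<forall>z. norm (f z) \<le> C"
proof -
  have "bounded (f ` cball 0 R)"
    using assms(1) by (intro compact_imp_bounded compact_continuous_image) (auto intro: continuous_on_subset)
  then obtain C where "\<forall>x\<in>f ` cball 0 R. norm x \<le> C" unfolding bounded_iff by blast
  then have C: "norm z \<le> R \<Longrightarrow> norm (f z) \<le> C" for z by simp
  have "norm (f z) \<le> max C 0" for z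
    using C[of z] assms(2)[of z] by (cases "norm z \<le> R") (auto simp: not_le)
  then show ?thesis by (intro exI[of _ "max C 0"]) auto
qed

lemma compactly_supported_integrable:
  fixes f :: "'a::euclidean_space \<Rightarrow> real"
  assumes "continuous_on UNIV f" "\<And>z. norm z > R \<Longrightarrow> f z = 0"
  shows "integrable lborel f"
proof -
  have "integrable lborel (\<lambda>z. indicator (cball 0 R) z *\<^sub>R f z)"
    by (rule borel_integrable_compact) (auto intro: continuous_on_subset[OF assms(1)])
  moreover have "(\<lambda>z. indicator (cball 0 R) z *\<^sub>R f z) = f"
    using assms(2) by (force simp: indicator_def not_le)
  ultimately show ?thesis by simp
qed

lemma norm_diff_le_directional:
  fixes f :: "'a::euclidean_space \<Rightarrow> real"
  assumes "Ck 1 UNIV f" "\<And>z. \<bar>frechet_derivative f (at z) v\<bar> \<le> C" "h > 0"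
  shows "\<bar>f (z + h *\<^sub>R v) - f z\<bar> \<le> h * C"
proof -
  have D: "(f has_derivative frechet_derivative f (at w)) (at w)" for w
    using assms(1) by (simp add: frechet_derivative_works)
  have "((\<lambda>s. f (z + s *\<^sub>R v)) has_real_derivative frechet_derivative f (at (z + s *\<^sub>R v)) v) (at s)" for s
  proof -
    have "((\<lambda>s. f (z + s *\<^sub>R v)) has_derivative (\<lambda>r. frechet_derivative f (at (z + s *\<^sub>R v)) (r *\<^sub>R v))) (at s)"
      by (rule has_derivative_compose[where g=f and f="\<lambda>s. z + s *\<^sub>R v", OF _ D]) (auto intro!: derivative_eq_intros)
    then show ?thesis
      using linear_scale[OF has_derivative_linear[OF D]]
      by (simp add: has_field_derivative_def mult_commute_abs)
  qed
  then have "\<exists>s>0. s < h \<and> f (z + h *\<^sub>R v) - f (z + 0 *\<^sub>R v) = (h - 0) * frechet_derivative f (at (z + s *\<^sub>R v)) v"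
    using assms(3) by (intro MVT2) auto
  then obtain s where "f (z + h *\<^sub>R v) - f z = h * frechet_derivative f (at (z + s *\<^sub>R v)) v" by auto
  then show ?thesis using assms(2)[of "z + s *\<^sub>R v"] assms(3) by (simp add: abs_mult)
qed

text \<open>Differentiate the translation invariance of Lebesgue measure.\<close>

lemma integral_directional_derivative_eq_0:
  fixes f :: "'a::euclidean_space \<Rightarrow> real"
  assumes C1: "Ck 1 UNIV f" and supp: "\<And>z. norm z > R \<Longrightarrow> f z = 0"
  shows "integrable lborel (\<lambda>z. frechet_derivative f (at z) v)"
    and "(LINT z|lborel. frechet_derivative f (at z) v) = 0"
proof -
  let ?d = "\<lambda>z. frechet_derivative f (at z) v"
  have D: "(f has_derivative frechet_derivative f (at w)) (at w)" for w
    using C1 by (simp add: frechet_derivative_works)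
  have cf: "continuous_on UNIV f" using Ck_mono[OF _ C1, of 0] by simp
  have cd: "continuous_on UNIV ?d" using C1 by simp
  have d0: "?d z = 0" if "norm z > R" for z
  proof -
    have "open {z. norm z > R}" by (intro open_Collect_less continuous_intros)
    from frechet_derivative_cong_open[OF this, of z f "\<lambda>_. 0"] that supp
    show ?thesis by (simp add: frechet_derivative_const)
  qed
  show int: "integrable lborel ?d" by (rule compactly_supported_integrable[OF cd d0])
  obtain C where C: "C \<ge> 0" "\<And>z. \<bar>?d z\<bar> \<le> C"
    using compactly_supported_bound[OF cd d0] by auto
  \<comment> \<open>Difference quotients with step 1 / (n + 1); their integrals vanish because
    translations preserve Lebesgue measure.\<close>
  define q where "q n z = real (Suc n) * (f (z + inverse (real (Suc n)) *\<^sub>R v) - f z)" for n z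
  have intf: "integrable lborel f" by (rule compactly_supported_integrable[OF cf supp])
  have q0: "(LINT z|lborel. q n z) = 0" for n
  proof -
    let ?t = "inverse (real (Suc n)) *\<^sub>R v"
    have "integrable lborel (\<lambda>z. f (z + ?t))"
    proof (rule compactly_supported_integrable[of _ "R + norm ?t"])
      show "continuous_on UNIV (\<lambda>z. f (z + ?t))"
        by (rule continuous_on_compose2[OF cf]) (auto intro!: continuous_intros)
      show "f (z + ?t) = 0" if "norm z > R + norm ?t" for z
        using that norm_triangle_ineq4[of "z + ?t" ?t] by (intro supp) simp
    qed
    moreover have "(LINT z|lborel. f (z + ?t)) = (LINT z|lborel. f z)"
      by (subst (2) lborel_distr_plus[of ?t, symmetric])
        (use cf in \<open>auto simp: integral_distr add.commute borel_measurable_continuous_onI\<close>)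
    ultimately show ?thesis using intf by (simp add: q_def)
  qed
  have "(\<lambda>n. LINT z|lborel. q n z) \<longlonglongrightarrow> (LINT z|lborel. ?d z)"
  \<comment> \<open>The mean value theorem bounds the quotients by \<open>C\<close>; as the steps
    are at most 1, they vanish outside the ball enlarged by the norm of \<open>v\<close>.\<close>
  proof (rule integral_dominated_convergence[where w="\<lambda>z. indicator (cball 0 (R + norm v)) z *\<^sub>R C"])
    show "?d \<in> borel_measurable lborel" using cd by (simp add: borel_measurable_continuous_onI)
    have "continuous_on UNIV (q n)" for n
      unfolding q_def[abs_def] by (intro continuous_intros continuous_on_compose2[OF cf]) auto
    then show "q n \<in> borel_measurable lborel" for n by (simp add: borel_measurable_continuous_onI)
    show "integrable lborel (\<lambda>z. indicator (cball 0 (R + norm v)) z *\<^sub>R C)"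
      by (rule borel_integrable_compact) auto
    show "AE z in lborel. (\<lambda>n. q n z) \<longlonglongrightarrow> ?d z"
    proof (rule AE_I2)
      fix z
      have "((\<lambda>s. f (z + s *\<^sub>R v)) has_derivative (\<lambda>r. frechet_derivative f (at z) (r *\<^sub>R v))) (at 0)"
        by (rule has_derivative_compose[where g=f and f="\<lambda>s. z + s *\<^sub>R v" and x=0, simplified, OF _ D]) (auto intro!: derivative_eq_intros)
      then have "((\<lambda>s. f (z + s *\<^sub>R v)) has_real_derivative ?d z) (at 0)"
        using linear_scale[OF has_derivative_linear[OF D]]
        by (simp add: has_field_derivative_def mult_commute_abs)
      then have "((\<lambda>h. (f (z + h *\<^sub>R v) - f z) / h) \<longlongrightarrow> ?d z) (at 0)" by (simp add: DERIV_def)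
      moreover have "filterlim (\<lambda>n. inverse (real (Suc n))) (at 0) sequentially"
        using LIMSEQ_inverse_real_of_nat by (auto simp: filterlim_at)
      ultimately have "(\<lambda>n. (f (z + inverse (real (Suc n)) *\<^sub>R v) - f z) / inverse (real (Suc n))) \<longlonglongrightarrow> ?d z"
        by (rule filterlim_compose)
      then show "(\<lambda>n. q n z) \<longlonglongrightarrow> ?d z" by (simp add: q_def divide_inverse mult.commute)
    qed
    show "AE z in lborel. norm (q n z) \<le> indicator (cball 0 (R + norm v)) z *\<^sub>R C" for n
    proof (rule AE_I2)
      fix z
      let ?h = "inverse (real (Suc n))"
      have h: "0 < ?h" "?h \<le> 1" by (auto simp: inverse_le_1_iff)
      show "norm (q n z) \<le> indicator (cball 0 (R + norm v)) z *\<^sub>R C"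
      proof (cases "norm z \<le> R + norm v")
        case True
        have "\<bar>q n z\<bar> \<le> real (Suc n) * (?h * C)"
          unfolding q_def abs_mult using norm_diff_le_directional[OF C1 C(2) h(1), of z]
          by (intro mult_mono) auto
        also have "\<dots> = C" by (simp add: mult.assoc[symmetric])
        finally show ?thesis using True by simp
      next
        case False
        have "norm (?h *\<^sub>R v) \<le> norm v" using h mult_right_mono[OF h(2) norm_ge_zero[of v]] by simp
        moreover have "norm z \<le> norm (z + ?h *\<^sub>R v) + norm (?h *\<^sub>R v)"
          using norm_triangle_ineq4[of "z + ?h *\<^sub>R v" "?h *\<^sub>R v"] by simp
        ultimately have "norm (z + ?h *\<^sub>R v) > R" "norm z > R" using False norm_ge_zero[of v] by linarith+
        then have "q n z = 0" using supp by (simp add: q_def)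
        then show ?thesis using C(1) by simp
      qed
    qed
  qed
  then show "(LINT z|lborel. ?d z) = 0" unfolding q0 by (simp add: LIMSEQ_const_iff)
qed

locale compact_surface = conformal_surface A g
  for A :: "'a::t2_space chart set" and g :: "'a surface_metric" +
  fixes dv :: "'a measure"
  assumes compact: "compact (UNIV :: 'a set)"
    and volume: "riemannian_measure A g dv"
begin

lemma sets_dv: "sets dv = sets borel"
  using volume by (simp add: riemannian_measure_def)

lemma space_dv: "space dv = UNIV"
  using sets_eq_imp_space_eq[OF sets_dv] by simp

lemma continuous_borel: "continuous_on UNIV (f :: 'a \<Rightarrow> real) \<Longrightarrow> f \<in> borel_measurable dv"
  using borel_measurable_continuous_onI measurable_cong_sets[OF sets_dv refl] by blast

lemma hol_gram:
  assumes "c \<in> hol_charts A g" "z \<in> snd c ` fst c"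
  shows "(let G = g c (chart_inv c z) in sqrt (G 1 1 * G \<i> \<i> - (G 1 \<i>)\<^sup>2)) = conf g c (chart_inv c z)"
  using metric_conf[OF assms(1) chart_inv_in[OF hol_in_atlas[OF assms(1)] assms(2)]]
    conf_pos[OF hol_in_atlas[OF assms(1)] chart_inv_in[OF hol_in_atlas[OF assms(1)] assms(2)]]
  by (simp add: Let_def inner_complex_def real_sqrt_mult)

lemma emeasure_hol:
  assumes c: "c \<in> hol_charts A g" and B: "B \<in> sets borel" "B \<subseteq> fst c"
  shows "emeasure dv B = (\<integral>\<^sup>+ z. ennreal (conf g c (chart_inv c z)) * indicator (snd c ` B) z \<partial>lborel)"
proof -
  have "emeasure dv B = (\<integral>\<^sup>+ z \<in> snd c ` B.
             ennreal (let G = g c (chart_inv c z) in sqrt (G 1 1 * G \<i> \<i> - (G 1 \<i>)\<^sup>2)) \<partial>lborel)"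
    using volume hol_in_atlas[OF c] B unfolding riemannian_measure_def by blast
  also have "\<dots> = (\<integral>\<^sup>+ z. ennreal (conf g c (chart_inv c z)) * indicator (snd c ` B) z \<partial>lborel)"
  proof (rule nn_integral_cong)
    fix z :: complex
    show "ennreal (let G = g c (chart_inv c z) in sqrt (G 1 1 * G \<i> \<i> - (G 1 \<i>)\<^sup>2)) * indicator (snd c ` B) z =
      ennreal (conf g c (chart_inv c z)) * indicator (snd c ` B) z"
    proof (cases "z \<in> snd c ` B")
      case True
      then have "z \<in> snd c ` fst c" using B(2) by blast
      from hol_gram[OF c this] show ?thesis by simp
    qed simp
  qed
  finally show ?thesis .
qed

lemma continuous_conf: "c \<in> A \<Longrightarrow> continuous_on (snd c ` fst c) (\<lambda>z. conf g c (chart_inv c z))"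
  using smooth_on_Ck[OF smooth_conf, of c 0] by simp

text \<open>\<open>riemannian_measure\<close> gives only the measures of Borel sets inside charts.
  These identify \<open>dv\<close> on the chart domain with the image under
  \<open>chart_inv c\<close> of Lebesgue measure with the conformal factor as density, and integrals
  follow.\<close>

lemma integral_chart:
  fixes f :: "'a \<Rightarrow> real"
  assumes c: "c \<in> hol_charts A g" and f: "f \<in> borel_measurable dv" and supp: "\<And>p. p \<notin> fst c \<Longrightarrow> f p = 0"
  shows "(LINT p|dv. f p) = (LINT z|lborel. indicator (snd c ` fst c) z * (conf g c (chart_inv c z) * f (chart_inv c z)))"
proof -
  let ?U = "fst c" and ?W = "snd c ` fst c"
  let ?s = "\<lambda>z. conf g c (chart_inv c z)"
  note cA = hol_in_atlas[OF c]
  have U: "open ?U" and W: "open ?W" using open_domain open_range cA by auto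
  have Ub: "?U \<in> sets dv" "?U \<in> sets borel" "?W \<in> sets borel" using U W by (auto simp: sets_dv)
  let ?L = "restrict_space lborel ?W"
  let ?N = "density ?L (\<lambda>z. ennreal (?s z))"
  have sL: "sets ?L = sets (restrict_space borel ?W)" by (rule sets_restrict_space_cong) simp
  have spL: "space ?L = ?W" by (simp add: space_restrict_space)
  have ms: "?s \<in> borel_measurable ?L"
    using borel_measurable_continuous_on_restrict[OF continuous_conf[OF cA]] measurable_cong_sets[OF sL refl] by blast
  have "chart_inv c \<in> measurable ?L borel"
    using borel_measurable_continuous_on_restrict[OF continuous_chart_inv[OF cA]] measurable_cong_sets[OF sL refl] by blast
  then have mc: "chart_inv c \<in> measurable ?L (restrict_space borel ?U)"
    by (rule measurable_restrict_space2[rotated]) (use chart_inv_in[OF cA] spL in auto)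
  then have mcN: "chart_inv c \<in> measurable ?N (restrict_space borel ?U)" by simp
  have eq: "restrict_space dv ?U = distr ?N (restrict_space borel ?U) (chart_inv c)"
  proof (rule measure_eqI)
    show "sets (restrict_space dv ?U) = sets (distr ?N (restrict_space borel ?U) (chart_inv c))"
      by (simp add: sets_restrict_space_cong[OF sets_dv])
    fix B assume "B \<in> sets (restrict_space dv ?U)"
    then have B: "B \<in> sets borel" "B \<subseteq> ?U"
      using U by (auto simp: sets_restrict_space_iff sets_dv space_dv)
    have pre: "chart_inv c -` B \<inter> ?W = snd c ` B" using cA B(2) by force
    have mB: "chart_inv c -` B \<inter> ?W \<in> sets ?L"
    proof -
      have "B \<in> sets (restrict_space borel ?U)" using B U by (simp add: sets_restrict_space_iff)
      from measurable_sets[OF mc this] show ?thesis by (simp add: spL)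
    qed
    have "emeasure (distr ?N (restrict_space borel ?U) (chart_inv c)) B = emeasure ?N (chart_inv c -` B \<inter> ?W)"
      using B U by (subst emeasure_distr[OF mcN]) (auto simp: sets_restrict_space_iff space_restrict_space)
    also have "\<dots> = (\<integral>\<^sup>+ z. ennreal (?s z) * indicator (snd c ` B) z \<partial>?L)"
      using mB ms by (subst emeasure_density) (auto simp: pre)
    also have "\<dots> = (\<integral>\<^sup>+ z. ennreal (?s z) * indicator (snd c ` B) z * indicator ?W z \<partial>lborel)"
      using W by (subst nn_integral_restrict_space) auto
    also have "\<dots> = (\<integral>\<^sup>+ z. ennreal (?s z) * indicator (snd c ` B) z \<partial>lborel)"
      using B(2) by (intro nn_integral_cong) (auto simp: indicator_def)
    also have "\<dots> = emeasure dv B" by (rule emeasure_hol[OF c B, symmetric])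
    also have "\<dots> = emeasure (restrict_space dv ?U) B"
      using B Ub by (subst emeasure_restrict_space) (auto simp: space_dv)
    finally show "emeasure (restrict_space dv ?U) B = emeasure (distr ?N (restrict_space borel ?U) (chart_inv c)) B" ..
  qed
  have "(LINT p|dv. f p) = (LINT p|dv. indicator ?U p *\<^sub>R f p)"
    by (intro Bochner_Integration.integral_cong) (auto simp: indicator_def supp)
  also have "\<dots> = (LINT p|restrict_space dv ?U. f p)"
    using Ub by (subst integral_restrict_space) (auto simp: space_dv)
  also have "\<dots> = (LINT z|?N. f (chart_inv c z))"
    unfolding eq using f measurable_cong_sets[OF sets_dv refl]
    by (subst integral_distr[OF mcN]) (auto intro!: measurable_restrict_space1)
  also have "\<dots> = (LINT z|?L. ?s z *\<^sub>R f (chart_inv c z))"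
  proof (rule integral_density)
    show "(\<lambda>z. f (chart_inv c z)) \<in> borel_measurable ?L"
    proof (rule measurable_compose[OF mc])
      show "f \<in> borel_measurable (restrict_space borel ?U)"
        using f measurable_cong_sets[OF sets_dv refl] by (auto intro!: measurable_restrict_space1)
    qed
    show "AE z in ?L. 0 \<le> ?s z"
      using conf_pos[OF cA chart_inv_in[OF cA]] by (intro AE_I2) (auto simp: spL less_imp_le)
  qed (rule ms)
  also have "\<dots> = (LINT z|lborel. indicator ?W z *\<^sub>R (?s z *\<^sub>R f (chart_inv c z)))"
    using W by (subst integral_restrict_space) auto
  finally show ?thesis by simp
qed

lemma compact_chart_set:
  assumes c: "c \<in> A" and K: "compact K" "K \<subseteq> snd c ` fst c"
  shows "compact (chart_inv c ` K)" "closed (chart_inv c ` K)" "chart_inv c ` K \<subseteq> fst c"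
proof -
  show co: "compact (chart_inv c ` K)"
    by (rule compact_continuous_image[OF continuous_on_subset[OF continuous_chart_inv[OF c] K(2)] K(1)])
  then show "closed (chart_inv c ` K)" by (rule compact_imp_closed)
  show "chart_inv c ` K \<subseteq> fst c" using K(2) c by auto
qed

text \<open>Continuity holds on two open sets covering the surface: the chart domain and the
  complement of the image of \<open>K\<close>, which is closed because compact subsets of a
  Hausdorff space are.\<close>

lemma continuous_extend_zero:
  assumes c: "c \<in> A" and K: "compact K" "K \<subseteq> snd c ` fst c"
    and h: "continuous_on (snd c ` fst c) h" "\<And>z. z \<in> snd c ` fst c \<Longrightarrow> z \<notin> K \<Longrightarrow> h z = (0 :: real)"
  shows "continuous_on UNIV (\<lambda>p. if p \<in> fst c then h (snd c p) else 0)"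
proof -
  let ?f = "\<lambda>p. if p \<in> fst c then h (snd c p) else 0"
  have "continuous_on (fst c) (\<lambda>p. h (snd c p))"
    using continuous_on_compose2[OF h(1) continuous_chart[OF c]] by blast
  then have 1: "continuous_on (fst c) ?f" by (rule continuous_on_eq) simp
  have z: "?f p = 0" if "p \<in> - chart_inv c ` K" for p
  proof (cases "p \<in> fst c")
    case True
    then have "snd c p \<notin> K" using that chart_inv_chart[OF c True] by (metis ComplD image_eqI)
    then show ?thesis using h(2) True by simp
  qed simp
  have 2: "continuous_on (- chart_inv c ` K) ?f"
    by (rule continuous_on_eq[OF continuous_on_const[of _ 0]]) (simp add: z)
  have "fst c \<union> - chart_inv c ` K = UNIV" using compact_chart_set(3)[OF c K] by blast
  then show ?thesis
    using continuous_on_open_Un[OF open_domain[OF c] _ 1 2] compact_chart_set(2)[OF c K] by (simp add: open_Compl)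
qed

end

section \<open>Partitions of unity of class C^1\<close>

lemma has_derivative_pos_part_square:
  "((\<lambda>x. (max 0 x)\<^sup>2) has_real_derivative 2 * max 0 x) (at (x :: real))"
proof (cases x "0 :: real" rule: linorder_cases)
  case less
  have "((\<lambda>x. 0) has_real_derivative 2 * max 0 x) (at x)" using less by simp
  then show ?thesis
    by (rule has_field_derivative_transform_within_open[where S="{..<0}"]) (use less in auto)
next
  case equal
  have "((\<lambda>h :: real. (max 0 h)\<^sup>2 / h) \<longlongrightarrow> 0) (at 0)"
  proof (rule Lim_null_comparison)
    show "\<forall>\<^sub>F h in at 0. norm ((max 0 h)\<^sup>2 / h) \<le> \<bar>h :: real\<bar>"
      by (intro always_eventually) (auto simp: max_def power2_eq_square)
    show "((\<lambda>h :: real. \<bar>h\<bar>) \<longlongrightarrow> 0) (at 0)" by (auto intro!: tendsto_eq_intros)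
  qed
  then show ?thesis unfolding equal by (simp add: DERIV_def)
next
  case greater
  have "((\<lambda>x. x\<^sup>2) has_real_derivative 2 * max 0 x) (at x)"
    using greater by (auto intro!: derivative_eq_intros)
  then show ?thesis
    by (rule has_field_derivative_transform_within_open[where S="{0<..}"]) (use greater in auto)
qed

lemma Ck_pos_part_square: "Ck 1 UNIV (\<lambda>x :: real. (max 0 x)\<^sup>2)"
  unfolding One_nat_def
proof (rule Ck_SucI)
  show "((\<lambda>x. (max 0 x)\<^sup>2) has_derivative (\<lambda>v. 2 * max 0 x * v)) (at x)" for x :: real
    using has_derivative_pos_part_square[of x] by (simp add: has_field_derivative_def)
  show "Ck 0 UNIV (\<lambda>x. 2 * max 0 x * v)" for v :: real
    by (auto intro!: continuous_intros)
qed simp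

text \<open>Squaring the positive part removes the kink on the circle of radius \<open>r\<close>.
  Class C^1 is the regularity that the divergence theorem asks of a cut-off.\<close>

definition bump :: "complex \<Rightarrow> real \<Rightarrow> complex \<Rightarrow> real" where
  "bump a r z = (max 0 (r\<^sup>2 - (z - a) \<bullet> (z - a)))\<^sup>2"

lemma Ck_bump: "Ck 1 UNIV (bump a r)"
proof -
  have d: "Ck 1 UNIV (\<lambda>z. z + (- a))" by (intro Ck_add Ck_ident Ck_const) simp
  have "Ck 1 UNIV (\<lambda>z. r\<^sup>2 + - ((z + (- a)) \<bullet> (z + (- a))))"
    by (intro Ck_add Ck_const Ck_minus Ck_bounded_bilinear[OF _ bounded_bilinear_inner] d) simp_all
  from Ck_compose[OF open_UNIV open_UNIV _ this Ck_pos_part_square]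
  show ?thesis unfolding bump_def[abs_def] by simp
qed

lemma bump_nonneg: "bump a r z \<ge> 0"
  by (simp add: bump_def)

lemma bump_center: "r > 0 \<Longrightarrow> bump a r a > 0"
  by (simp add: bump_def)

lemma bump_eq_0:
  assumes "r > 0" "z \<notin> cball a r"
  shows "bump a r z = 0"
proof -
  have "r < norm (z - a)" using assms by (simp add: dist_norm norm_minus_commute)
  then have "r\<^sup>2 \<le> (norm (z - a))\<^sup>2" using assms(1) by (intro power_mono) auto
  then show ?thesis by (simp add: bump_def power2_norm_eq_inner)
qed

context compact_surface
begin

text \<open>Near a point of the chart domain the extension is \<open>h\<close> after a transition;
  near any other point it vanishes identically.\<close>

lemma Ck_extend_zero:
  assumes c: "c \<in> A" and K: "compact K" "K \<subseteq> snd c ` fst c"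
    and h: "Ck 1 (snd c ` fst c) h" "\<And>z. z \<in> snd c ` fst c \<Longrightarrow> z \<notin> K \<Longrightarrow> h z = (0 :: real)"
    and c': "c' \<in> A"
  shows "Ck 1 (snd c' ` fst c') ((\<lambda>q. if q \<in> fst c then h (snd c q) else 0) \<circ> chart_inv c')"
    (is "Ck 1 _ (?u \<circ> _)")
proof (rule Ck_local)
  fix z assume "z \<in> snd c' ` fst c'"
  then obtain q where q: "q \<in> fst c'" "z = snd c' q" by blast
  show "\<exists>T. open T \<and> z \<in> T \<and> Ck 1 T (?u \<circ> chart_inv c')"
  proof (cases "q \<in> fst c")
    case True
    let ?T = "snd c' ` (fst c' \<inter> fst c)"
    have T: "open ?T" by (rule open_chart_image[OF c' open_domain[OF c]])
    have sm: "smooth_on ?T (transition c' c)"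
      using atlas c c' by (simp add: oriented_smooth_structure_def oriented_compatible_def)
    have img: "transition c' c ` ?T \<subseteq> snd c ` fst c" using c' by (auto simp: transition_def)
    have "Ck 1 ?T (\<lambda>w. h (transition c' c w))"
      by (rule Ck_compose[OF T open_range[OF c] img smooth_on_Ck[OF sm] h(1)])
    then have "Ck 1 ?T (?u \<circ> chart_inv c')"
      by (rule Ck_transform[OF T]) (use c' in \<open>auto simp: transition_def\<close>)
    then show ?thesis using T True q by blast
  next
    case False
    let ?T = "snd c' ` (fst c' \<inter> - chart_inv c ` K)"
    have T: "open ?T"
      by (rule open_chart_image[OF c']) (simp add: open_Compl compact_chart_set(2)[OF c K])
    have "?u p = 0" if "p \<notin> chart_inv c ` K" for p
    proof (cases "p \<in> fst c")
      case True
      then have "snd c p \<notin> K" using that chart_inv_chart[OF c True] by (metis image_eqI)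
      then show ?thesis using h(2) True by simp
    qed simp
    then have "Ck 1 ?T (?u \<circ> chart_inv c')"
      using c' by (intro Ck_transform[OF T Ck_const[of _ _ 0]]) force
    moreover have "q \<notin> chart_inv c ` K" using compact_chart_set(3)[OF c K] False by blast
    ultimately show ?thesis using T q by blast
  qed
qed

lemma continuous_from_charts:
  fixes f :: "'a \<Rightarrow> real"
  assumes "\<And>p. \<exists>c\<in>A. p \<in> fst c \<and> isCont (f \<circ> chart_inv c) (snd c p)"
  shows "continuous_on UNIV f"
proof -
  have "isCont f p" for p
  proof -
    obtain c where c: "c \<in> A" "p \<in> fst c" "isCont (f \<circ> chart_inv c) (snd c p)" using assms by blast
    have "isCont (snd c) p"
      using continuous_chart[OF c(1)] open_domain[OF c(1)] c(2) by (simp add: continuous_on_eq_continuous_at)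
    from isCont_o2[OF this c(3)] have 1: "isCont (\<lambda>q. (f \<circ> chart_inv c) (snd c q)) p" .
    have "\<forall>\<^sub>F q in nhds p. (f \<circ> chart_inv c) (snd c q) = f q"
      using open_domain[OF c(1)] c(1,2) by (auto simp: eventually_nhds intro!: exI[of _ "fst c"])
    from isCont_cong[OF this] 1 show ?thesis by simp
  qed
  then show ?thesis by (simp add: continuous_on_eq_continuous_at)
qed

text \<open>Every point has a bump that is positive there; compactness extracts finitely many with
  positive sum, and dividing by the sum normalizes. The charts are prescribed so that each can come
  with an adapted section of \<open>S\<close>.\<close>

lemma partition_of_unity:
  assumes C: "\<And>p. C p \<in> hol_charts A g" "\<And>p. p \<in> fst (C p)"
  obtains I :: "'a set" and K \<phi> where "finite I"
    "\<And>i. i \<in> I \<Longrightarrow> compact (K i)" "\<And>i. i \<in> I \<Longrightarrow> K i \<subseteq> snd (C i) ` fst (C i)"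
    "\<And>i q. i \<in> I \<Longrightarrow> q \<notin> chart_inv (C i) ` K i \<Longrightarrow> \<phi> i q = 0"
    "\<And>i q. i \<in> I \<Longrightarrow> \<phi> i q \<ge> (0 :: real)" "\<And>q. (\<Sum>i\<in>I. \<phi> i q) = 1"
    "\<And>i c. i \<in> I \<Longrightarrow> c \<in> A \<Longrightarrow> Ck 1 (snd c ` fst c) (\<phi> i \<circ> chart_inv c)"
proof -
  have CA: "C p \<in> A" for p using C(1) by (rule hol_in_atlas)
  have "\<exists>r>0. cball (snd (C p) p) r \<subseteq> snd (C p) ` fst (C p)" for p
    using open_range[OF CA] C(2)[of p] unfolding open_contains_cball by blast
  then obtain r where r: "\<And>p. r p > 0" "\<And>p. cball (snd (C p) p) (r p) \<subseteq> snd (C p) ` fst (C p)" by metis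
  define K where "K p = cball (snd (C p) p) (r p)" for p
  define \<beta> where "\<beta> p = (\<lambda>q. if q \<in> fst (C p) then bump (snd (C p) p) (r p) (snd (C p) q) else 0)" for p
  have K: "compact (K p)" "K p \<subseteq> snd (C p) ` fst (C p)" for p using r by (auto simp: K_def)
  have b0: "bump (snd (C p) p) (r p) z = 0" if "z \<notin> K p" for p z
    using bump_eq_0[OF r(1)] that by (simp add: K_def)
  have cb: "continuous_on UNIV (bump a s)" for a s using Ck_mono[OF _ Ck_bump, of 0] by simp
  have c\<beta>: "continuous_on UNIV (\<beta> p)" for p
    unfolding \<beta>_def by (rule continuous_extend_zero[OF CA K]) (auto intro: continuous_on_subset[OF cb] b0)
  have C\<beta>: "Ck 1 (snd c ` fst c) (\<beta> p \<circ> chart_inv c)" if "c \<in> A" for c p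
    unfolding \<beta>_def
    by (rule Ck_extend_zero[OF CA K Ck_subset[OF Ck_bump subset_UNIV] _ that]) (rule b0)
  have \<beta>p: "\<beta> p p > 0" for p using C(2) r by (simp add: \<beta>_def bump_center)
  have \<beta>nn: "\<beta> p q \<ge> 0" for p q by (simp add: \<beta>_def bump_nonneg)
  have "\<exists>I\<subseteq>UNIV. finite I \<and> UNIV \<subseteq> (\<Union>p\<in>I. {q. 0 < \<beta> p q})"
    using compact
  proof (rule compactE_image)
    show "open {q. 0 < \<beta> p q}" for p
      using c\<beta> by (intro open_Collect_less) auto
  qed (use \<beta>p in auto)
  then obtain I where I: "finite I" "UNIV \<subseteq> (\<Union>p\<in>I. {q. 0 < \<beta> p q})" by blast
  let ?s = "\<lambda>q. \<Sum>i\<in>I. \<beta> i q"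
  have s: "?s q > 0" for q
  proof -
    obtain i where "i \<in> I" "\<beta> i q > 0" using I(2) by blast
    then show ?thesis using sum_pos2[OF I(1), of i "\<lambda>i. \<beta> i q"] \<beta>nn by simp
  qed
  define \<phi> where "\<phi> i q = \<beta> i q * inverse (?s q)" for i q
  have "\<phi> i q = 0" if "q \<notin> chart_inv (C i) ` K i" for i q
  proof (cases "q \<in> fst (C i)")
    case True
    then have "snd (C i) q \<notin> K i" using that chart_inv_chart[OF CA True] by (metis image_eqI)
    then show ?thesis by (simp add: \<phi>_def \<beta>_def b0)
  qed (simp add: \<phi>_def \<beta>_def)
  moreover have "\<phi> i q \<ge> 0" for i q
    unfolding \<phi>_def using \<beta>nn s[of q] by simp
  moreover have "(\<Sum>i\<in>I. \<phi> i q) = 1" for q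
    using s[of q] by (simp add: \<phi>_def flip: sum_distrib_right)
  moreover have "Ck 1 (snd c ` fst c) (\<phi> i \<circ> chart_inv c)" if c: "c \<in> A" for i c
  proof -
    note o = open_range[OF c]
    have "Ck 1 (snd c ` fst c) (\<lambda>z. (\<beta> i \<circ> chart_inv c) z * inverse (\<Sum>i\<in>I. (\<beta> i \<circ> chart_inv c) z))"
    proof (intro Ck_mult Ck_inverse Ck_sum o C\<beta> c)
      show "(\<Sum>i\<in>I. (\<beta> i \<circ> chart_inv c) z) \<noteq> 0" for z using s[of "chart_inv c z"] by simp
    qed
    then show ?thesis by (simp add: \<phi>_def[abs_def] o_def)
  qed
  ultimately show ?thesis using that[OF I(1) K(1) K(2)] by blast
qed

end

section \<open>The divergence theorem on the surface\<close>

definition divergence :: "(complex \<Rightarrow> complex) \<Rightarrow> complex \<Rightarrow> real" where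
  "divergence X z = Re (frechet_derivative X (at z) 1) + Im (frechet_derivative X (at z) \<i>)"

locale partitioned_surface = compact_surface A g dv
  for A :: "'a::t2_space chart set" and g :: "'a surface_metric" and dv :: "'a measure" +
  fixes I :: "'i set" and C :: "'i \<Rightarrow> 'a chart" and K :: "'i \<Rightarrow> complex set" and \<phi> :: "'i \<Rightarrow> 'a \<Rightarrow> real"
  assumes finite_I: "finite I"
    and C_hol: "\<And>i. i \<in> I \<Longrightarrow> C i \<in> hol_charts A g"
    and K_compact: "\<And>i. i \<in> I \<Longrightarrow> compact (K i)"
    and K_sub: "\<And>i. i \<in> I \<Longrightarrow> K i \<subseteq> snd (C i) ` fst (C i)"
    and \<phi>_supp: "\<And>i q. i \<in> I \<Longrightarrow> q \<notin> chart_inv (C i) ` K i \<Longrightarrow> \<phi> i q = 0"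
    and \<phi>_nonneg: "\<And>i q. i \<in> I \<Longrightarrow> \<phi> i q \<ge> 0"
    and \<phi>_sum: "\<And>q. (\<Sum>i\<in>I. \<phi> i q) = 1"
    and \<phi>_Ck: "\<And>i c. i \<in> I \<Longrightarrow> c \<in> A \<Longrightarrow> Ck 1 (snd c ` fst c) (\<phi> i \<circ> chart_inv c)"
begin

lemma C_atlas: "i \<in> I \<Longrightarrow> C i \<in> A"
  by (simp add: C_hol hol_in_atlas)

lemma K_cover: "\<exists>i\<in>I. \<exists>z\<in>K i. q = chart_inv (C i) z"
proof (rule ccontr)
  assume "\<not> ?thesis"
  then have "\<phi> i q = 0" if "i \<in> I" for i using \<phi>_supp[OF that, of q] that by blast
  then show False using \<phi>_sum[of q] by simp
qed

text \<open>Finitely many compact sets cover the surface, and the density is bounded on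
  each.\<close>

lemma finite_volume: "finite_measure dv"
proof
  have KB: "chart_inv (C i) ` K i \<in> sets dv" if "i \<in> I" for i
    using compact_chart_set(2)[OF C_atlas[OF that] K_compact[OF that] K_sub[OF that]]
    by (simp add: sets_dv borel_closed)
  have fin: "emeasure dv (chart_inv (C i) ` K i) < \<infinity>" if i: "i \<in> I" for i
  proof -
    let ?s = "\<lambda>z. conf g (C i) (chart_inv (C i) z)"
    have "bounded (?s ` K i)"
      by (rule compact_imp_bounded[OF compact_continuous_image[OF continuous_on_subset[OF continuous_conf[OF C_atlas[OF i]] K_sub[OF i]] K_compact[OF i]]])
    then obtain B where B: "\<forall>x\<in>?s ` K i. norm x \<le> B" unfolding bounded_iff by blast
    have im: "snd (C i) ` chart_inv (C i) ` K i = K i"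
      using K_sub[OF i] C_atlas[OF i] by force
    have "emeasure dv (chart_inv (C i) ` K i) = (\<integral>\<^sup>+ z. ennreal (?s z) * indicator (K i) z \<partial>lborel)"
      using emeasure_hol[OF C_hol[OF i], of "chart_inv (C i) ` K i"] KB[OF i]
        compact_chart_set(3)[OF C_atlas[OF i] K_compact[OF i] K_sub[OF i]]
      by (simp add: sets_dv im)
    also have "\<dots> \<le> (\<integral>\<^sup>+ z. ennreal B * indicator (K i) z \<partial>lborel)"
    proof (rule nn_integral_mono)
      fix z
      show "ennreal (?s z) * indicator (K i) z \<le> ennreal B * indicator (K i) z"
        using B by (cases "z \<in> K i") (auto intro!: ennreal_leI)
    qed
    also have "\<dots> = ennreal B * emeasure lborel (K i)"
      using K_compact[OF i] by (intro nn_integral_cmult_indicator) (auto simp: borel_compact)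
    also have "\<dots> < \<infinity>"
      using emeasure_bounded_finite[OF compact_imp_bounded[OF K_compact[OF i]]]
      by (simp add: ennreal_mult_less_top)
    finally show ?thesis .
  qed
  have "space dv \<subseteq> (\<Union>i\<in>I. chart_inv (C i) ` K i)" using K_cover by blast
  then have "emeasure dv (space dv) \<le> emeasure dv (\<Union>i\<in>I. chart_inv (C i) ` K i)"
    using KB finite_I by (intro emeasure_mono) auto
  also have "\<dots> \<le> (\<Sum>i\<in>I. emeasure dv (chart_inv (C i) ` K i))"
    using KB finite_I by (intro emeasure_subadditive_finite) auto
  also have "\<dots> < \<infinity>" using fin finite_I by (simp add: less_top)
  finally show "emeasure dv (space dv) \<noteq> \<infinity>" by simp
qed

sublocale finite_measure dv by (rule finite_volume)

lemma integrable_continuous: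
  fixes f :: "'a \<Rightarrow> real"
  assumes "continuous_on UNIV f"
  shows "integrable dv f"
proof -
  have "bounded (range f)" using compact_imp_bounded[OF compact_continuous_image[OF assms compact]] .
  then obtain B where "\<forall>x\<in>range f. norm x \<le> B" unfolding bounded_iff by blast
  then show ?thesis by (intro integrable_const_bound[where B=B] continuous_borel assms) auto
qed

text \<open>A nonempty open subset of the plane is not negligible, and the density is positive on
  it. Serves to divide by the volume in \<open>eigenvalue_real\<close>.\<close>

lemma volume_pos: "measure dv UNIV > 0"
proof -
  obtain c :: "'a chart" where c: "c \<in> hol_charts A g" "fst c \<noteq> {}" using hol_chart_at by blast
  note cA = hol_in_atlas[OF c(1)]
  let ?s = "\<lambda>z. ennreal (conf g c (chart_inv c z)) * indicator (snd c ` fst c) z"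
  have B: "fst c \<in> sets borel" using open_domain[OF cA] by simp
  have W: "open (snd c ` fst c)" by (rule open_range[OF cA])
  have "emeasure dv (fst c) = (\<integral>\<^sup>+ z. ?s z \<partial>lborel)" by (rule emeasure_hol[OF c(1) B]) simp
  moreover have "(\<integral>\<^sup>+ z. ?s z \<partial>lborel) \<noteq> 0"
  proof
    assume 0: "(\<integral>\<^sup>+ z. ?s z \<partial>lborel) = 0"
    have "(\<lambda>z. indicator (snd c ` fst c) z * conf g c (chart_inv c z)) \<in> borel_measurable borel"
      using borel_measurable_continuous_on_indicator[OF _ continuous_conf[OF cA]] W by simp
    then have "(\<lambda>z. ennreal (indicator (snd c ` fst c) z * conf g c (chart_inv c z))) \<in> borel_measurable lborel"
      by simp
    moreover have "(\<lambda>z. ennreal (indicator (snd c ` fst c) z * conf g c (chart_inv c z))) = ?s"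
      by (auto simp: indicator_def)
    ultimately have "?s \<in> borel_measurable lborel" by simp
    with 0 have "AE z in lborel. ?s z = 0" by (simp add: nn_integral_0_iff_AE)
    then have "AE z in lborel. z \<notin> snd c ` fst c"
    proof eventually_elim
      case (elim z)
      show ?case
      proof
        assume z: "z \<in> snd c ` fst c"
        then show False using elim conf_pos[OF cA chart_inv_in[OF cA z]] by simp
      qed
    qed
    then have "snd c ` fst c \<in> null_sets lborel"
      using W by (simp add: AE_iff_null_sets)
    then have "negligible (snd c ` fst c)"
      by (simp add: negligible_iff_null_sets null_sets_completionI)
    then show False using open_not_negligible[OF W] c(2) by blast
  qed
  ultimately have "emeasure dv (fst c) \<noteq> 0" by simp
  then have "measure dv (fst c) > 0"
    by (simp add: emeasure_eq_measure zero_less_measure_iff)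
  also have "measure dv (fst c) \<le> measure dv UNIV"
    by (rule finite_measure_mono) (auto simp: sets_dv)
  finally show ?thesis .
qed

lemma \<phi>_locally_zero:
  assumes i: "i \<in> I" and p: "p \<notin> chart_inv (C i) ` K i" and c: "c \<in> A" "p \<in> fst c"
  shows "frechet_derivative (\<phi> i \<circ> chart_inv c) (at (snd c p)) v = 0"
proof -
  let ?T = "snd c ` (fst c \<inter> - chart_inv (C i) ` K i)"
  have T: "open ?T"
    using compact_chart_set(2)[OF C_atlas[OF i] K_compact[OF i] K_sub[OF i]]
    by (intro open_chart_image c) (simp add: open_Compl)
  have "(\<phi> i \<circ> chart_inv c) w = 0" if "w \<in> ?T" for w
    using that c \<phi>_supp[OF i] by auto
  then have "frechet_derivative (\<phi> i \<circ> chart_inv c) (at (snd c p)) = frechet_derivative (\<lambda>_. 0) (at (snd c p))"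
    using p c by (intro frechet_derivative_cong_open[OF T]) blast+
  then show ?thesis by (simp add: frechet_derivative_const)
qed

text \<open>By \<open>compat\<close> the quotients of \<open>X i\<close> by the conformal factor are
  the coordinates of one vector field Y; the quotient of \<open>divergence (X i)\<close> by the
  conformal factor is its Riemannian divergence, which integrates to 0. So a function within
  \<open>e\<close> of it has an integral of at most \<open>e\<close> times the volume. The global
  theorem is the sum of the planar ones for the products of Y with the partition functions.\<close>

lemma divergence_bound:
  fixes X :: "'i \<Rightarrow> complex \<Rightarrow> complex"
  assumes X: "\<And>i. i \<in> I \<Longrightarrow> Ck 1 (snd (C i) ` fst (C i)) (X i)"
    and compat: "\<And>i j p. i \<in> I \<Longrightarrow> j \<in> I \<Longrightarrow> p \<in> fst (C i) \<Longrightarrow> p \<in> fst (C j) \<Longrightarrow>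
      deriv (transition (C i) (C j)) (snd (C i) p) * X i (snd (C i) p) / of_real (conf g (C i) p) =
      X j (snd (C j) p) / of_real (conf g (C j) p)"
    and r: "continuous_on UNIV r"
    and bound: "\<And>i z. i \<in> I \<Longrightarrow> z \<in> K i \<Longrightarrow>
      \<bar>divergence (X i) z - conf g (C i) (chart_inv (C i) z) * r (chart_inv (C i) z)\<bar>
        \<le> e * conf g (C i) (chart_inv (C i) z)"
  shows "\<bar>LINT p|dv. r p\<bar> \<le> e * measure dv UNIV"
proof -
  let ?D = "\<lambda>i c p v. frechet_derivative (\<phi> i \<circ> chart_inv c) (at (snd c p)) v"
  \<comment> \<open>\<open>T i\<close> and \<open>W i\<close> will be the two terms of the product
    rule for the divergence of \<open>\<phi> i\<close> times Y: the derivative of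
    \<open>\<phi> i\<close> along Y, and \<open>\<phi> i\<close> times the divergence of Y.\<close>
  define t where "t i z = frechet_derivative (\<phi> i \<circ> chart_inv (C i)) (at z) (X i z) / conf g (C i) (chart_inv (C i) z)" for i z
  define w where "w i z = (\<phi> i \<circ> chart_inv (C i)) z * divergence (X i) z / conf g (C i) (chart_inv (C i) z)" for i z
  define T where "T i = (\<lambda>p. if p \<in> fst (C i) then t i (snd (C i) p) else 0)" for i
  define W where "W i = (\<lambda>p. if p \<in> fst (C i) then w i (snd (C i) p) else 0)" for i
  have pos: "conf g (C i) (chart_inv (C i) z) > 0" if "i \<in> I" "z \<in> snd (C i) ` fst (C i)" for i z
    using conf_pos[OF C_atlas[OF that(1)] chart_inv_in[OF C_atlas[OF that(1)] that(2)]] .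
  have Dlin: "linear (frechet_derivative (\<phi> i \<circ> chart_inv c) (at (snd c p)))"
    if "i \<in> I" "c \<in> A" "p \<in> fst c" for i c p
    using Ck_has_derivative[of 0, OF \<phi>_Ck[OF that(1,2), unfolded One_nat_def]] that(3)
    by (blast intro: has_derivative_linear)
  have lin2: "L v = Re v * L 1 + Im v * L \<i>" if "linear L" for L :: "complex \<Rightarrow> real" and v
  proof -
    have "v = Re v *\<^sub>R 1 + Im v *\<^sub>R \<i>" by (simp add: complex_eq_iff)
    then have "L v = L (Re v *\<^sub>R 1 + Im v *\<^sub>R \<i>)" by simp
    then show ?thesis using that by (simp add: linear_add linear_scale)
  qed
  have cX: "continuous_on (snd (C i) ` fst (C i)) (X i)"
    and cdivX: "continuous_on (snd (C i) ` fst (C i)) (divergence (X i))" if i: "i \<in> I" for i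
    using Ck_mono[OF _ X[OF i], of 0] X[OF i]
    by (auto simp: divergence_def[abs_def] intro!: continuous_intros)
  have cphi: "continuous_on (snd (C i) ` fst (C i)) (\<phi> i \<circ> chart_inv (C i))" if i: "i \<in> I" for i
    using Ck_mono[OF _ \<phi>_Ck[OF i C_atlas[OF i]], of 0] by simp
  have ct: "continuous_on (snd (C i) ` fst (C i)) (t i)" if i: "i \<in> I" for i
  proof -
    let ?S = "snd (C i) ` fst (C i)"
    have "continuous_on ?S (\<lambda>z. (Re (X i z) * frechet_derivative (\<phi> i \<circ> chart_inv (C i)) (at z) 1 +
       Im (X i z) * frechet_derivative (\<phi> i \<circ> chart_inv (C i)) (at z) \<i>) / conf g (C i) (chart_inv (C i) z))"
      using \<phi>_Ck[OF i C_atlas[OF i]] pos[OF i]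
      by (intro continuous_on_divide continuous_on_add continuous_on_mult continuous_on_Re continuous_on_Im
          cX[OF i] continuous_conf[OF C_atlas[OF i]]) force+
    then show ?thesis
    proof (rule continuous_on_eq)
      fix z assume "z \<in> ?S"
      then obtain p where p: "p \<in> fst (C i)" "z = snd (C i) p" by blast
      show "(Re (X i z) * frechet_derivative (\<phi> i \<circ> chart_inv (C i)) (at z) 1 +
       Im (X i z) * frechet_derivative (\<phi> i \<circ> chart_inv (C i)) (at z) \<i>) / conf g (C i) (chart_inv (C i) z) = t i z"
        using lin2[OF Dlin[OF i C_atlas[OF i] p(1)], of "X i z"] by (simp add: t_def p(2))
    qed
  qed
  have cw: "continuous_on (snd (C i) ` fst (C i)) (w i)" if i: "i \<in> I" for i
    unfolding w_def[abs_def] using pos[OF i]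
    by (intro continuous_on_divide continuous_on_mult cphi[OF i] cdivX[OF i] continuous_conf[OF C_atlas[OF i]]) force
  have supp: "chart_inv (C i) z \<notin> chart_inv (C i) ` K i" if "i \<in> I" "z \<in> snd (C i) ` fst (C i)" "z \<notin> K i" for i z
  proof
    assume "chart_inv (C i) z \<in> chart_inv (C i) ` K i"
    then obtain z' where "z' \<in> K i" "chart_inv (C i) z = chart_inv (C i) z'" by blast
    then show False using that chart_chart_inv[OF C_atlas[OF that(1)]] K_sub[OF that(1)] by (metis subsetD)
  qed
  have t0: "t i z = 0" if i: "i \<in> I" and z: "z \<in> snd (C i) ` fst (C i)" "z \<notin> K i" for i z
    using \<phi>_locally_zero[OF i supp[OF i z] C_atlas[OF i] chart_inv_in[OF C_atlas[OF i] z(1)]]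
      chart_chart_inv[OF C_atlas[OF i] z(1)]
    by (simp add: t_def)
  have w0: "w i z = 0" if i: "i \<in> I" and z: "z \<in> snd (C i) ` fst (C i)" "z \<notin> K i" for i z
    using \<phi>_supp[OF i supp[OF i z]] by (simp add: w_def)
  have cT: "continuous_on UNIV (T i)" and cW: "continuous_on UNIV (W i)" if i: "i \<in> I" for i
    unfolding T_def W_def
    by (rule continuous_extend_zero[OF C_atlas[OF i] K_compact[OF i] K_sub[OF i] ct[OF i] t0[OF i]],
        assumption+, rule continuous_extend_zero[OF C_atlas[OF i] K_compact[OF i] K_sub[OF i] cw[OF i] w0[OF i]])
  have TW: "(LINT p|dv. T i p) + (LINT p|dv. W i p) = 0" if i: "i \<in> I" for i
  proof -
    let ?c = "C i" and ?S = "snd (C i) ` fst (C i)"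
    note cA = C_atlas[OF i]
    have S: "open ?S" by (rule open_range[OF cA])
    \<comment> \<open>The localized field in the plane, extended by zero: it is of class C^1 with
      compact support, so its planar divergence integrates to 0.\<close>
    define f where "f z = (if z \<in> ?S then \<phi> i (chart_inv ?c z) *\<^sub>R X i z else 0)" for z
    have Kc: "closed (K i)" by (rule compact_imp_closed[OF K_compact[OF i]])
    have f0: "f z = 0" if "z \<notin> K i" for z
      using \<phi>_supp[OF i supp[OF i _ that]] by (simp add: f_def)
    have fS: "Ck 1 ?S f"
    proof (rule Ck_transform[OF S])
      show "Ck 1 ?S (\<lambda>z. (\<phi> i \<circ> chart_inv ?c) z *\<^sub>R X i z)"
        by (rule Ck_bounded_bilinear[OF S bounded_bilinear_scaleR \<phi>_Ck[OF i cA] X[OF i]])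
    qed (simp add: f_def)
    have Ckf: "Ck 1 UNIV f"
    proof (rule Ck_local)
      fix z
      show "\<exists>T. open T \<and> z \<in> T \<and> Ck 1 T f"
      proof (cases "z \<in> ?S")
        case False
        then have "z \<in> - K i" using K_sub[OF i] by blast
        moreover have "Ck 1 (- K i) f"
          by (rule Ck_transform[OF _ Ck_const[of _ _ 0]]) (use Kc f0 in \<open>auto simp: open_Compl\<close>)
        ultimately show ?thesis using open_Compl[OF Kc] by blast
      next
        case True
        then show ?thesis using S fS by blast
      qed
    qed
    have "bounded (K i)" by (rule compact_imp_bounded[OF K_compact[OF i]])
    then obtain R where R: "\<forall>z\<in>K i. norm z \<le> R" unfolding bounded_iff by blast
    have fR: "f z = 0" if "norm z > R" for z using R f0[of z] that by force
    have CkRe: "Ck 1 UNIV (\<lambda>z. Re (f z))" and CkIm: "Ck 1 UNIV (\<lambda>z. Im (f z))"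
      by (rule Ck_bounded_linear[OF open_UNIV bounded_linear_Re Ckf],
          rule Ck_bounded_linear[OF open_UNIV bounded_linear_Im Ckf])
    have Df: "(f has_derivative frechet_derivative f (at z)) (at z)" for z
      using Ckf by (simp add: frechet_derivative_works)
    have dRe: "frechet_derivative (\<lambda>z. Re (f z)) (at z) v = Re (frechet_derivative f (at z) v)" for z v
      by (rule fun_cong[OF frechet_derivative_eqI[OF bounded_linear.has_derivative[OF bounded_linear_Re Df]]])
    have dIm: "frechet_derivative (\<lambda>z. Im (f z)) (at z) v = Im (frechet_derivative f (at z) v)" for z v
      by (rule fun_cong[OF frechet_derivative_eqI[OF bounded_linear.has_derivative[OF bounded_linear_Im Df]]])
    have "(LINT z|lborel. divergence f z) = 0"
      unfolding divergence_def
      using integral_directional_derivative_eq_0[OF CkRe, of R 1] integral_directional_derivative_eq_0[OF CkIm, of R \<i>] fR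
      by (simp add: dRe dIm)
    moreover have "divergence f z = indicator ?S z * (conf g ?c (chart_inv ?c z) * (T i (chart_inv ?c z) + W i (chart_inv ?c z)))" for z
    proof (cases "z \<in> ?S")
      case True
      then obtain p where p: "p \<in> fst ?c" "z = snd ?c p" by blast
      have "f differentiable (at z)" using Ckf by simp
      have "((\<lambda>z. (\<phi> i \<circ> chart_inv ?c) z *\<^sub>R X i z) has_derivative
        (\<lambda>v. (\<phi> i \<circ> chart_inv ?c) z *\<^sub>R frechet_derivative (X i) (at z) v + frechet_derivative (\<phi> i \<circ> chart_inv ?c) (at z) v *\<^sub>R X i z)) (at z)"
        by (rule has_derivative_scaleR[OF Ck_has_derivative[of 0, OF \<phi>_Ck[OF i cA, unfolded One_nat_def] True]
              Ck_has_derivative[of 0, OF X[OF i, unfolded One_nat_def] True]])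
      then have "(f has_derivative
        (\<lambda>v. (\<phi> i \<circ> chart_inv ?c) z *\<^sub>R frechet_derivative (X i) (at z) v + frechet_derivative (\<phi> i \<circ> chart_inv ?c) (at z) v *\<^sub>R X i z)) (at z)"
        by (rule has_derivative_transform_within_open[OF _ S True]) (simp add: f_def)
      from frechet_derivative_eqI[OF this]
      have "divergence f z = (\<phi> i \<circ> chart_inv ?c) z * divergence (X i) z + frechet_derivative (\<phi> i \<circ> chart_inv ?c) (at z) (X i z)"
        using lin2[OF Dlin[OF i cA p(1)], of "X i z"] p by (simp add: divergence_def algebra_simps)
      then show ?thesis
        using pos[OF i True] True p cA by (simp add: T_def W_def t_def w_def field_simps)
    next
      case False
      then have "z \<in> - K i" using K_sub[OF i] by blast
      from frechet_derivative_cong_open[of "- K i" z f "\<lambda>_. 0", OF _ this] f0 Kc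
      show ?thesis using False by (simp add: divergence_def frechet_derivative_const open_Compl)
    qed
    ultimately have "(LINT z|lborel. indicator ?S z * (conf g ?c (chart_inv ?c z) * (T i (chart_inv ?c z) + W i (chart_inv ?c z)))) = 0"
      by simp
    moreover have "(LINT p|dv. T i p + W i p) = (LINT z|lborel. indicator ?S z * (conf g ?c (chart_inv ?c z) * (T i (chart_inv ?c z) + W i (chart_inv ?c z))))"
      by (rule integral_chart[OF C_hol[OF i]])
        (auto simp: T_def[of i] W_def[of i] intro!: continuous_borel continuous_on_add cT[OF i, unfolded T_def] cW[OF i, unfolded W_def])
    ultimately show ?thesis
      using Bochner_Integration.integral_add[OF integrable_continuous[OF cT[OF i]] integrable_continuous[OF cW[OF i]]] by simp
  qed
  \<comment> \<open>The functions \<open>\<phi> i\<close> sum to 1, so their derivatives along Y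
    cancel. Here the local fields must agree on overlaps.\<close>
  have T0: "(\<Sum>i\<in>I. T i p) = 0" for p
  proof -
    obtain k z where k: "k \<in> I" "z \<in> K k" "p = chart_inv (C k) z" using K_cover by blast
    have p: "p \<in> fst (C k)" using k K_sub[OF k(1)] chart_inv_in[OF C_atlas[OF k(1)]] by blast
    \<comment> \<open>The value of Y at \<open>p\<close> in one fixed chart \<open>C k\<close>;
      every \<open>T i p\<close> is rewritten as a derivative along this vector.\<close>
    define v where "v = X k (snd (C k) p) / of_real (conf g (C k) p)"
    have "T i p = ?D i (C k) p v" if i: "i \<in> I" for i
    proof (cases "p \<in> fst (C i)")
      case True
      let ?Di = "frechet_derivative (\<phi> i \<circ> chart_inv (C i)) (at (snd (C i) p))"
      have "((\<phi> i \<circ> chart_inv (C i)) has_derivative ?Di) (at (snd (C i) p))"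
        using Ck_has_derivative[of 0, OF \<phi>_Ck[OF i C_atlas[OF i], unfolded One_nat_def]] True by blast
      from frechet_derivative_eqI[OF has_derivative_chart_change[OF C_atlas[OF k(1)] C_atlas[OF i] p True this]]
      have "?D i (C k) p v = ?Di (deriv (transition (C k) (C i)) (snd (C k) p) * v)"
        by (simp add: hol_transition_frechet[OF C_hol[OF k(1)] C_hol[OF i] p True])
      also have "deriv (transition (C k) (C i)) (snd (C k) p) * v = X i (snd (C i) p) / of_real (conf g (C i) p)"
        using compat[OF k(1) i p True] by (simp add: v_def)
      also have "\<dots> = (1 / conf g (C i) p) *\<^sub>R X i (snd (C i) p)" by (simp add: scaleR_conv_of_real)
      also have "?Di \<dots> = T i p"
        using True linear_scale[OF Dlin[OF i C_atlas[OF i] True]] C_atlas[OF i]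
        by (simp add: T_def t_def)
      finally show ?thesis by (rule sym)
    next
      case False
      then have "p \<notin> chart_inv (C i) ` K i"
        using compact_chart_set(3)[OF C_atlas[OF i] K_compact[OF i] K_sub[OF i]] by blast
      from \<phi>_locally_zero[OF i this C_atlas[OF k(1)] p] False show ?thesis by (simp add: T_def)
    qed
    then have "(\<Sum>i\<in>I. T i p) = (\<Sum>i\<in>I. ?D i (C k) p v)" by simp
    also have "\<dots> = frechet_derivative (\<lambda>z. \<Sum>i\<in>I. (\<phi> i \<circ> chart_inv (C k)) z) (at (snd (C k) p)) v"
    proof -
      have "((\<lambda>z. \<Sum>i\<in>I. (\<phi> i \<circ> chart_inv (C k)) z) has_derivative (\<lambda>v. \<Sum>i\<in>I. ?D i (C k) p v)) (at (snd (C k) p))"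
      proof (rule has_derivative_sum)
        show "((\<lambda>z. (\<phi> i \<circ> chart_inv (C k)) z) has_derivative (\<lambda>v. ?D i (C k) p v)) (at (snd (C k) p))"
          if i: "i \<in> I" for i
          using Ck_has_derivative[of 0, OF \<phi>_Ck[OF i C_atlas[OF k(1)], unfolded One_nat_def] imageI[OF p]] .
      qed
      from fun_cong[OF frechet_derivative_eqI[OF this]] show ?thesis by (rule sym)
    qed
    also have "\<dots> = 0" by (simp add: \<phi>_sum frechet_derivative_const)
    finally show ?thesis .
  qed
  have "(\<Sum>i\<in>I. (LINT p|dv. T i p)) = (LINT p|dv. (\<Sum>i\<in>I. T i p))"
    by (rule Bochner_Integration.integral_sum[symmetric]) (intro integrable_continuous cT)
  then have sumT: "(\<Sum>i\<in>I. (LINT p|dv. T i p)) = 0" by (simp add: T0)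
  have "(\<Sum>i\<in>I. (LINT p|dv. T i p)) + (\<Sum>i\<in>I. (LINT p|dv. W i p)) = (\<Sum>i\<in>I. 0)"
    unfolding sum.distrib[symmetric] by (rule sum.cong) (auto simp: TW)
  then have "0 = (\<Sum>i\<in>I. (LINT p|dv. W i p))" using sumT by simp
  also have "\<dots> = (LINT p|dv. (\<Sum>i\<in>I. W i p))"
    by (rule Bochner_Integration.integral_sum[symmetric]) (intro integrable_continuous cW)
  finally have sumW: "(LINT p|dv. (\<Sum>i\<in>I. W i p)) = 0" by simp
  have cs: "continuous_on UNIV (\<lambda>p. \<Sum>i\<in>I. W i p)" by (intro continuous_on_sum cW)
  \<comment> \<open>With the partition of unity inserted in front of \<open>r\<close>, the
    difference is an average, with weights \<open>\<phi> i p\<close>, of errors that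
    \<open>bound\<close> controls by \<open>e\<close>.\<close>
  have pw: "\<bar>r p - (\<Sum>i\<in>I. W i p)\<bar> \<le> e" for p
  proof -
    have "r p - (\<Sum>i\<in>I. W i p) = (\<Sum>i\<in>I. \<phi> i p * r p - W i p)"
      by (simp add: sum_subtractf \<phi>_sum flip: sum_distrib_right)
    also have "\<bar>\<dots>\<bar> \<le> (\<Sum>i\<in>I. \<phi> i p * e)"
    proof (rule order_trans[OF sum_abs sum_mono])
      fix i assume i: "i \<in> I"
      show "\<bar>\<phi> i p * r p - W i p\<bar> \<le> \<phi> i p * e"
      proof (cases "p \<in> chart_inv (C i) ` K i")
        case True
        then obtain z where z: "z \<in> K i" "p = chart_inv (C i) z" by blast
        then have zS: "z \<in> snd (C i) ` fst (C i)" using K_sub[OF i] by blast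
        have sz: "snd (C i) p = z" using z chart_chart_inv[OF C_atlas[OF i] zS] by simp
        have pf: "p \<in> fst (C i)" using z chart_inv_in[OF C_atlas[OF i] zS] by simp
        let ?s = "conf g (C i) p"
        have s: "?s > 0" by (rule conf_pos[OF C_atlas[OF i] pf])
        have "\<bar>r p - divergence (X i) z / ?s\<bar> = \<bar>divergence (X i) z - ?s * r p\<bar> / ?s"
        proof -
          have "r p - divergence (X i) z / ?s = - ((divergence (X i) z - ?s * r p) / ?s)"
            using s by (simp add: field_simps)
          then show ?thesis using s by (simp only: abs_minus abs_divide)
        qed
        also have "\<dots> \<le> e" using bound[OF i z(1)] s by (simp add: z(2)[symmetric] field_simps)
        finally have "\<bar>r p - divergence (X i) z / ?s\<bar> \<le> e" .
        moreover have "\<phi> i p * r p - W i p = \<phi> i p * (r p - divergence (X i) z / ?s)"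
          by (simp only: W_def w_def sz pf if_True o_apply right_diff_distrib times_divide_eq_right z(2)[symmetric])
        ultimately show ?thesis using \<phi>_nonneg[OF i, of p] by (simp add: abs_mult mult_left_mono)
      next
        case False
        then have z: "\<phi> i p = 0" by (rule \<phi>_supp[OF i])
        then have "W i p = 0" using C_atlas[OF i] by (auto simp: W_def w_def)
        then show ?thesis by (simp add: z)
      qed
    qed
    also have "\<dots> = e" by (simp add: \<phi>_sum flip: sum_distrib_right)
    finally show ?thesis .
  qed
  have "(LINT p|dv. r p) = (LINT p|dv. r p - (\<Sum>i\<in>I. W i p))"
    using Bochner_Integration.integral_diff[OF integrable_continuous[OF r] integrable_continuous[OF cs]] sumW by simp
  also have "\<bar>\<dots>\<bar> \<le> (LINT p|dv. \<bar>r p - (\<Sum>i\<in>I. W i p)\<bar>)"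
    using integral_norm_bound[of dv "\<lambda>p. r p - (\<Sum>i\<in>I. W i p)"] by simp
  also have "\<dots> \<le> (LINT p|dv. e)"
    by (intro integral_mono integrable_continuous continuous_intros r cs pw)
  also have "\<dots> = e * measure dv UNIV" by (simp add: space_dv)
  finally show ?thesis .
qed

end

section \<open>The energy and its variations\<close>

text \<open>In the plane \<open>y\<close> is \<open>x\<close> turned by a right angle, up to a sign
  \<open>t\<close>, so the products of \<open>D 1\<close> with \<open>D \<i>\<close> cancel. Lets
  the trace over an orthonormal pair from any chart be computed in a conformal one.\<close>

lemma trace_orthogonal:
  fixes D :: "complex \<Rightarrow> 'b::real_inner"
  assumes D: "linear D" and xy: "x \<bullet> x = s" "y \<bullet> y = s" "x \<bullet> y = 0" and s: "s > 0"
  shows "(norm (D x))\<^sup>2 + (norm (D y))\<^sup>2 = s * ((norm (D 1))\<^sup>2 + (norm (D \<i>))\<^sup>2)"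
proof -
  \<comment> \<open>The orientation of the pair, seen below to satisfy t^2 = 1.\<close>
  define t where "t = (Re x * Im y - Im x * Re y) / s"
  have xx: "Re x * Re x + Im x * Im x = s" and yy: "Re y * Re y + Im y * Im y = s"
    and xy0: "Re x * Re y + Im x * Im y = 0"
    using xy by (simp_all add: inner_complex_def)
  have "s * Re y = - Im x * (Re x * Im y - Im x * Re y)"
  proof -
    have "- Im x * (Re x * Im y - Im x * Re y) = - Re x * (Im x * Im y) + Im x * Im x * Re y"
      by (simp add: algebra_simps)
    also have "Im x * Im y = - Re x * Re y" using xy0 by simp
    finally show ?thesis by (simp add: xx[symmetric] algebra_simps)
  qed
  then have y1: "Re y = - Im x * t" using s by (simp add: t_def field_simps)
  have "s * Im y = Re x * (Re x * Im y - Im x * Re y)"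
  proof -
    have "Re x * (Re x * Im y - Im x * Re y) = Re x * Re x * Im y - Im x * (Re x * Re y)"
      by (simp add: algebra_simps)
    also have "Re x * Re y = - (Im x * Im y)" using xy0 by simp
    finally show ?thesis by (simp add: xx[symmetric] algebra_simps)
  qed
  then have y2: "Im y = Re x * t" using s by (simp add: t_def field_simps)
  have "s = t\<^sup>2 * (Re x * Re x + Im x * Im x)"
    using yy unfolding y1 y2 by (simp add: power2_eq_square algebra_simps)
  then have t: "t\<^sup>2 = 1" using s by (simp add: xx)
  let ?P = "D 1" and ?Q = "D \<i>"
  have n: "(norm (a *\<^sub>R ?P + b *\<^sub>R ?Q))\<^sup>2 = a * a * (norm ?P)\<^sup>2 + 2 * a * b * (?P \<bullet> ?Q) + b * b * (norm ?Q)\<^sup>2" for a b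
    by (simp add: power2_norm_eq_inner inner_add_left inner_add_right inner_commute[of ?Q ?P] algebra_simps)
  have "(norm (D x))\<^sup>2 + (norm (D y))\<^sup>2 =
     (Re x * Re x + t\<^sup>2 * (Im x * Im x)) * (norm ?P)\<^sup>2 + (2 * Re x * Im x - t\<^sup>2 * (2 * Re x * Im x)) * (?P \<bullet> ?Q)
       + (Im x * Im x + t\<^sup>2 * (Re x * Re x)) * (norm ?Q)\<^sup>2"
    unfolding linear_complex_Re_Im[OF D, of x] linear_complex_Re_Im[OF D, of y] n y1 y2
    by (simp add: power2_eq_square algebra_simps)
  also have "\<dots> = s * ((norm ?P)\<^sup>2 + (norm ?Q)\<^sup>2)"
    unfolding t by (simp add: xx[symmetric] algebra_simps)
  finally show ?thesis .
qed

text \<open>For a conformal chart this is the polarized Dirichlet density, the inner product of the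
  differentials with respect to \<open>g\<close>.\<close>

definition gradient_inner :: "('a::t2_space) surface_metric \<Rightarrow> 'a chart \<Rightarrow> ('a \<Rightarrow> 'b::real_inner) \<Rightarrow> ('a \<Rightarrow> 'b) \<Rightarrow> 'a \<Rightarrow> real" where
  "gradient_inner g c u w p =
    (frechet_derivative (u \<circ> chart_inv c) (at (snd c p)) 1 \<bullet> frechet_derivative (w \<circ> chart_inv c) (at (snd c p)) 1 +
     frechet_derivative (u \<circ> chart_inv c) (at (snd c p)) \<i> \<bullet> frechet_derivative (w \<circ> chart_inv c) (at (snd c p)) \<i>)
      / conf g c p"

context conformal_surface
begin

lemma frechet_chart_change:
  assumes c: "c \<in> hol_charts A g" "c' \<in> hol_charts A g" "p \<in> fst c" "p \<in> fst c'"
    and u: "(u \<circ> chart_inv c') differentiable (at (snd c' p))"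
  shows "frechet_derivative (u \<circ> chart_inv c) (at (snd c p)) v =
    Re (deriv (transition c c') (snd c p) * v) *\<^sub>R frechet_derivative (u \<circ> chart_inv c') (at (snd c' p)) 1 +
    Im (deriv (transition c c') (snd c p) * v) *\<^sub>R frechet_derivative (u \<circ> chart_inv c') (at (snd c' p)) \<i>"
proof -
  let ?D = "frechet_derivative (u \<circ> chart_inv c') (at (snd c' p))"
  have D: "((u \<circ> chart_inv c') has_derivative ?D) (at (snd c' p))"
    using u by (simp add: frechet_derivative_works)
  from frechet_derivative_eqI[OF has_derivative_chart_change[OF hol_in_atlas[OF c(1)] hol_in_atlas[OF c(2)] c(3,4) D]]
  have "frechet_derivative (u \<circ> chart_inv c) (at (snd c p)) v = ?D (deriv (transition c c') (snd c p) * v)"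
    by (simp add: hol_transition_frechet[OF c])
  also have "\<dots> = Re (deriv (transition c c') (snd c p) * v) *\<^sub>R ?D 1 + Im (deriv (transition c c') (snd c p) * v) *\<^sub>R ?D \<i>"
    by (rule linear_complex_Re_Im[OF has_derivative_linear[OF D]])
  finally show ?thesis .
qed

text \<open>A holomorphic coordinate change acts on tangent vectors by rotation and scaling, so
  numerator and conformal factor are both multiplied by |a|^2.\<close>

lemma gradient_inner_change:
  assumes c: "c \<in> hol_charts A g" "c' \<in> hol_charts A g" "p \<in> fst c" "p \<in> fst c'"
    and u: "(u \<circ> chart_inv c') differentiable (at (snd c' p))"
    and w: "(w \<circ> chart_inv c') differentiable (at (snd c' p))"
  shows "gradient_inner g c u w p = gradient_inner g c' u w p"
proof -
  define a where "a = deriv (transition c c') (snd c p)"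
  let ?P = "frechet_derivative (u \<circ> chart_inv c') (at (snd c' p)) 1" and ?Q = "frechet_derivative (u \<circ> chart_inv c') (at (snd c' p)) \<i>"
  let ?R = "frechet_derivative (w \<circ> chart_inv c') (at (snd c' p)) 1" and ?S = "frechet_derivative (w \<circ> chart_inv c') (at (snd c' p)) \<i>"
  have a0: "a \<noteq> 0" unfolding a_def by (rule hol_transition(3)[OF c])
  have s: "conf g c p = conf g c' p * (cmod a)\<^sup>2" unfolding a_def by (rule hol_transition(2)[OF c])
  have "(Re a *\<^sub>R ?P + Im a *\<^sub>R ?Q) \<bullet> (Re a *\<^sub>R ?R + Im a *\<^sub>R ?S) +
     ((- Im a) *\<^sub>R ?P + Re a *\<^sub>R ?Q) \<bullet> ((- Im a) *\<^sub>R ?R + Re a *\<^sub>R ?S) = (cmod a)\<^sup>2 * (?P \<bullet> ?R + ?Q \<bullet> ?S)"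
  proof -
    have cm: "(cmod a)\<^sup>2 = Re a * Re a + Im a * Im a"
      using cmod_power2[of a] by (simp only: power2_eq_square)
    show ?thesis unfolding cm by (simp add: inner_add_left inner_add_right algebra_simps)
  qed
  then show ?thesis
    unfolding gradient_inner_def frechet_chart_change[OF c u] frechet_chart_change[OF c w] a_def[symmetric] s
    using a0 by simp
qed

definition hol_chart_of :: "'a \<Rightarrow> 'a chart" where
  "hol_chart_of p = (SOME c. c \<in> hol_charts A g \<and> p \<in> fst c)"

lemma hol_chart_of: "hol_chart_of p \<in> hol_charts A g" "p \<in> fst (hol_chart_of p)"
proof -
  have "\<exists>c. c \<in> hol_charts A g \<and> p \<in> fst c" using hol_chart_at by blast
  from someI_ex[OF this] show "hol_chart_of p \<in> hol_charts A g" "p \<in> fst (hol_chart_of p)"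
    unfolding hol_chart_of_def by auto
qed

definition grad :: "('a \<Rightarrow> 'b::real_inner) \<Rightarrow> ('a \<Rightarrow> 'b) \<Rightarrow> 'a \<Rightarrow> real" where
  "grad u w p = gradient_inner g (hol_chart_of p) u w p"

definition C1 :: "('a \<Rightarrow> 'b::real_normed_vector) \<Rightarrow> bool" where
  "C1 u \<longleftrightarrow> (\<forall>c\<in>hol_charts A g. Ck 1 (snd c ` fst c) (u \<circ> chart_inv c))"

lemma C1_differentiable:
  "C1 u \<Longrightarrow> c \<in> hol_charts A g \<Longrightarrow> p \<in> fst c \<Longrightarrow> (u \<circ> chart_inv c) differentiable (at (snd c p))"
  unfolding C1_def One_nat_def by (blast intro: Ck_differentiable)

lemma C1_diff:
  assumes "C1 u" "C1 w"
  shows "C1 (\<lambda>p. u p - w p)"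
  unfolding C1_def
proof
  fix c assume c: "c \<in> hol_charts A g"
  note o = open_range[OF hol_in_atlas[OF c]]
  have "Ck 1 (snd c ` fst c) (\<lambda>z. (u \<circ> chart_inv c) z + - (w \<circ> chart_inv c) z)"
    by (intro Ck_add Ck_minus o) (use assms c in \<open>auto simp: C1_def simp del: One_nat_def o_apply\<close>)
  then show "Ck 1 (snd c ` fst c) ((\<lambda>p. u p - w p) \<circ> chart_inv c)" by (simp add: o_def del: Ck.simps)
qed

lemma grad_eq:
  assumes "C1 u" "C1 w" "c \<in> hol_charts A g" "p \<in> fst c"
  shows "grad u w p = gradient_inner g c u w p"
  unfolding grad_def
  by (rule gradient_inner_change[OF hol_chart_of(1) assms(3) hol_chart_of(2) assms(4)
        C1_differentiable[OF assms(1,3,4)] C1_differentiable[OF assms(2,3,4)]])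

lemma grad_diff:
  assumes "C1 u" "C1 w"
  shows "grad u u p - grad w w p = grad (\<lambda>p. u p - w p) (\<lambda>p. u p - w p) p + 2 * grad (\<lambda>p. u p - w p) w p"
proof -
  let ?c = "hol_chart_of p"
  have u: "((u \<circ> chart_inv ?c) has_derivative frechet_derivative (u \<circ> chart_inv ?c) (at (snd ?c p))) (at (snd ?c p))"
    and w: "((w \<circ> chart_inv ?c) has_derivative frechet_derivative (w \<circ> chart_inv ?c) (at (snd ?c p))) (at (snd ?c p))"
    using C1_differentiable[OF assms(1) hol_chart_of] C1_differentiable[OF assms(2) hol_chart_of]
    by (simp_all add: frechet_derivative_works)
  have "(\<lambda>p. u p - w p) \<circ> chart_inv ?c = (\<lambda>z. (u \<circ> chart_inv ?c) z - (w \<circ> chart_inv ?c) z)"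
    by (simp add: o_def)
  with frechet_derivative_eqI[OF has_derivative_diff[OF u w]]
  have d: "frechet_derivative ((\<lambda>p. u p - w p) \<circ> chart_inv ?c) (at (snd ?c p)) v =
     frechet_derivative (u \<circ> chart_inv ?c) (at (snd ?c p)) v - frechet_derivative (w \<circ> chart_inv ?c) (at (snd ?c p)) v" for v
    by simp
  show ?thesis
    unfolding grad_def gradient_inner_def d
    by (simp add: inner_diff_left inner_diff_right inner_commute add_divide_distrib diff_divide_distrib)
qed

lemma local_lift_projline:
  assumes c: "c \<in> A" and F: "local_lift c p \<Psi> F"
  shows "\<exists>W. open W \<and> snd c p \<in> W \<and> W \<subseteq> snd c ` fst c \<and> (\<forall>n. Ck n W (projline \<circ> \<Psi> \<circ> chart_inv c)) \<and>
      (\<forall>z\<in>W. (projline \<circ> \<Psi> \<circ> chart_inv c) z = projmat (F z)) \<and> F (snd c p) \<noteq> 0 \<and> F differentiable (at (snd c p))"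
proof -
  obtain W where W: "open W" "snd c p \<in> W" "W \<subseteq> snd c ` fst c" "smooth_on W F"
    "\<And>z. z \<in> W \<Longrightarrow> F z \<noteq> 0 \<and> \<Psi> (chart_inv c z) = hcoord (F z)"
    using F unfolding local_lift_def by blast
  have eq: "(projline \<circ> \<Psi> \<circ> chart_inv c) z = projmat (F z)" if "z \<in> W" for z
    using W(5)[OF that] by (simp add: projline_hcoord)
  have "Ck n W (projline \<circ> \<Psi> \<circ> chart_inv c)" for n
  proof (rule Ck_transform[OF W(1)])
    show "Ck n W (\<lambda>z. projmat (F z))"
      by (rule Ck_projmat[OF W(1) smooth_on_Ck[OF W(4)]]) (use W(5) in blast)
    show "projmat (F z) = (projline \<circ> \<Psi> \<circ> chart_inv c) z" if "z \<in> W" for z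
      by (rule eq[OF that, symmetric])
  qed
  moreover have "F differentiable (at (snd c p))"
    by (rule Ck_differentiable[OF smooth_on_Ck[OF W(4)] W(2)])
  ultimately show ?thesis using W(1,2,3) W(5)[OF W(2)] eq by blast
qed

text \<open>Smoothness provides a lift in some chart around each point. Projections do not depend on
  the lift, and the transition carries their regularity to any other chart.\<close>

lemma smooth_map_Ck:
  assumes \<Psi>: "smooth_map A \<Psi>" and c: "c \<in> A"
  shows "Ck n (snd c ` fst c) (projline \<circ> \<Psi> \<circ> chart_inv c)"
proof (rule Ck_local)
  fix z assume "z \<in> snd c ` fst c"
  then obtain p where p: "p \<in> fst c" "z = snd c p" by blast
  obtain c' F where c': "c' \<in> A" and F: "local_lift c' p \<Psi> F" using \<Psi> unfolding smooth_map_def by blast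
  have pc': "p \<in> fst c'" using F by (simp add: local_lift_def)
  obtain W where W: "open W" "snd c' p \<in> W" "W \<subseteq> snd c' ` fst c'" "\<And>n. Ck n W (projline \<circ> \<Psi> \<circ> chart_inv c')"
    using local_lift_projline[OF c' F] by blast
  let ?S = "snd c ` (fst c \<inter> fst c')"
  have S: "open ?S" by (rule open_chart_image[OF c open_domain[OF c']])
  have sm: "smooth_on ?S (transition c c')"
    using atlas c c' by (simp add: oriented_smooth_structure_def oriented_compatible_def)
  have ct: "continuous_on ?S (transition c c')" using smooth_on_Ck[OF sm, of 0] by simp
  let ?T = "?S \<inter> transition c c' -` W"
  have T: "open ?T" by (rule continuous_open_preimage[OF ct S W(1)])
  have "Ck n ?T (\<lambda>w. (projline \<circ> \<Psi> \<circ> chart_inv c') (transition c c' w))"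
    by (rule Ck_compose[OF T W(1) _ Ck_subset[OF smooth_on_Ck[OF sm]] W(4)]) auto
  then have "Ck n ?T (projline \<circ> \<Psi> \<circ> chart_inv c)"
  proof (rule Ck_transform[OF T])
    show "(projline \<circ> \<Psi> \<circ> chart_inv c') (transition c c' w) = (projline \<circ> \<Psi> \<circ> chart_inv c) w" if "w \<in> ?T" for w
      using that by (intro chart_change[OF c c']) blast
  qed
  moreover have "z \<in> ?T" using p pc' W(2) transition_chart[OF c p(1)] by simp
  ultimately show "\<exists>T. open T \<and> z \<in> T \<and> Ck n T (projline \<circ> \<Psi> \<circ> chart_inv c)" using T by blast
qed

lemma smooth_map_C1: "smooth_map A \<Psi> \<Longrightarrow> C1 (projline \<circ> \<Psi>)"
  unfolding C1_def by (intro ballI smooth_map_Ck hol_in_atlas)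

text \<open>The description in \<open>energy_density\<close> ranges over all charts, lifts and
  orthonormal pairs; \<open>val\<close> moves the pair to a conformal chart and finds the same value
  each time. The factor k / 2 stems from \<open>fubini_study_sq_projmat\<close>.\<close>

lemma energy_density_eq:
  assumes \<Psi>: "smooth_map A \<Psi>"
  shows "energy_density A g k \<Psi> p = k / 2 * grad (projline \<circ> \<Psi>) (projline \<circ> \<Psi>) p"
proof -
  let ?u = "projline \<circ> \<Psi>" and ?h = "hol_chart_of p"
  let ?D = "frechet_derivative (?u \<circ> chart_inv ?h) (at (snd ?h p))"
  note h = hol_chart_of[of p] and hA = hol_in_atlas[OF hol_chart_of(1)[of p]]
  have D: "((?u \<circ> chart_inv ?h) has_derivative ?D) (at (snd ?h p))"
    using C1_differentiable[OF smooth_map_C1[OF \<Psi>] h] by (simp add: frechet_derivative_works)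
  have val: "k * fubini_study_sq (F (snd c p)) (frechet_derivative F (at (snd c p)) v) +
      k * fubini_study_sq (F (snd c p)) (frechet_derivative F (at (snd c p)) w) = k / 2 * grad ?u ?u p"
    if c: "c \<in> A" and F: "local_lift c p \<Psi> F" and on: "g c p v v = 1" "g c p w w = 1" "g c p v w = 0" for c F v w
  proof -
    have pc: "p \<in> fst c" using F by (simp add: local_lift_def)
    obtain W where W: "open W" "snd c p \<in> W" "\<And>z. z \<in> W \<Longrightarrow> (?u \<circ> chart_inv c) z = projmat (F z)"
      "F (snd c p) \<noteq> 0" "F differentiable (at (snd c p))"
      using local_lift_projline[OF c F] by blast
    let ?L = "frechet_derivative (transition c ?h) (at (snd c p))"
    have FS: "2 * fubini_study_sq (F (snd c p)) (frechet_derivative F (at (snd c p)) x) = (norm (?D (?L x)))\<^sup>2" for x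
    proof -
      have "(F has_derivative frechet_derivative F (at (snd c p))) (at (snd c p))"
        using W(5) by (simp add: frechet_derivative_works)
      from fubini_study_sq_projmat[OF this W(4)]
      have "2 * fubini_study_sq (F (snd c p)) (frechet_derivative F (at (snd c p)) x) =
        (norm (frechet_derivative (\<lambda>z. projmat (F z)) (at (snd c p)) x))\<^sup>2" .
      also have "frechet_derivative (\<lambda>z. projmat (F z)) (at (snd c p)) = frechet_derivative (?u \<circ> chart_inv c) (at (snd c p))"
        by (rule frechet_derivative_cong_open[OF W(1,2)]) (rule W(3)[symmetric])
      also have "\<dots> = (\<lambda>x. ?D (?L x))"
        by (rule frechet_derivative_eqI[OF has_derivative_chart_change[OF c hA pc h(2) D]])
      finally show ?thesis .
    qed
    have s: "conf g ?h p > 0" by (rule conf_pos[OF hA h(2)])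
    have g: "g c p x y = conf g ?h p * (?L x \<bullet> ?L y)" for x y
      using metric_change[OF c hA pc h(2)] metric_conf[OF h] by simp
    have "(norm (?D (?L v)))\<^sup>2 + (norm (?D (?L w)))\<^sup>2 = (1 / conf g ?h p) * ((norm (?D 1))\<^sup>2 + (norm (?D \<i>))\<^sup>2)"
      using on s by (intro trace_orthogonal[OF has_derivative_linear[OF D]]) (simp_all add: g field_simps)
    also have "\<dots> = grad ?u ?u p"
      by (simp add: grad_def gradient_inner_def power2_norm_eq_inner)
    finally have fin: "2 * fubini_study_sq (F (snd c p)) (frechet_derivative F (at (snd c p)) v) +
        2 * fubini_study_sq (F (snd c p)) (frechet_derivative F (at (snd c p)) w) = grad ?u ?u p"
      by (simp only: FS)
    show ?thesis unfolding fin[symmetric] by (simp add: algebra_simps)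
  qed
  show ?thesis
    unfolding energy_density_def Let_def
  proof (rule the_equality)
    show "\<forall>c\<in>A. \<forall>F v w. local_lift c p \<Psi> F \<and> g c p v v = 1 \<and> g c p w w = 1 \<and> g c p v w = 0 \<longrightarrow>
      k / 2 * grad ?u ?u p = k * fubini_study_sq (F (snd c p)) (frechet_derivative F (at (snd c p)) v) +
        k * fubini_study_sq (F (snd c p)) (frechet_derivative F (at (snd c p)) w)"
    proof (intro ballI allI impI, elim conjE)
      fix c F v w assume "c \<in> A" "local_lift c p \<Psi> F" "g c p v v = 1" "g c p w w = 1" "g c p v w = 0"
      from val[OF this] show "k / 2 * grad ?u ?u p = k * fubini_study_sq (F (snd c p)) (frechet_derivative F (at (snd c p)) v) +
        k * fubini_study_sq (F (snd c p)) (frechet_derivative F (at (snd c p)) w)" by (rule sym)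
    qed
  next
    fix x
    assume x: "\<forall>c\<in>A. \<forall>F v w. local_lift c p \<Psi> F \<and> g c p v v = 1 \<and> g c p w w = 1 \<and> g c p v w = 0 \<longrightarrow>
      x = k * fubini_study_sq (F (snd c p)) (frechet_derivative F (at (snd c p)) v) +
        k * fubini_study_sq (F (snd c p)) (frechet_derivative F (at (snd c p)) w)"
    obtain c F where c: "c \<in> A" and F: "local_lift c p \<Psi> F" using \<Psi> unfolding smooth_map_def by blast
    have pc: "p \<in> fst c" using F by (simp add: local_lift_def)
    \<comment> \<open>For uniqueness at least one orthonormal pair is needed in a chart that has a
      lift: the normalized coordinate vectors of the conformal chart are transported there.\<close>
    let ?M = "frechet_derivative (transition ?h c) (at (snd ?h p))"
    let ?s = "1 / sqrt (conf g ?h p)"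
    have s: "conf g ?h p > 0" by (rule conf_pos[OF hA h(2)])
    have gM: "g c p (?M y) (?M z) = conf g ?h p * (y \<bullet> z)" for y z
      using metric_change[OF hA c h(2) pc, of y z] metric_conf[OF h, of y z] by simp
    have on: "g c p (?M (?s *\<^sub>R 1)) (?M (?s *\<^sub>R 1)) = 1" "g c p (?M (?s *\<^sub>R \<i>)) (?M (?s *\<^sub>R \<i>)) = 1"
       "g c p (?M (?s *\<^sub>R 1)) (?M (?s *\<^sub>R \<i>)) = 0"
      unfolding gM using s by (simp_all add: inner_complex_def)
    show "x = k / 2 * grad ?u ?u p"
      using x[rule_format, OF c conjI[OF F conjI[OF on(1) conjI[OF on(2,3)]]]] val[OF c F on] by simp
  qed
qed

end

context compact_surface
begin

lemma continuous_grad: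
  fixes u w :: "'a \<Rightarrow> 'b::real_inner"
  assumes "C1 u" "C1 w"
  shows "continuous_on UNIV (grad u w)"
proof (rule continuous_from_charts)
  fix p
  obtain c where c: "c \<in> hol_charts A g" "p \<in> fst c" using hol_chart_at by blast
  note cA = hol_in_atlas[OF c(1)]
  let ?S = "snd c ` fst c"
  have cu: "continuous_on ?S (\<lambda>z. frechet_derivative (u \<circ> chart_inv c) (at z) v)"
    and cw: "continuous_on ?S (\<lambda>z. frechet_derivative (w \<circ> chart_inv c) (at z) v)" for v
    using assms c(1) by (auto simp: C1_def)
  have "continuous_on ?S (\<lambda>z. (frechet_derivative (u \<circ> chart_inv c) (at z) 1 \<bullet> frechet_derivative (w \<circ> chart_inv c) (at z) 1 +
     frechet_derivative (u \<circ> chart_inv c) (at z) \<i> \<bullet> frechet_derivative (w \<circ> chart_inv c) (at z) \<i>)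
      / conf g c (chart_inv c z))"
  proof (intro continuous_on_divide continuous_on_add continuous_on_inner cu cw continuous_conf[OF cA] ballI)
    show "conf g c (chart_inv c z) \<noteq> 0" if "z \<in> ?S" for z
      using conf_pos[OF cA chart_inv_in[OF cA that]] by simp
  qed
  then have "continuous_on ?S (grad u w \<circ> chart_inv c)"
  proof (rule continuous_on_eq)
    fix z assume "z \<in> ?S"
    then obtain q where q: "q \<in> fst c" "z = snd c q" by blast
    show "(frechet_derivative (u \<circ> chart_inv c) (at z) 1 \<bullet> frechet_derivative (w \<circ> chart_inv c) (at z) 1 +
     frechet_derivative (u \<circ> chart_inv c) (at z) \<i> \<bullet> frechet_derivative (w \<circ> chart_inv c) (at z) \<i>)
      / conf g c (chart_inv c z) = (grad u w \<circ> chart_inv c) z"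
      using grad_eq[OF assms c(1) q(1)] cA q by (simp add: gradient_inner_def)
  qed
  then have "isCont (grad u w \<circ> chart_inv c) (snd c p)"
    using c(2) open_range[OF cA] continuous_on_eq_continuous_at by blast
  then show "\<exists>c\<in>A. p \<in> fst c \<and> isCont (grad u w \<circ> chart_inv c) (snd c p)"
    using c(2) cA by blast
qed

end

section \<open>Estimates along a variation\<close>

lemma Ck_lipschitz_parameter:
  fixes f :: "'a::euclidean_space \<times> real \<Rightarrow> 'b::real_normed_vector"
  assumes W: "open W" "(z0, 0) \<in> W" and f: "Ck 1 W f"
  shows "\<exists>r>0. \<exists>C. \<forall>z\<in>ball z0 r. \<forall>t. \<bar>t\<bar> < r \<longrightarrow> norm (f (z, t) - f (z, 0)) \<le> C * \<bar>t\<bar>"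
proof -
  let ?d = "\<lambda>x. frechet_derivative f (at x) (0, 1)"
  have "continuous_on W ?d" using f by simp
  then have "isCont ?d (z0, 0)" using W continuous_on_eq_continuous_at by blast
  then obtain e where e: "e > 0" "\<And>x. dist x (z0, 0) < e \<Longrightarrow> dist (?d x) (?d (z0, 0)) < 1"
    unfolding continuous_at_eps_delta by (metis zero_less_one)
  obtain e' where e': "e' > 0" "ball (z0, 0) e' \<subseteq> W" using W openE by blast
  \<comment> \<open>Half, because the distance in the product is bounded by the sum of the distances
    in \<open>z\<close> and in \<open>t\<close>.\<close>
  define r where "r = min e e' / 2"
  have r: "r > 0" using e e' by (simp add: r_def)
  have near: "dist (z, t) (z0, 0) < min e e'" if "z \<in> ball z0 r" "\<bar>t\<bar> < r" for z t
  proof -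
    have "dist (z, t) (z0, 0) \<le> dist z z0 + \<bar>t\<bar>"
      using sqrt_sum_squares_le_sum_abs[of "dist z z0" t] by (simp add: dist_Pair_Pair)
    also have "\<dots> < min e e'" using that by (simp add: r_def dist_commute)
    finally show ?thesis .
  qed
  let ?C = "norm (?d (z0, 0)) + 1"
  have "norm (f (z, t) - f (z, 0)) \<le> ?C * \<bar>t\<bar>" if z: "z \<in> ball z0 r" and t: "\<bar>t\<bar> < r" for z t
  proof -
    have D: "((\<lambda>s. f (z, s)) has_derivative (\<lambda>h. h *\<^sub>R ?d (z, s))) (at s within {-r<..<r})" if "s \<in> {-r<..<r}" for s
    proof -
      have s: "\<bar>s\<bar> < r" using that by auto
      have zs: "(z, s) \<in> W" using near[OF z s] e' by (auto simp: dist_commute)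
      have df: "(f has_derivative frechet_derivative f (at (z, s))) (at (z, s))"
        by (rule Ck_has_derivative[of 0, OF f[unfolded One_nat_def] zs])
      have eq: "(\<lambda>h. frechet_derivative f (at (z, s)) (0, h)) = (\<lambda>h. h *\<^sub>R ?d (z, s))"
      proof
        show "frechet_derivative f (at (z, s)) (0, h) = h *\<^sub>R ?d (z, s)" for h
          using linear_scale[OF has_derivative_linear[OF df], of h "(0, 1)"] by simp
      qed
      show ?thesis
        unfolding eq[symmetric]
        by (rule has_derivative_compose[where g=f and f="\<lambda>s. (z, s)", OF _ df]) (auto intro!: derivative_eq_intros)
    qed
    have B: "onorm (\<lambda>h. h *\<^sub>R ?d (z, s)) \<le> ?C" if "s \<in> {-r<..<r}" for s
    proof (rule onorm_le)
      have s: "\<bar>s\<bar> < r" using that by auto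
      have "dist (?d (z, s)) (?d (z0, 0)) < 1" using near[OF z s] by (intro e) simp
      then have b: "norm (?d (z, s)) \<le> ?C"
        using norm_triangle_sub[of "?d (z, s)" "?d (z0, 0)"] by (simp add: dist_norm)
      show "norm (h *\<^sub>R ?d (z, s)) \<le> ?C * norm h" for h
        using mult_right_mono[OF b abs_ge_zero[of h]] by (simp add: mult.commute)
    qed
    have "norm ((\<lambda>s. f (z, s)) t - (\<lambda>s. f (z, s)) 0) \<le> ?C * norm (t - 0)"
      by (rule differentiable_bound[OF _ D B]) (use t r in auto)
    then show ?thesis by simp
  qed
  then show ?thesis using r by blast
qed

text \<open>A finite subcover allows the smallest radius and the largest constant.\<close>

lemma compact_uniform_parameter:
  fixes h :: "'a::metric_space \<Rightarrow> real \<Rightarrow> real"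
  assumes K: "compact K" and loc: "\<And>z0. z0 \<in> K \<Longrightarrow> \<exists>r>0. \<exists>C. \<forall>z\<in>ball z0 r. \<forall>t. \<bar>t\<bar> < r \<longrightarrow> h z t \<le> C * \<bar>t\<bar>"
  shows "\<exists>r>0. \<exists>C\<ge>0. \<forall>z\<in>K. \<forall>t. \<bar>t\<bar> < r \<longrightarrow> h z t \<le> C * \<bar>t\<bar>"
proof -
  obtain r C where rC: "\<And>z0. z0 \<in> K \<Longrightarrow> r z0 > 0"
    "\<And>z0 z t. z0 \<in> K \<Longrightarrow> z \<in> ball z0 (r z0) \<Longrightarrow> \<bar>t\<bar> < r z0 \<Longrightarrow> h z t \<le> C z0 * \<bar>t\<bar>"
    using loc by metis
  have cov: "K \<subseteq> (\<Union>z\<in>K. ball z (r z))" using rC(1) centre_in_ball by blast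
  obtain F where F: "F \<subseteq> K" "finite F" "K \<subseteq> (\<Union>z\<in>F. ball z (r z))"
    by (rule compactE_image[OF K _ cov]) (rule open_ball, rule that)
  \<comment> \<open>The inserted 1 here and 0 below cover an empty \<open>F\<close>; the 0 also
    makes \<open>B\<close> nonnegative.\<close>
  define R where "R = Min (insert 1 (r ` F))"
  define B where "B = Max (insert 0 (C ` F))"
  have "R > 0" using F rC(1) by (auto simp: R_def)
  moreover have "B \<ge> 0" using F by (simp add: B_def)
  moreover have "h z t \<le> B * \<bar>t\<bar>" if z: "z \<in> K" and t: "\<bar>t\<bar> < R" for z t
  proof -
    obtain z0 where z0: "z0 \<in> F" "z \<in> ball z0 (r z0)" using F z by blast
    have "\<bar>t\<bar> < r z0" using t z0 F by (simp add: R_def)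
    then have "h z t \<le> C z0 * \<bar>t\<bar>" using rC(2) z0 F by blast
    also have "\<dots> \<le> B * \<bar>t\<bar>" using z0 F by (intro mult_right_mono) (auto simp: B_def)
    finally show ?thesis .
  qed
  ultimately show ?thesis by blast
qed

context conformal_surface
begin

lemma smooth_variation_smooth_map:
  assumes V: "smooth_variation A \<Psi> V"
  shows "\<exists>\<epsilon>>0. \<forall>t. \<bar>t\<bar> < \<epsilon> \<longrightarrow> smooth_map A (V t)"
proof -
  obtain \<epsilon> where \<epsilon>: "\<epsilon> > 0" "\<And>p t. \<bar>t\<bar> < \<epsilon> \<Longrightarrow> \<exists>c\<in>A. p \<in> fst c \<and>
          (\<exists>W F. open W \<and> (snd c p, t) \<in> W \<and> W \<subseteq> (snd c ` fst c) \<times> UNIV \<and> smooth_on W F \<and>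
            (\<forall>(z, s)\<in>W. F (z, s) \<noteq> 0 \<and> V s (chart_inv c z) = hcoord (F (z, s))))"
    using V unfolding smooth_variation_def by blast
  have "smooth_map A (V t)" if t: "\<bar>t\<bar> < \<epsilon>" for t
    unfolding smooth_map_def
  proof
    fix p
    obtain c W F where c: "c \<in> A" "p \<in> fst c" and W: "open W" "(snd c p, t) \<in> W" "W \<subseteq> (snd c ` fst c) \<times> UNIV"
      and F: "smooth_on W F" "\<forall>(z, s)\<in>W. F (z, s) \<noteq> 0 \<and> V s (chart_inv c z) = hcoord (F (z, s))"
      using \<epsilon>(2)[OF t, of p] by blast
    let ?T = "(\<lambda>z. (z, t)) -` W"
    have T: "open ?T"
      by (intro open_vimage W(1) continuous_on_Pair continuous_on_id continuous_on_const)
    have "Ck n ?T (\<lambda>z. F (z, t))" for n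
      by (rule Ck_compose[OF T W(1) _ Ck_slice smooth_on_Ck[OF F(1)]]) auto
    then have "smooth_on ?T (\<lambda>z. F (z, t))" by (simp add: smooth_on_def)
    then have "local_lift c p (V t) (\<lambda>z. F (z, t))"
      unfolding local_lift_def using c W F(2) T by (intro conjI exI[of _ ?T]) auto
    then show "\<exists>c\<in>A. \<exists>F. local_lift c p (V t) F" using c by blast
  qed
  then show ?thesis using \<epsilon>(1) by blast
qed

text \<open>A variation has joint lifts in charts of its own choice. Projections remove the lift,
  and the transition, extended by the identity in \<open>t\<close>, moves the family to the given
  chart.\<close>

lemma smooth_variation_chart:
  assumes V: "smooth_variation A \<Psi> V" and c: "c \<in> A" and z0: "z0 \<in> snd c ` fst c"
  shows "\<exists>W H. open W \<and> (z0, 0) \<in> W \<and> (\<forall>n. Ck n W H) \<and>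
    (\<forall>(z, t)\<in>W. (projline \<circ> V t \<circ> chart_inv c) z = H (z, t))"
proof -
  obtain p where p: "p \<in> fst c" "z0 = snd c p" using z0 by blast
  obtain \<epsilon> where \<epsilon>: "\<epsilon> > 0" "\<And>p t. \<bar>t\<bar> < \<epsilon> \<Longrightarrow> \<exists>c\<in>A. p \<in> fst c \<and>
          (\<exists>W F. open W \<and> (snd c p, t) \<in> W \<and> W \<subseteq> (snd c ` fst c) \<times> UNIV \<and> smooth_on W F \<and>
            (\<forall>(z, s)\<in>W. F (z, s) \<noteq> 0 \<and> V s (chart_inv c z) = hcoord (F (z, s))))"
    using V unfolding smooth_variation_def by blast
  have "\<bar>0 :: real\<bar> < \<epsilon>" using \<epsilon>(1) by simp
  from \<epsilon>(2)[OF this, of p] obtain c' W F where c': "c' \<in> A" "p \<in> fst c'" and W: "open W" "(snd c' p, 0) \<in> W"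
      and F: "smooth_on W F" "\<forall>(z, s)\<in>W. F (z, s) \<noteq> 0 \<and> V s (chart_inv c' z) = hcoord (F (z, s))"
    by blast
  let ?S = "snd c ` (fst c \<inter> fst c')"
  have S: "open ?S" by (rule open_chart_image[OF c open_domain[OF c'(1)]])
  have sm: "smooth_on ?S (transition c c')"
    using atlas c c' by (simp add: oriented_smooth_structure_def oriented_compatible_def)
  let ?j = "\<lambda>x. (transition c c' (fst x), snd x :: real)"
  have SU: "open (?S \<times> (UNIV :: real set))" using S by (intro open_Times) auto
  have Cj: "Ck n (?S \<times> UNIV) ?j" for n
  proof (rule Ck_Pair[OF SU])
    show "Ck n (?S \<times> UNIV) (\<lambda>x :: complex \<times> real. transition c c' (fst x))"
      by (rule Ck_compose[OF SU S _ _ smooth_on_Ck[OF sm]])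
        (auto intro: Ck_bounded_linear[OF SU bounded_linear_fst Ck_ident] simp del: Ck.simps)
    show "Ck n (?S \<times> UNIV) (\<lambda>x :: complex \<times> real. snd x)"
      by (rule Ck_bounded_linear[OF SU bounded_linear_snd Ck_ident])
  qed
  let ?W = "(?S \<times> UNIV) \<inter> ?j -` W"
  have cj: "continuous_on (?S \<times> UNIV) ?j" using Cj[of 0] by simp
  have oW: "open ?W" by (rule continuous_open_preimage[OF cj SU W(1)])
  have CF: "Ck n W (\<lambda>x. projmat (F x))" for n
    by (rule Ck_projmat[OF W(1) smooth_on_Ck[OF F(1)]]) (use F(2) in auto)
  have CH: "Ck n ?W (\<lambda>x. projmat (F (?j x)))" for n
    by (rule Ck_compose[OF oW W(1) _ Ck_subset[OF Cj] CF]) auto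
  have eq: "(projline \<circ> V t \<circ> chart_inv c) z = projmat (F (?j (z, t)))" if "(z, t) \<in> ?W" for z t
  proof -
    have z: "z \<in> ?S" and jW: "(transition c c' z, t) \<in> W" using that by auto
    have "(projline \<circ> V t \<circ> chart_inv c) z = (projline \<circ> V t \<circ> chart_inv c') (transition c c' z)"
      by (rule chart_change[OF c c'(1) z, symmetric])
    also have "\<dots> = projmat (F (transition c c' z, t))"
      using F(2) jW by (auto simp: projline_hcoord)
    finally show ?thesis by simp
  qed
  have "(z0, 0) \<in> ?W" using p c'(2) W(2) transition_chart[OF c p(1)] by simp
  then show ?thesis using oW CH eq by (intro exI[of _ ?W] exI[of _ "\<lambda>x. projmat (F (?j x))"]) blast
qed

text \<open>The family and its first derivatives along the surface are all of class C^1 in z and t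
  jointly, hence locally Lipschitz in \<open>t\<close>; compactness of \<open>K\<close> makes the
  constants uniform.\<close>

lemma smooth_variation_estimate:
  assumes V: "smooth_variation A \<Psi> V" and c: "c \<in> A" and K: "compact K" "K \<subseteq> snd c ` fst c"
  defines "u \<equiv> \<lambda>t. projline \<circ> V t \<circ> chart_inv c"
  shows "\<exists>r>0. \<exists>B\<ge>0. \<forall>z\<in>K. \<forall>t. \<bar>t\<bar> < r \<longrightarrow> norm (u t z - u 0 z) +
      norm (frechet_derivative (u t) (at z) 1 - frechet_derivative (u 0) (at z) 1) +
      norm (frechet_derivative (u t) (at z) \<i> - frechet_derivative (u 0) (at z) \<i>) \<le> B * \<bar>t\<bar>"
proof (rule compact_uniform_parameter[OF K(1)])
  fix z0 assume "z0 \<in> K"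
  then have z0: "z0 \<in> snd c ` fst c" using K(2) by blast
  obtain W H where W: "open W" "(z0, 0) \<in> W" and H: "\<And>n. Ck n W H"
    and eq: "\<And>z t. (z, t) \<in> W \<Longrightarrow> u t z = H (z, t)"
    using smooth_variation_chart[OF V c z0] unfolding u_def by blast
  have du: "frechet_derivative (u t) (at z) v = frechet_derivative H (at (z, t)) (v, 0)" if zt: "(z, t) \<in> W" for z t v
  proof -
    have DH: "(H has_derivative frechet_derivative H (at (z, t))) (at (z, t))"
      by (rule Ck_has_derivative[OF H zt])
    have "((\<lambda>z. H (z, t)) has_derivative (\<lambda>v. frechet_derivative H (at (z, t)) (v, 0))) (at z)"
      by (rule has_derivative_compose[where g=H and f="\<lambda>z. (z, t)", OF _ DH]) (auto intro!: derivative_eq_intros)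
    moreover have T: "open ((\<lambda>z. (z, t)) -` W)"
      by (intro open_vimage W(1) continuous_on_Pair continuous_on_id continuous_on_const)
    ultimately have "(u t has_derivative (\<lambda>v. frechet_derivative H (at (z, t)) (v, 0))) (at z)"
    proof (rule has_derivative_transform_within_open)
      show "z \<in> (\<lambda>z. (z, t)) -` W" using zt by simp
      show "H (y, t) = u t y" if "y \<in> (\<lambda>z. (z, t)) -` W" for y using eq[of y t] that by simp
    qed
    then show ?thesis by (simp add: frechet_derivative_eqI)
  qed
  have CH1: "Ck 1 W (\<lambda>x. frechet_derivative H (at x) v)" for v
    by (rule Ck_frechet[OF H])
  obtain r0 B0 where 0: "r0 > 0" "\<forall>z\<in>ball z0 r0. \<forall>t. \<bar>t\<bar> < r0 \<longrightarrow>
      norm (H (z, t) - H (z, 0)) \<le> B0 * \<bar>t\<bar>"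
    using Ck_lipschitz_parameter[OF W H[of 1]] by (elim exE conjE) (rule that)
  obtain r1 B1 where 1: "r1 > 0" "\<forall>z\<in>ball z0 r1. \<forall>t. \<bar>t\<bar> < r1 \<longrightarrow>
      norm (frechet_derivative H (at (z, t)) (1, 0) - frechet_derivative H (at (z, 0)) (1, 0)) \<le> B1 * \<bar>t\<bar>"
    using Ck_lipschitz_parameter[OF W CH1[of "(1, 0)"]] by (elim exE conjE) (rule that)
  obtain r2 B2 where 2: "r2 > 0" "\<forall>z\<in>ball z0 r2. \<forall>t. \<bar>t\<bar> < r2 \<longrightarrow>
      norm (frechet_derivative H (at (z, t)) (\<i>, 0) - frechet_derivative H (at (z, 0)) (\<i>, 0)) \<le> B2 * \<bar>t\<bar>"
    using Ck_lipschitz_parameter[OF W CH1[of "(\<i>, 0)"]] by (elim exE conjE) (rule that)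
  \<comment> \<open>A product neighbourhood, so that (z, t) and (z, 0) lie in \<open>W\<close>
    together.\<close>
  obtain U J where UJ: "open U" "open J" "(z0, 0 :: real) \<in> U \<times> J" "U \<times> J \<subseteq> W"
    by (rule open_prod_elim[OF W])
  have "z0 \<in> U" "0 \<in> J" using UJ(3) by auto
  obtain r3 where 3: "r3 > 0" "ball z0 r3 \<subseteq> U" by (rule openE[OF UJ(1) \<open>z0 \<in> U\<close>])
  obtain r4 where 4: "r4 > 0" "ball 0 r4 \<subseteq> J" by (rule openE[OF UJ(2) \<open>0 \<in> J\<close>])
  define r where "r = min (min r0 r1) (min r2 (min r3 r4))"
  have "r > 0" using 0 1 2 3 4 by (simp add: r_def)
  moreover have "norm (u t z - u 0 z) +
      norm (frechet_derivative (u t) (at z) 1 - frechet_derivative (u 0) (at z) 1) +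
      norm (frechet_derivative (u t) (at z) \<i> - frechet_derivative (u 0) (at z) \<i>) \<le> (B0 + B1 + B2) * \<bar>t\<bar>"
    if z: "z \<in> ball z0 r" and t: "\<bar>t\<bar> < r" for z t
  proof -
    have "z \<in> U" using z 3 by (auto simp: r_def)
    moreover have "t \<in> J" "0 \<in> J" using t 4 by (auto simp: r_def subset_iff)
    ultimately have zt: "(z, t) \<in> W" "(z, 0) \<in> W" using UJ(4) by blast+
    have "norm (H (z, t) - H (z, 0)) \<le> B0 * \<bar>t\<bar>" using z t by (intro 0(2)[rule_format]) (auto simp: r_def)
    moreover have "norm (frechet_derivative H (at (z, t)) (1, 0) - frechet_derivative H (at (z, 0)) (1, 0)) \<le> B1 * \<bar>t\<bar>"
      using z t by (intro 1(2)[rule_format]) (auto simp: r_def)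
    moreover have "norm (frechet_derivative H (at (z, t)) (\<i>, 0) - frechet_derivative H (at (z, 0)) (\<i>, 0)) \<le> B2 * \<bar>t\<bar>"
      using z t by (intro 2(2)[rule_format]) (auto simp: r_def)
    ultimately show ?thesis
      unfolding eq[OF zt(1)] eq[OF zt(2)] du[OF zt(1)] du[OF zt(2)] by (simp add: algebra_simps)
  qed
  ultimately show "\<exists>r>0. \<exists>C. \<forall>z\<in>ball z0 r. \<forall>t. \<bar>t\<bar> < r \<longrightarrow> norm (u t z - u 0 z) +
      norm (frechet_derivative (u t) (at z) 1 - frechet_derivative (u 0) (at z) 1) +
      norm (frechet_derivative (u t) (at z) \<i> - frechet_derivative (u 0) (at z) \<i>) \<le> C * \<bar>t\<bar>"
    by blast
qed

end

section \<open>Harmonicity\<close>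

lemma has_real_derivative_0_quadratic:
  fixes f :: "real \<Rightarrow> real"
  assumes R: "R > 0" and f: "\<And>t. \<bar>t\<bar> < R \<Longrightarrow> \<bar>f t - f 0\<bar> \<le> Q * t\<^sup>2"
  shows "(f has_real_derivative 0) (at 0)"
proof -
  have "((\<lambda>h. (f (0 + h) - f 0) / h) \<longlongrightarrow> 0) (at 0)"
  proof (rule Lim_null_comparison)
    show "((\<lambda>h. \<bar>Q\<bar> * \<bar>h :: real\<bar>) \<longlongrightarrow> 0) (at 0)" by (auto intro!: tendsto_eq_intros)
    show "\<forall>\<^sub>F h in at 0. norm ((f (0 + h) - f 0) / h) \<le> \<bar>Q\<bar> * \<bar>h\<bar>"
      unfolding eventually_at
    proof (intro exI[of _ R] conjI R ballI impI)
      fix h :: real assume "h \<noteq> 0 \<and> dist h 0 < R"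
      then have h: "h \<noteq> 0" "\<bar>h\<bar> < R" by auto
      have "\<bar>f h - f 0\<bar> \<le> \<bar>Q\<bar> * h\<^sup>2"
        using f[OF h(2)] mult_right_mono[OF abs_ge_self[of Q] zero_le_power2[of h]] by linarith
      also have "\<dots> = \<bar>Q\<bar> * \<bar>h\<bar> * \<bar>h\<bar>" by (simp add: power2_eq_square mult.assoc)
      finally show "norm ((f (0 + h) - f 0) / h) \<le> \<bar>Q\<bar> * \<bar>h\<bar>"
        using h(1) by (simp add: abs_divide divide_le_eq)
    qed
  qed
  then show ?thesis by (simp add: DERIV_def)
qed

text \<open>Ties the partition of unity to the spin structure: over each of its charts
  \<open>S\<close> has a section with square dz, so the lift is available there.\<close>

locale partitioned_eigenspinors =
  eigenspinors A g S \<theta> \<psi> \<mu> + partitioned_surface A g dv I C K \<phi>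
  for A :: "'a::t2_space chart set" and g :: "'a surface_metric"
    and S :: "('a, 's) line_bundle" and \<theta> :: "'s \<Rightarrow> 's \<Rightarrow> 'a covector"
    and \<psi> :: "'m::finite \<Rightarrow> ('a, 's) spinor_field" and \<mu> :: complex
    and dv :: "'a measure" and I :: "'i set" and C :: "'i \<Rightarrow> 'a chart"
    and K :: "'i \<Rightarrow> complex set" and \<phi> :: "'i \<Rightarrow> 'a \<Rightarrow> real" +
  fixes s0 :: "'i \<Rightarrow> 'a \<Rightarrow> 's"
  assumes adapted_C: "\<And>i. i \<in> I \<Longrightarrow> adapted A g S \<theta> (C i) (s0 i)"
begin

text \<open>Self-adjointness of the Dirac operator, by Stokes.\<close>

lemma eigenvalue_real: "Im \<mu> = 0"
proof -
  let ?q = "\<lambda>i. quadratic (s0 i) \<circ> chart_inv (C i)"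
  \<comment> \<open>As \<open>quadratic\<close> is the coefficient of a (1,0)-form, its conjugate
    divided by the conformal factor transforms as a tangent vector. The factor - i makes the
    divergence see the imaginary part of \<open>d_zbar\<close> in place of the real part.\<close>
  let ?X = "\<lambda>i z. - \<i> * cnj (?q i z)"
  have "\<bar>LINT p|dv. Im \<mu>\<bar> \<le> 0 * measure dv UNIV"
  proof (rule divergence_bound[where X="?X"])
    fix i assume i: "i \<in> I"
    show "Ck 1 (snd (C i) ` fst (C i)) (?X i)"
      by (intro Ck_mult Ck_const Ck_bounded_linear[OF _ bounded_linear_cnj] quadratic_smooth adapted_C i
          open_range C_atlas)
  next
    fix i j p assume i: "i \<in> I" "j \<in> I" and p: "p \<in> fst (C i)" "p \<in> fst (C j)"
    let ?a = "deriv (transition (C i) (C j)) (snd (C i) p)"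
    have a: "?a \<noteq> 0" "conf g (C i) p = conf g (C j) p * (cmod ?a)\<^sup>2"
      using hol_transition[OF C_hol[OF i(1)] C_hol[OF i(2)] p] by auto
    have q: "?q i (snd (C i) p) = ?q j (snd (C j) p) * ?a"
      using quadratic_change[OF adapted_C[OF i(1)] adapted_C[OF i(2)] p] p C_atlas i by simp
    have c: "complex_of_real (conf g (C i) p) = of_real (conf g (C j) p) * (?a * cnj ?a)"
      unfolding a(2) of_real_mult complex_norm_square ..
    have "cnj ?a \<noteq> 0" "complex_of_real (conf g (C j) p) \<noteq> 0"
      using a(1) conf_pos[OF C_atlas[OF i(2)] p(2)] by auto
    then show "?a * ?X i (snd (C i) p) / of_real (conf g (C i) p) = ?X j (snd (C j) p) / of_real (conf g (C j) p)"
      unfolding q c using a(1) by (simp add: field_simps del: o_apply)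
  next
    fix i z assume i: "i \<in> I" and z: "z \<in> K i"
    note ad = adapted_C[OF i] and cA = C_atlas[OF i]
    have "z \<in> snd (C i) ` fst (C i)" using z K_sub[OF i] by blast
    then obtain p where p: "p \<in> fst (C i)" "z = snd (C i) p" by blast
    have "?q i differentiable (at z)"
      using Ck_differentiable[OF quadratic_smooth[OF ad, of "Suc 0"]] p by simp
    then have D: "(?q i has_derivative frechet_derivative (?q i) (at z)) (at z)"
      by (simp add: frechet_derivative_works)
    have "(?X i has_derivative (\<lambda>v. - \<i> * cnj (frechet_derivative (?q i) (at z) v))) (at z)"
      by (intro has_derivative_mult_right bounded_linear.has_derivative[OF bounded_linear_cnj] D)
    from frechet_derivative_eqI[OF this]
    have "divergence (?X i) z = - 2 * Im (d_zbar (?q i) z)"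
      by (simp add: divergence_def d_zbar_def)
    also have "\<dots> = conf g (C i) p * Im \<mu>" unfolding p(2) by (rule quadratic_d_zbar[OF ad p(1)])
    finally show "\<bar>divergence (?X i) z - conf g (C i) (chart_inv (C i) z) * Im \<mu>\<bar>
        \<le> 0 * conf g (C i) (chart_inv (C i) z)"
      using p cA by simp
  qed simp
  then show ?thesis using volume_pos by (simp add: space_dv)
qed

text \<open>Carries \<open>laplace_spinor_map_bound\<close> over to the map itself, which agrees
  with the projection of the lift on the open chart image and so has the same derivatives.\<close>

lemma laplace_bound:
  assumes i: "i \<in> I"
  defines "u \<equiv> projline \<circ> spinor_map S \<psi> \<circ> chart_inv (C i)"
  shows "\<exists>B\<ge>0. \<forall>z\<in>K i. \<forall>v. v \<noteq> 0 \<longrightarrow>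
    \<bar>(projmat v - u z) \<bullet> (frechet_derivative (\<lambda>w. frechet_derivative u (at w) 1) (at z) 1 +
      frechet_derivative (\<lambda>w. frechet_derivative u (at w) \<i>) (at z) \<i>)\<bar> \<le> B * (norm (projmat v - u z))\<^sup>2"
proof -
  let ?S = "snd (C i) ` fst (C i)"
  note ad = adapted_C[OF i] and cA = C_atlas[OF i]
  define M where "M = (\<lambda>w. projmat ((lift (s0 i) \<circ> chart_inv (C i)) w))"
  have S: "open ?S" by (rule open_range[OF cA])
  have eq: "u w = M w" if "w \<in> ?S" for w
    unfolding u_def M_def o_apply spinor_map_lift[OF ad chart_inv_in[OF cA that]]
    by (rule projline_hcoord[OF lift_nonzero[OF ad chart_inv_in[OF cA that]]])
  have d1: "frechet_derivative u (at w) v = frechet_derivative M (at w) v" if w: "w \<in> ?S" for w v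
    by (rule fun_cong[OF frechet_derivative_cong_open[OF S w eq]])
  have d2: "frechet_derivative (\<lambda>w. frechet_derivative u (at w) v) (at z) =
      frechet_derivative (\<lambda>w. frechet_derivative M (at w) v) (at z)" if z: "z \<in> ?S" for z v
    by (rule frechet_derivative_cong_open[OF S z d1])
  \<comment> \<open>The constant \<open>l\<close> of the equation for the lift is half the
    eigenvalue.\<close>
  have "\<mu> = of_real (2 * (Re \<mu> / 2))" using eigenvalue_real by (simp add: complex_eq_iff)
  then have "\<exists>B. \<forall>z\<in>K i. \<forall>v. v \<noteq> 0 \<longrightarrow>
    \<bar>(projmat v - M z) \<bullet> (frechet_derivative (\<lambda>w. frechet_derivative M (at w) 1) (at z) 1 +
      frechet_derivative (\<lambda>w. frechet_derivative M (at w) \<i>) (at z) \<i>)\<bar> \<le> B * (norm (projmat v - M z))\<^sup>2"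
    unfolding M_def by (rule laplace_spinor_map_bound[OF _ ad K_compact[OF i] K_sub[OF i]])
  then obtain B where B: "\<forall>z\<in>K i. \<forall>v. v \<noteq> 0 \<longrightarrow>
    \<bar>(projmat v - M z) \<bullet> (frechet_derivative (\<lambda>w. frechet_derivative M (at w) 1) (at z) 1 +
      frechet_derivative (\<lambda>w. frechet_derivative M (at w) \<i>) (at z) \<i>)\<bar> \<le> B * (norm (projmat v - M z))\<^sup>2"
    by (elim exE) (rule that)
  show ?thesis
  proof (intro exI[of _ "\<bar>B\<bar>"] conjI ballI allI impI abs_ge_zero)
    fix z v assume z: "z \<in> K i" and v: "(v :: complex ^ ('m \<times> bool)) \<noteq> 0"
    have zS: "z \<in> ?S" using z K_sub[OF i] by blast
    have "\<bar>(projmat v - M z) \<bullet> (frechet_derivative (\<lambda>w. frechet_derivative M (at w) 1) (at z) 1 +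
      frechet_derivative (\<lambda>w. frechet_derivative M (at w) \<i>) (at z) \<i>)\<bar> \<le> B * (norm (projmat v - M z))\<^sup>2"
      using B[rule_format, OF z v] .
    also have "\<dots> \<le> \<bar>B\<bar> * (norm (projmat v - M z))\<^sup>2" by (intro mult_right_mono) auto
    finally show "\<bar>(projmat v - u z) \<bullet> (frechet_derivative (\<lambda>w. frechet_derivative u (at w) 1) (at z) 1 +
      frechet_derivative (\<lambda>w. frechet_derivative u (at w) \<i>) (at z) \<i>)\<bar> \<le> \<bar>B\<bar> * (norm (projmat v - u z))\<^sup>2"
      unfolding d2[OF zS] eq[OF zS] .
  qed
qed

text \<open>Put D = u - u0. The divergence of the field obtained by pairing D with the gradient of
  u0 is the product of the differentials of D and u0 plus the pairing of D with the Laplacian. The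
  latter is small by assumption, so \<open>divergence_bound\<close> controls the integral of the
  former.\<close>

lemma first_variation_bound:
  fixes u :: "'a \<Rightarrow> complex ^ ('m \<times> bool) ^ ('m \<times> bool)"
  defines "u0 \<equiv> projline \<circ> spinor_map S \<psi>"
  assumes u: "C1 u" and e: "\<And>i z. i \<in> I \<Longrightarrow> z \<in> K i \<Longrightarrow>
    \<bar>(u (chart_inv (C i) z) - u0 (chart_inv (C i) z)) \<bullet>
      (frechet_derivative (\<lambda>w. frechet_derivative (u0 \<circ> chart_inv (C i)) (at w) 1) (at z) 1 +
      frechet_derivative (\<lambda>w. frechet_derivative (u0 \<circ> chart_inv (C i)) (at w) \<i>) (at z) \<i>)\<bar>
     \<le> e * conf g (C i) (chart_inv (C i) z)"
  shows "\<bar>LINT p|dv. grad (\<lambda>p. u p - u0 p) u0 p\<bar> \<le> e * measure dv UNIV"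
proof -
  have u0: "C1 u0" unfolding u0_def by (rule smooth_map_C1[OF smooth_spinor_map])
  let ?d = "\<lambda>p. u p - u0 p"
  have d: "C1 ?d" by (rule C1_diff[OF u u0])
  let ?P = "\<lambda>i v z. frechet_derivative (u0 \<circ> chart_inv (C i)) (at z) v"
  let ?a = "\<lambda>i v z. (?d \<circ> chart_inv (C i)) z \<bullet> ?P i v z"
  \<comment> \<open>That field times the conformal factor, which cancels the inverse factor in the
    gradient: the pairings of \<open>?d\<close> with the two partial derivatives of
    \<open>u0\<close>.\<close>
  let ?X = "\<lambda>i z. complex_of_real (?a i 1 z) + \<i> * complex_of_real (?a i \<i> z)"
  have P: "Ck 1 (snd (C i) ` fst (C i)) (?P i v)" if i: "i \<in> I" for i v
    unfolding u0_def by (rule Ck_frechet[OF smooth_map_Ck[OF smooth_spinor_map C_atlas[OF i]]])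
  have dC: "Ck 1 (snd (C i) ` fst (C i)) (?d \<circ> chart_inv (C i))" if i: "i \<in> I" for i
    using d C_hol[OF i] unfolding C1_def by blast
  show ?thesis
  proof (rule divergence_bound[where X="?X", OF _ _ continuous_grad[OF d u0]])
    fix i assume i: "i \<in> I"
    note o = open_range[OF C_atlas[OF i]]
    have a: "Ck 1 (snd (C i) ` fst (C i)) (?a i v)" for v
      by (rule Ck_bounded_bilinear[OF o bounded_bilinear_inner dC[OF i] P[OF i]])
    show "Ck 1 (snd (C i) ` fst (C i)) (?X i)"
      by (rule Ck_add[OF o Ck_bounded_linear[OF o bounded_linear_of_real a]
           Ck_mult[OF o Ck_const Ck_bounded_linear[OF o bounded_linear_of_real a]]])
  next
    fix i j p assume i: "i \<in> I" "j \<in> I" and p: "p \<in> fst (C i)" "p \<in> fst (C j)"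
    define a where "a = deriv (transition (C i) (C j)) (snd (C i) p)"
    have a: "a \<noteq> 0" "conf g (C i) p = conf g (C j) p * (cmod a)\<^sup>2"
      using hol_transition[OF C_hol[OF i(1)] C_hol[OF i(2)] p] by (auto simp: a_def)
    have dd: "(?d \<circ> chart_inv (C i)) (snd (C i) p) = ?d p" "(?d \<circ> chart_inv (C j)) (snd (C j) p) = ?d p"
      using p C_atlas i by simp_all
    note ch = frechet_chart_change[OF C_hol[OF i(1)] C_hol[OF i(2)] p C1_differentiable[OF u0 C_hol[OF i(2)] p(2)], folded a_def]
    \<comment> \<open>Pairs of partial derivatives, read as complex numbers, transform with the
      conjugate of the derivative of the transition.\<close>
    have X: "?X i (snd (C i) p) = cnj a * ?X j (snd (C j) p)"
      unfolding dd ch inner_add_right inner_scaleR_right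
      by (simp add: complex_eq_iff)
    have c: "complex_of_real (conf g (C i) p) = of_real (conf g (C j) p) * (a * cnj a)"
      unfolding a(2) of_real_mult complex_norm_square ..
    have "cnj a \<noteq> 0" "complex_of_real (conf g (C j) p) \<noteq> 0"
      using a(1) conf_pos[OF C_atlas[OF i(2)] p(2)] by auto
    moreover have "a * (cnj a * x) / (s * (a * cnj a)) = x / s" if "cnj a \<noteq> 0" "s \<noteq> 0" for x s
      using that a(1) by (simp add: field_simps)
    ultimately show "deriv (transition (C i) (C j)) (snd (C i) p) * ?X i (snd (C i) p) / of_real (conf g (C i) p) =
        ?X j (snd (C j) p) / of_real (conf g (C j) p)"
      unfolding X c a_def[symmetric] by blast
  next
    fix i z assume i: "i \<in> I" and z: "z \<in> K i"
    note cA = C_atlas[OF i]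
    have zS: "z \<in> snd (C i) ` fst (C i)" using z K_sub[OF i] by blast
    then obtain p where p: "p \<in> fst (C i)" "z = snd (C i) p" by blast
    have zp: "chart_inv (C i) z = p" using p cA by simp
    let ?D = "\<lambda>v. frechet_derivative (?d \<circ> chart_inv (C i)) (at z) v"
    have Dd: "((?d \<circ> chart_inv (C i)) has_derivative ?D) (at z)"
      by (rule Ck_has_derivative[of 0, OF dC[OF i, unfolded One_nat_def] zS])
    have DP: "(?P i w has_derivative frechet_derivative (?P i w) (at z)) (at z)" for w
      by (rule Ck_has_derivative[of 0, OF P[OF i, unfolded One_nat_def] zS])
    have Da: "(?a i w has_derivative (\<lambda>v. (?d \<circ> chart_inv (C i)) z \<bullet> frechet_derivative (?P i w) (at z) v + ?D v \<bullet> ?P i w z)) (at z)" for w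
      by (rule has_derivative_inner[OF Dd DP])
    have "(?X i has_derivative (\<lambda>v. complex_of_real ((?d \<circ> chart_inv (C i)) z \<bullet> frechet_derivative (?P i 1) (at z) v + ?D v \<bullet> ?P i 1 z) +
       \<i> * complex_of_real ((?d \<circ> chart_inv (C i)) z \<bullet> frechet_derivative (?P i \<i>) (at z) v + ?D v \<bullet> ?P i \<i> z))) (at z)"
      by (rule has_derivative_add[OF bounded_linear.has_derivative[OF bounded_linear_of_real Da]
           has_derivative_mult_right[OF bounded_linear.has_derivative[OF bounded_linear_of_real Da]]])
    from frechet_derivative_eqI[OF this]
    have div: "divergence (?X i) z = (?D 1 \<bullet> ?P i 1 z + ?D \<i> \<bullet> ?P i \<i> z) +
       ?d p \<bullet> (frechet_derivative (?P i 1) (at z) 1 + frechet_derivative (?P i \<i>) (at z) \<i>)"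
      by (simp add: divergence_def inner_add_right zp)
    have s: "conf g (C i) p > 0" by (rule conf_pos[OF cA p(1)])
    have "conf g (C i) p * grad ?d u0 p = ?D 1 \<bullet> ?P i 1 z + ?D \<i> \<bullet> ?P i \<i> z"
      using grad_eq[OF d u0 C_hol[OF i] p(1)] s by (simp add: gradient_inner_def p(2))
    then show "\<bar>divergence (?X i) z - conf g (C i) (chart_inv (C i) z) * grad ?d u0 (chart_inv (C i) z)\<bar>
        \<le> e * conf g (C i) (chart_inv (C i) z)"
      using e[OF i z] unfolding div zp by simp
  qed
qed

text \<open>Both quantities are of second order in \<open>t\<close>: the Dirichlet density of the
  difference because the first derivatives of the difference are O(t), the pairing with the
  Laplacian because \<open>laplace_bound\<close> is quadratic in a difference that is itself O(t).
  As there are finitely many charts, the constants can be shared.\<close>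

lemma variation_constants:
  assumes V: "smooth_variation A (spinor_map S \<psi>) V"
  shows "\<exists>R>0. \<exists>Q\<ge>0. \<forall>t. \<bar>t\<bar> < R \<longrightarrow> smooth_map A (V t) \<and> (\<forall>i\<in>I. \<forall>z\<in>K i.
    gradient_inner g (C i) (\<lambda>p. (projline \<circ> V t) p - (projline \<circ> spinor_map S \<psi>) p)
      (\<lambda>p. (projline \<circ> V t) p - (projline \<circ> spinor_map S \<psi>) p) (chart_inv (C i) z) \<le> Q * t\<^sup>2 \<and>
    \<bar>((projline \<circ> V t) (chart_inv (C i) z) - (projline \<circ> spinor_map S \<psi>) (chart_inv (C i) z)) \<bullet>
      (frechet_derivative (\<lambda>w. frechet_derivative (projline \<circ> spinor_map S \<psi> \<circ> chart_inv (C i)) (at w) 1) (at z) 1 +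
      frechet_derivative (\<lambda>w. frechet_derivative (projline \<circ> spinor_map S \<psi> \<circ> chart_inv (C i)) (at w) \<i>) (at z) \<i>)\<bar>
     \<le> Q * t\<^sup>2 * conf g (C i) (chart_inv (C i) z))"
proof -
  let ?u0 = "projline \<circ> spinor_map S \<psi>"
  let ?L = "\<lambda>i z. frechet_derivative (\<lambda>w. frechet_derivative (?u0 \<circ> chart_inv (C i)) (at w) 1) (at z) 1 +
      frechet_derivative (\<lambda>w. frechet_derivative (?u0 \<circ> chart_inv (C i)) (at w) \<i>) (at z) \<i>"
  let ?d = "\<lambda>t p. (projline \<circ> V t) p - ?u0 p"
  obtain \<epsilon> where \<epsilon>: "\<epsilon> > 0" "\<forall>t. \<bar>t\<bar> < \<epsilon> \<longrightarrow> smooth_map A (V t)"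
    using smooth_variation_smooth_map[OF V] by (elim exE conjE) (rule that)
  have V0: "V 0 = spinor_map S \<psi>" using V by (simp add: smooth_variation_def)
  have loc: "\<exists>R>0. \<exists>Q\<ge>0. \<forall>t. \<bar>t\<bar> < R \<longrightarrow> (\<forall>z\<in>K i.
    gradient_inner g (C i) (?d t) (?d t) (chart_inv (C i) z) \<le> Q * t\<^sup>2 \<and>
    \<bar>?d t (chart_inv (C i) z) \<bullet> ?L i z\<bar> \<le> Q * t\<^sup>2 * conf g (C i) (chart_inv (C i) z))" if i: "i \<in> I" for i
  proof -
    note cA = C_atlas[OF i]
    let ?c = "C i" and ?S = "snd (C i) ` fst (C i)"
    obtain r B where r: "r > 0" and B: "B \<ge> 0" and est: "\<forall>z\<in>K i. \<forall>t. \<bar>t\<bar> < r \<longrightarrow>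
      norm ((projline \<circ> V t \<circ> chart_inv ?c) z - (projline \<circ> V 0 \<circ> chart_inv ?c) z) +
      norm (frechet_derivative (projline \<circ> V t \<circ> chart_inv ?c) (at z) 1 - frechet_derivative (projline \<circ> V 0 \<circ> chart_inv ?c) (at z) 1) +
      norm (frechet_derivative (projline \<circ> V t \<circ> chart_inv ?c) (at z) \<i> - frechet_derivative (projline \<circ> V 0 \<circ> chart_inv ?c) (at z) \<i>) \<le> B * \<bar>t\<bar>"
      using smooth_variation_estimate[OF V cA K_compact[OF i] K_sub[OF i]] by (elim exE conjE) (rule that)
    obtain Q where Q: "Q \<ge> 0" "\<forall>z\<in>K i. \<forall>v. v \<noteq> 0 \<longrightarrow>
        \<bar>(projmat v - (?u0 \<circ> chart_inv ?c) z) \<bullet> ?L i z\<bar> \<le> Q * (norm (projmat v - (?u0 \<circ> chart_inv ?c) z))\<^sup>2"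
      using laplace_bound[OF i] by (elim exE conjE) (rule that)
    have "continuous_on (K i) (\<lambda>z. inverse (conf g ?c (chart_inv ?c z)))"
    proof (intro continuous_on_inverse continuous_on_subset[OF continuous_conf[OF cA] K_sub[OF i]] ballI)
      fix z assume "z \<in> K i"
      then have "z \<in> ?S" using K_sub[OF i] by blast
      from conf_pos[OF cA chart_inv_in[OF cA this]] show "conf g ?c (chart_inv ?c z) \<noteq> 0" by simp
    qed
    then have "bounded ((\<lambda>z. inverse (conf g ?c (chart_inv ?c z))) ` K i)"
      using K_compact[OF i] compact_continuous_image compact_imp_bounded by blast
    then obtain m where m: "\<forall>x\<in>(\<lambda>z. inverse (conf g ?c (chart_inv ?c z))) ` K i. norm x \<le> m"
      unfolding bounded_iff by blast
    let ?m = "\<bar>m\<bar>"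
    \<comment> \<open>\<open>?m\<close> bounds the inverse of the conformal factor on
      \<open>K i\<close>. The first summand of \<open>?Q\<close> serves the two squared derivatives,
      the second the pairing, where 1 is at most \<open>?m\<close> times the conformal
      factor.\<close>
    let ?R = "min r \<epsilon>" and ?Q = "2 * B\<^sup>2 * ?m + Q * B\<^sup>2 * ?m"
    have "gradient_inner g ?c (?d t) (?d t) (chart_inv ?c z) \<le> ?Q * t\<^sup>2 \<and>
      \<bar>?d t (chart_inv ?c z) \<bullet> ?L i z\<bar> \<le> ?Q * t\<^sup>2 * conf g ?c (chart_inv ?c z)"
      if t: "\<bar>t\<bar> < ?R" and z: "z \<in> K i" for t z
    proof -
      have zS: "z \<in> ?S" using z K_sub[OF i] by blast
      then obtain p where p: "p \<in> fst ?c" "z = snd ?c p" by blast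
      have zp: "chart_inv ?c z = p" using p cA by simp
      have tr: "\<bar>t\<bar> < r" "\<bar>t\<bar> < \<epsilon>" using t by auto
      have sm: "smooth_map A (V t)" using \<epsilon>(2) tr by blast
      let ?s = "conf g ?c p"
      have s: "?s > 0" by (rule conf_pos[OF cA p(1)])
      have sm1: "inverse ?s \<le> ?m" using bspec[OF m imageI[OF z]] s by (simp add: zp)
      then have sm2: "1 \<le> ?m * ?s" using s by (simp add: field_simps)
      have Du: "((projline \<circ> V t \<circ> chart_inv ?c) has_derivative frechet_derivative (projline \<circ> V t \<circ> chart_inv ?c) (at z)) (at z)"
        by (rule Ck_has_derivative[OF smooth_map_Ck[OF sm cA] zS])
      have D0: "((?u0 \<circ> chart_inv ?c) has_derivative frechet_derivative (?u0 \<circ> chart_inv ?c) (at z)) (at z)"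
        by (rule Ck_has_derivative[OF smooth_map_Ck[OF smooth_spinor_map cA] zS])
      have "(?d t \<circ> chart_inv ?c) = (\<lambda>z. (projline \<circ> V t \<circ> chart_inv ?c) z - (?u0 \<circ> chart_inv ?c) z)"
        by (simp add: o_def)
      with frechet_derivative_eqI[OF has_derivative_diff[OF Du D0]]
      have Dd: "frechet_derivative (?d t \<circ> chart_inv ?c) (at z) v =
        frechet_derivative (projline \<circ> V t \<circ> chart_inv ?c) (at z) v - frechet_derivative (?u0 \<circ> chart_inv ?c) (at z) v" for v
        by simp
      let ?D = "\<lambda>v. frechet_derivative (?d t \<circ> chart_inv ?c) (at z) v"
      have sumB: "norm (?d t p) + norm (?D 1) + norm (?D \<i>) \<le> B * \<bar>t\<bar>"
        using est[rule_format, OF z tr(1)] unfolding V0 Dd by (simp add: zp)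
      have sq: "x\<^sup>2 \<le> B\<^sup>2 * t\<^sup>2" if "0 \<le> x" "x \<le> B * \<bar>t\<bar>" for x
        using power_mono[OF that(2,1), of 2] by (simp add: power_mult_distrib)
      have nb: "norm (?d t p) \<le> B * \<bar>t\<bar>" "norm (?D 1) \<le> B * \<bar>t\<bar>" "norm (?D \<i>) \<le> B * \<bar>t\<bar>"
        using sumB norm_ge_zero[of "?d t p"] norm_ge_zero[of "?D 1"] norm_ge_zero[of "?D \<i>"] by linarith+
      note n2 = sq[OF norm_ge_zero nb(1)] sq[OF norm_ge_zero nb(2)] sq[OF norm_ge_zero nb(3)]
      have "gradient_inner g ?c (?d t) (?d t) p = ((norm (?D 1))\<^sup>2 + (norm (?D \<i>))\<^sup>2) * inverse ?s"
        by (simp add: gradient_inner_def p(2) power2_norm_eq_inner divide_inverse)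
      also have "\<dots> \<le> (B\<^sup>2 * t\<^sup>2 + B\<^sup>2 * t\<^sup>2) * ?m"
        using n2 sm1 s by (intro mult_mono add_mono) auto
      also have "\<dots> \<le> ?Q * t\<^sup>2"
        using Q(1) by (simp add: algebra_simps)
      finally have 1: "gradient_inner g ?c (?d t) (?d t) p \<le> ?Q * t\<^sup>2" .
      \<comment> \<open>\<open>laplace_bound\<close> speaks of matrices \<open>projmat v\<close>, so
        \<open>V t\<close> is represented at \<open>p\<close> by a local lift.\<close>
      obtain c' F where c': "c' \<in> A" "local_lift c' p (V t) F" using sm unfolding smooth_map_def by blast
      have pc': "p \<in> fst c'" using c'(2) by (simp add: local_lift_def)
      obtain W where W: "snd c' p \<in> W" "\<forall>z\<in>W. (projline \<circ> V t \<circ> chart_inv c') z = projmat (F z)" "F (snd c' p) \<noteq> 0"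
        using local_lift_projline[OF c'] by blast
      have ut: "(projline \<circ> V t) p = projmat (F (snd c' p))"
        using W(2)[rule_format, OF W(1)] c'(1) pc' by simp
      have "\<bar>?d t p \<bullet> ?L i z\<bar> \<le> Q * (norm (?d t p))\<^sup>2"
        using Q(2)[rule_format, OF z W(3)] unfolding ut by (simp add: zp)
      also have "\<dots> \<le> Q * (B\<^sup>2 * t\<^sup>2)" by (rule mult_left_mono[OF n2(1) Q(1)])
      also have "\<dots> \<le> Q * (B\<^sup>2 * t\<^sup>2) * (?m * ?s)"
        using mult_left_mono[OF sm2, of "Q * (B\<^sup>2 * t\<^sup>2)"] Q(1) by simp
      also have "\<dots> \<le> ?Q * t\<^sup>2 * ?s"
        using s by (simp add: algebra_simps)
      finally show ?thesis using 1 unfolding zp by blast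
    qed
    moreover have "?R > 0" "?Q \<ge> 0" using r \<epsilon> Q(1) by auto
    ultimately show ?thesis by blast
  qed
  obtain R Q where RQ: "\<forall>i\<in>I. R i > 0 \<and> Q i \<ge> 0 \<and> (\<forall>t. \<bar>t\<bar> < R i \<longrightarrow> (\<forall>z\<in>K i.
    gradient_inner g (C i) (?d t) (?d t) (chart_inv (C i) z) \<le> Q i * t\<^sup>2 \<and>
    \<bar>?d t (chart_inv (C i) z) \<bullet> ?L i z\<bar> \<le> Q i * t\<^sup>2 * conf g (C i) (chart_inv (C i) z)))"
  proof -
    have "\<forall>i\<in>I. \<exists>x. fst x > 0 \<and> snd x \<ge> 0 \<and> (\<forall>t. \<bar>t\<bar> < fst x \<longrightarrow> (\<forall>z\<in>K i.
      gradient_inner g (C i) (?d t) (?d t) (chart_inv (C i) z) \<le> snd x * t\<^sup>2 \<and>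
      \<bar>?d t (chart_inv (C i) z) \<bullet> ?L i z\<bar> \<le> snd x * t\<^sup>2 * conf g (C i) (chart_inv (C i) z)))"
    proof
      fix i assume "i \<in> I"
      from loc[OF this] obtain R Q where "R > 0" "Q \<ge> 0" "\<forall>t. \<bar>t\<bar> < R \<longrightarrow> (\<forall>z\<in>K i.
        gradient_inner g (C i) (?d t) (?d t) (chart_inv (C i) z) \<le> Q * t\<^sup>2 \<and>
        \<bar>?d t (chart_inv (C i) z) \<bullet> ?L i z\<bar> \<le> Q * t\<^sup>2 * conf g (C i) (chart_inv (C i) z))"
        by (elim exE conjE) (rule that)
      then show "\<exists>x. fst x > 0 \<and> snd x \<ge> 0 \<and> (\<forall>t. \<bar>t\<bar> < fst x \<longrightarrow> (\<forall>z\<in>K i.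
        gradient_inner g (C i) (?d t) (?d t) (chart_inv (C i) z) \<le> snd x * t\<^sup>2 \<and>
        \<bar>?d t (chart_inv (C i) z) \<bullet> ?L i z\<bar> \<le> snd x * t\<^sup>2 * conf g (C i) (chart_inv (C i) z)))"
        by (intro exI[of _ "(R, Q)"]) (simp only: fst_conv snd_conv)
    qed
    from bchoice[OF this] obtain f where "\<forall>i\<in>I. fst (f i) > 0 \<and> snd (f i) \<ge> 0 \<and> (\<forall>t. \<bar>t\<bar> < fst (f i) \<longrightarrow> (\<forall>z\<in>K i.
      gradient_inner g (C i) (?d t) (?d t) (chart_inv (C i) z) \<le> snd (f i) * t\<^sup>2 \<and>
      \<bar>?d t (chart_inv (C i) z) \<bullet> ?L i z\<bar> \<le> snd (f i) * t\<^sup>2 * conf g (C i) (chart_inv (C i) z)))"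
      by (elim exE)
    then show ?thesis by (rule that)
  qed
  define r where "r = Min (insert \<epsilon> (R ` I))"
  \<comment> \<open>A sum of nonnegative constants bounds each of them.\<close>
  define q where "q = sum Q I"
  have r: "r > 0" "r \<le> \<epsilon>" and rR: "\<And>i. i \<in> I \<Longrightarrow> r \<le> R i" using finite_I \<epsilon>(1) RQ by (auto simp: r_def)
  have q: "q \<ge> 0" and qQ: "\<And>i. i \<in> I \<Longrightarrow> Q i \<le> q"
    using finite_I RQ by (auto simp: q_def intro!: sum_nonneg member_le_sum)
  show ?thesis
  proof (rule exI[of _ r], rule conjI[OF r(1)], rule exI[of _ q], intro conjI[OF q] conjI allI impI ballI)
    fix t assume t: "\<bar>t\<bar> < r"
    then have "\<bar>t\<bar> < \<epsilon>" using r by linarith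
    then show "smooth_map A (V t)" using \<epsilon>(2) by blast
    fix i z assume i: "i \<in> I" and z: "z \<in> K i"
    have tR: "\<bar>t\<bar> < R i" using t rR[OF i] by linarith
    have s: "conf g (C i) (chart_inv (C i) z) > 0"
      using conf_pos[OF C_atlas[OF i] chart_inv_in[OF C_atlas[OF i]]] z K_sub[OF i] by blast
    have b: "Q i * t\<^sup>2 \<le> q * t\<^sup>2" by (intro mult_right_mono qQ[OF i]) simp
    have H: "gradient_inner g (C i) (?d t) (?d t) (chart_inv (C i) z) \<le> Q i * t\<^sup>2 \<and>
      \<bar>?d t (chart_inv (C i) z) \<bullet> ?L i z\<bar> \<le> Q i * t\<^sup>2 * conf g (C i) (chart_inv (C i) z)"
      using bspec[OF RQ i] tR z by blast
    show "gradient_inner g (C i) (?d t) (?d t) (chart_inv (C i) z) \<le> q * t\<^sup>2"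
      by (rule order_trans[OF conjunct1[OF H] b])
    show "\<bar>?d t (chart_inv (C i) z) \<bullet> ?L i z\<bar> \<le> q * t\<^sup>2 * conf g (C i) (chart_inv (C i) z)"
      by (rule order_trans[OF conjunct2[OF H] mult_right_mono[OF b less_imp_le[OF s]]])
  qed
qed

text \<open>The factor is the 1 / 2 of the energy times the k / 2 of
  \<open>energy_density_eq\<close>.\<close>

lemma energy_eq:
  assumes "smooth_map A \<Psi>"
  shows "energy A g dv k \<Psi> = k / 4 * (LINT p|dv. grad (projline \<circ> \<Psi>) (projline \<circ> \<Psi>) p)"
  by (simp add: energy_def energy_density_eq[OF assms])

lemma harmonic_spinor_map: "harmonic_map A g dv k (spinor_map S \<psi>)"
  unfolding harmonic_map_def
proof (intro conjI allI impI)
  show sm0: "smooth_map A (spinor_map S \<psi>)" by (rule smooth_spinor_map)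
  fix V assume V: "smooth_variation A (spinor_map S \<psi>) V"
  have V0: "V 0 = spinor_map S \<psi>" using V by (simp add: smooth_variation_def)
  let ?w = "projline \<circ> spinor_map S \<psi>"
  let ?d = "\<lambda>t p. (projline \<circ> V t) p - ?w p"
  obtain R Q where R: "R > 0" and Q: "Q \<ge> 0" and RQ: "\<forall>t. \<bar>t\<bar> < R \<longrightarrow> smooth_map A (V t) \<and> (\<forall>i\<in>I. \<forall>z\<in>K i.
    gradient_inner g (C i) (?d t) (?d t) (chart_inv (C i) z) \<le> Q * t\<^sup>2 \<and>
    \<bar>?d t (chart_inv (C i) z) \<bullet>
      (frechet_derivative (\<lambda>w. frechet_derivative (?w \<circ> chart_inv (C i)) (at w) 1) (at z) 1 +
      frechet_derivative (\<lambda>w. frechet_derivative (?w \<circ> chart_inv (C i)) (at w) \<i>) (at z) \<i>)\<bar>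
     \<le> Q * t\<^sup>2 * conf g (C i) (chart_inv (C i) z))"
    using variation_constants[OF V] by (elim exE conjE) (rule that)
  have u0: "C1 ?w" by (rule smooth_map_C1[OF sm0])
  let ?vol = "measure dv UNIV"
  show "((\<lambda>t. energy A g dv k (V t)) has_real_derivative 0) (at 0)"
  proof (rule has_real_derivative_0_quadratic[OF R])
    fix t assume t: "\<bar>t\<bar> < R"
    have smt: "smooth_map A (V t)" using RQ t by blast
    let ?u = "projline \<circ> V t"
    have u: "C1 ?u" by (rule smooth_map_C1[OF smt])
    have d: "C1 (?d t)" by (rule C1_diff[OF u u0])
    have int: "integrable dv (grad x y)" if "C1 x" "C1 y" for x y :: "'a \<Rightarrow> complex ^ ('m \<times> bool) ^ ('m \<times> bool)"
      by (rule integrable_continuous[OF continuous_grad[OF that]])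
    have dd: "0 \<le> grad (?d t) (?d t) p \<and> grad (?d t) (?d t) p \<le> Q * t\<^sup>2" for p
    proof -
      obtain i z where i: "i \<in> I" and z: "z \<in> K i" and p: "p = chart_inv (C i) z" using K_cover by blast
      have zS: "z \<in> snd (C i) ` fst (C i)" using z K_sub[OF i] by blast
      have pf: "p \<in> fst (C i)" using chart_inv_in[OF C_atlas[OF i] zS] by (simp add: p)
      have "gradient_inner g (C i) (?d t) (?d t) p \<le> Q * t\<^sup>2"
        using RQ t i z unfolding p by blast
      moreover have "0 \<le> gradient_inner g (C i) (?d t) (?d t) p"
        using conf_pos[OF C_atlas[OF i] pf] unfolding gradient_inner_def by (intro divide_nonneg_pos add_nonneg_nonneg inner_ge_zero)
      ultimately show ?thesis unfolding grad_eq[OF d d C_hol[OF i] pf] by blast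
    qed
    have "(LINT p|dv. grad (?d t) (?d t) p) \<le> (LINT p|dv. Q * t\<^sup>2)"
      using dd by (intro integral_mono int d) auto
    moreover have "0 \<le> (LINT p|dv. grad (?d t) (?d t) p)" using dd by simp
    ultimately have 1: "\<bar>LINT p|dv. grad (?d t) (?d t) p\<bar> \<le> Q * t\<^sup>2 * ?vol" by (simp add: space_dv mult_ac)
    have 2: "\<bar>LINT p|dv. grad (?d t) ?w p\<bar> \<le> Q * t\<^sup>2 * ?vol"
      by (rule first_variation_bound[OF u]) (use RQ t in blast)
    have "(LINT p|dv. grad ?u ?u p) - (LINT p|dv. grad ?w ?w p) = (LINT p|dv. grad ?u ?u p - grad ?w ?w p)"
      by (rule Bochner_Integration.integral_diff[symmetric]) (intro int u u0)+
    also have "\<dots> = (LINT p|dv. grad (?d t) (?d t) p + 2 * grad (?d t) ?w p)"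
      unfolding grad_diff[OF u u0] ..
    also have "\<dots> = (LINT p|dv. grad (?d t) (?d t) p) + 2 * (LINT p|dv. grad (?d t) ?w p)"
      using int[OF d d] int[OF d u0] by simp
    finally have diff: "(LINT p|dv. grad ?u ?u p) - (LINT p|dv. grad ?w ?w p) =
      (LINT p|dv. grad (?d t) (?d t) p) + 2 * (LINT p|dv. grad (?d t) ?w p)" .
    \<comment> \<open>One share comes from the energy of the difference, two from the cross term,
      which enters twice.\<close>
    have b: "\<bar>(LINT p|dv. grad ?u ?u p) - (LINT p|dv. grad ?w ?w p)\<bar> \<le> 3 * (Q * t\<^sup>2 * ?vol)"
      unfolding diff using 1 2 by linarith
    have "energy A g dv k (V t) - energy A g dv k (V 0) =
       k / 4 * ((LINT p|dv. grad ?u ?u p) - (LINT p|dv. grad ?w ?w p))"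
      unfolding energy_eq[OF smt] V0 energy_eq[OF sm0] by (simp add: right_diff_distrib)
    then have "\<bar>energy A g dv k (V t) - energy A g dv k (V 0)\<bar> =
       \<bar>k / 4\<bar> * \<bar>(LINT p|dv. grad ?u ?u p) - (LINT p|dv. grad ?w ?w p)\<bar>"
      by (simp only: abs_mult)
    also have "\<dots> \<le> \<bar>k / 4\<bar> * (3 * (Q * t\<^sup>2 * ?vol))"
      by (rule mult_left_mono[OF b abs_ge_zero])
    also have "\<dots> = (\<bar>k / 4\<bar> * 3 * Q * ?vol) * t\<^sup>2" by (simp add: mult_ac)
    finally show "\<bar>energy A g dv k (V t) - energy A g dv k (V 0)\<bar> \<le> (\<bar>k / 4\<bar> * 3 * Q * ?vol) * t\<^sup>2" .
  qed
qed

end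

theorem theorem1p6:
  fixes A :: "'a::t2_space chart set"
    and g :: "'a surface_metric"
    and dv :: "'a measure"
    and S :: "('a, 's) line_bundle"
    and \<theta> :: "'s \<Rightarrow> 's \<Rightarrow> 'a covector"
    and \<psi> :: "'m::finite \<Rightarrow> ('a, 's) spinor_field"
    and \<mu> :: complex
    and k :: real
  assumes "compact (UNIV :: 'a set)"
    and "oriented_smooth_structure A"
    and "riemannian_metric A g"
    and "riemannian_measure A g dv"
    and complex_structure: "(\<Union>c\<in>hol_charts A g. fst c) = UNIV"
    and "spin_structure A g S \<theta>"
    and "\<And>j. smooth_spinor A S (\<psi> j)"
    and "\<And>j p. dirac A g S \<theta> (\<psi> j) p = spinor_scl S \<mu> (\<psi> j p)"
    and "\<mu> \<noteq> 0"
    and "\<And>p. (\<Sum>j\<in>UNIV. spinor_norm_sq A g S \<theta> (\<psi> j p)) = 1"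
    and "k > 0"
  shows "harmonic_map A g dv k (spinor_map S \<psi>)"
proof -
  interpret eigenspinors A g S \<theta> \<psi> \<mu>
    by unfold_locales (use assms in auto)
  interpret compact_surface A g dv
    by unfold_locales (use assms in auto)
  \<comment> \<open>An adapted chart with its section is chosen at every point, and the partition of
    unity is made subordinate to these charts.\<close>
  have "\<forall>p. \<exists>x. adapted A g S \<theta> (fst x) (snd x) \<and> p \<in> fst (fst x)"
    using adapted_exists by (metis fst_conv snd_conv)
  then obtain f where f: "\<And>p. adapted A g S \<theta> (fst (f p)) (snd (f p))" "\<And>p. p \<in> fst (fst (f p))"
    by metis
  show ?thesis
  proof (rule partition_of_unity[of "\<lambda>p. fst (f p)", OF adapted_hol[OF f(1)] f(2)])
    fix I :: "'a set" and K and \<phi> :: "'a \<Rightarrow> 'a \<Rightarrow> real"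
    assume "finite I"
      and "\<And>i. i \<in> I \<Longrightarrow> compact (K i)"
      and "\<And>i. i \<in> I \<Longrightarrow> K i \<subseteq> snd (fst (f i)) ` fst (fst (f i))"
      and "\<And>i q. i \<in> I \<Longrightarrow> q \<notin> chart_inv (fst (f i)) ` K i \<Longrightarrow> \<phi> i q = 0"
      and "\<And>i q. i \<in> I \<Longrightarrow> 0 \<le> \<phi> i q"
      and "\<And>q. (\<Sum>i\<in>I. \<phi> i q) = 1"
      and "\<And>i c. i \<in> I \<Longrightarrow> c \<in> A \<Longrightarrow> Ck 1 (snd c ` fst c) (\<phi> i \<circ> chart_inv c)"
    then interpret partitioned_eigenspinors A g S \<theta> \<psi> \<mu> dv I "\<lambda>p. fst (f p)" K \<phi> "\<lambda>p. snd (f p)"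
      by unfold_locales (simp_all add: f(1) adapted_hol[OF f(1)] del: Ck.simps One_nat_def)
    show "harmonic_map A g dv k (spinor_map S \<psi>)" by (rule harmonic_spinor_map)
  qed
qed

end
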